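(* Let $\Gamma\curvearrowright (X,\mu)$ be a p.m.p. action of a countable group $\Gamma$ on a standard probability space, admitting a factor action $\Gamma\curvearrowright (Y,\nu)$ such that the Koopman representation $\kappa_0$ of $\Gamma$ on $L^2_0(Y)$ is not amenable. Then the restriction of the action $\Gamma\curvearrowright (X,\mu)$ to any measurable $\Gamma$-invariant set $X_0\subset X$ with $\mu(X_0)=1$ is antimodular.
   Context: A p.m.p. action $\Gamma\curvearrowright (X,\mu)$ is a Borel action of a countable group $\Gamma$ on a standard Borel space $X$ preserving the Borel probability measure $\mu$. A factor action is a p.m.p. action $\Gamma\curvearrowright (Y,\nu)$ on a standard probability space together with a measurable measure preserving map $X\to Y$ that is $\Gamma$-equivariant almost everywhere. $L^2_0(Y)=L^2(Y)\ominus\mathbb C\mathbf 1_Y$, and the Koopman representation of $\Gamma$ on it is the unitary representation induced by the action on $Y$. A unitary representation $\pi:\Gamma\to\mathcal U(\mathcal H)$ on a Hilbert space $\mathcal H$ has spectral gap if there is no sequence of unit vectors $\xi_n\in\mathcal H$ such that $\|\pi(g)(\xi_n)-\xi_n\|\to 0$ for all $g\in\Gamma$. A unitary representation $\pi$ is not amenable (in the sense of Bekka) if $\pi\otimes\bar\pi$ has spectral gap, where $\bar\pi$ is the conjugate representation. For a Borel action $\Gamma\curvearrowright X$ of a countable group, $\mathcal R(\Gamma\curvearrowright X)=\{(x_1,x_2)\in X\times X : \Gamma\cdot x_1=\Gamma\cdot x_2\}$ is its orbit equivalence relation. A homomorphism from an equivalence relation $\mathcal R$ on $X$ to an equivalence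 relation $\mathcal S$ on $Z$ is a map $\alpha:X\to Z$ with $(\alpha\times\alpha)(\mathcal R)\subset\mathcal S$; it is countable-to-one if every point of $Z$ has countable preimage. A Borel action $\Delta\curvearrowright Z$ of a countable group on a standard Borel space is modular if there exists a sequence $\{\mathcal P_n\}$ of countable Borel partitions of $Z$ which separates points in $Z$, such that each $\mathcal P_n$ is $\Delta$-invariant (i.e., its pieces are permuted by $\Delta$). A Borel action $\Gamma\curvearrowright X$ is antimodular if there does not exist a countable-to-one Borel homomorphism from $\mathcal R(\Gamma\curvearrowright X)$ to $\mathcal R(\Delta\curvearrowright Z)$, for any modular action $\Delta\curvearrowright Z$ of a countable group $\Delta$. For the restriction to $X_0$, the relative Borel structure on $X_0$ is used.
   Formalization: The formal statement additionally assumes that L^2_0(Y) is nonzero; for a one-point factor Y the zero representation is vacuously "not amenable" and the claim fails, e.g. for the 2-adic odometer, which is itself modular. *)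

theory Defs
  imports "HOL-Probability.Probability" "HOL-Algebra.Group_Action"
begin

section \<open>Borel actions and orbit equivalence relations\<close>

definition standard_borel :: "'x measure \<Rightarrow> bool" where
  "standard_borel M \<longleftrightarrow>
    (\<exists>T. completely_metrizable_space T \<and> second_countable T \<and> topspace T = space M \<and>
         sets M = sigma_sets (space M) {U. openin T U})"

text \<open>Countable groups are discrete, so an action is Borel as soon as each group element acts by
  a Borel map. The underlying space is not required to be standard here; only the measurable
  structure of the argument \<open>M\<close> is used.\<close>

definition borel_action :: "('g, 'm) monoid_scheme \<Rightarrow> 'x measure \<Rightarrow> ('g \<Rightarrow> 'x \<Rightarrow> 'x) \<Rightarrow> bool" where
  "borel_action G M \<phi> \<longleftrightarrow>
    countable (carrier G) \<and> group_action G (space M) \<phi> \<and> (\<forall>g\<in>carrier G. \<phi> g \<in> M \<rightarrow>\<^sub>M M)"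

definition pmp_action :: "('g, 'm) monoid_scheme \<Rightarrow> 'x measure \<Rightarrow> ('g \<Rightarrow> 'x \<Rightarrow> 'x) \<Rightarrow> bool" where
  "pmp_action G M \<phi> \<longleftrightarrow>
    standard_borel M \<and> prob_space M \<and> borel_action G M \<phi> \<and>
    (\<forall>g\<in>carrier G. distr M M (\<phi> g) = M)"

text \<open>Factor maps are only required to be measurable with respect to the completed measure on the
  domain; this includes all Borel maps.\<close>

definition factor_map ::
  "('g, 'm) monoid_scheme \<Rightarrow> 'x measure \<Rightarrow> ('g \<Rightarrow> 'x \<Rightarrow> 'x) \<Rightarrow>
   'y measure \<Rightarrow> ('g \<Rightarrow> 'y \<Rightarrow> 'y) \<Rightarrow> ('x \<Rightarrow> 'y) \<Rightarrow> bool" where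
  "factor_map G M \<phi> N \<psi> p \<longleftrightarrow>
    p \<in> completion M \<rightarrow>\<^sub>M N \<and> distr (completion M) N p = N \<and>
    (\<forall>g\<in>carrier G. AE x in M. p (\<phi> g x) = \<psi> g (p x))"

definition orbit_eqrel ::
  "('g, 'm) monoid_scheme \<Rightarrow> 'x measure \<Rightarrow> ('g \<Rightarrow> 'x \<Rightarrow> 'x) \<Rightarrow> ('x \<times> 'x) set" where
  "orbit_eqrel G M \<phi> =
    {(x1, x2) \<in> space M \<times> space M. Group_Action.orbit G \<phi> x1 = Group_Action.orbit G \<phi> x2}"

definition countable_to_one_borel_hom ::
  "'x measure \<Rightarrow> ('x \<times> 'x) set \<Rightarrow> 'z measure \<Rightarrow> ('z \<times> 'z) set \<Rightarrow> ('x \<Rightarrow> 'z) \<Rightarrow> bool" where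
  "countable_to_one_borel_hom M R N S \<alpha> \<longleftrightarrow>
    \<alpha> \<in> M \<rightarrow>\<^sub>M N \<and> map_prod \<alpha> \<alpha> ` R \<subseteq> S \<and>
    (\<forall>z\<in>space N. countable (\<alpha> -` {z} \<inter> space M))"

definition modular_action ::
  "('d, 'm) monoid_scheme \<Rightarrow> 'z measure \<Rightarrow> ('d \<Rightarrow> 'z \<Rightarrow> 'z) \<Rightarrow> bool" where
  "modular_action D N \<psi> \<longleftrightarrow>
    standard_borel N \<and> borel_action D N \<psi> \<and>
    (\<exists>P :: nat \<Rightarrow> 'z set set.
      (\<forall>n. partition_on (space N) (P n) \<and> countable (P n) \<and> P n \<subseteq> sets N) \<and>
      (\<forall>n. \<forall>d\<in>carrier D. \<forall>A\<in>P n. \<psi> d ` A \<in> P n) \<and>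
      (\<forall>z\<in>space N. \<forall>z'\<in>space N. z \<noteq> z' \<longrightarrow> (\<exists>n. \<exists>A\<in>P n. z \<in> A \<and> z' \<notin> A)))"

text \<open>The two type arguments are the types on which the groups \<open>D\<close> and the spaces \<open>N\<close> live. A
  definition cannot quantify over types; antimodularity means that the predicate holds for all of
  them, so they are to be left as free type variables.\<close>

definition antimodular ::
  "'d itself \<Rightarrow> 'z itself \<Rightarrow> ('g, 'm) monoid_scheme \<Rightarrow> 'x measure \<Rightarrow> ('g \<Rightarrow> 'x \<Rightarrow> 'x) \<Rightarrow> bool" where
  "antimodular _ _ G M \<phi> \<longleftrightarrow>
    \<not> (\<exists>(D :: 'd monoid) (N :: 'z measure) \<psi> \<alpha>.
        modular_action D N \<psi> \<and>
        countable_to_one_borel_hom M (orbit_eqrel G M \<phi>) N (orbit_eqrel D N \<psi>) \<alpha>)"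


section \<open>Complex Hilbert spaces\<close>

record 'a hspace =
  hcarrier :: "'a set"
  hzero :: 'a
  hadd :: "'a \<Rightarrow> 'a \<Rightarrow> 'a"
  hscale :: "complex \<Rightarrow> 'a \<Rightarrow> 'a"
  hinner :: "'a \<Rightarrow> 'a \<Rightarrow> complex"

text \<open>Inner products are linear in the first argument.\<close>

definition hnorm :: "'a hspace \<Rightarrow> 'a \<Rightarrow> real" where
  "hnorm H x = sqrt (Re (hinner H x x))"

definition hdiff :: "'a hspace \<Rightarrow> 'a \<Rightarrow> 'a \<Rightarrow> 'a" where
  "hdiff H x y = hadd H x (hscale H (-1) y)"

definition conj_hspace :: "'a hspace \<Rightarrow> 'a hspace" where
  "conj_hspace H = H\<lparr>hscale := \<lambda>c. hscale H (cnj c), hinner := \<lambda>x y. hinner H y x\<rparr>"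

text \<open>Hausdorff completion of a space with a positive semidefinite form: Cauchy sequences modulo
  sequences of null distance. Points at distance zero become equal.\<close>

definition hcauchy :: "'a hspace \<Rightarrow> (nat \<Rightarrow> 'a) \<Rightarrow> bool" where
  "hcauchy H s \<longleftrightarrow>
    (\<forall>n. s n \<in> hcarrier H) \<and> (\<forall>e>0. \<exists>N. \<forall>m\<ge>N. \<forall>n\<ge>N. hnorm H (hdiff H (s m) (s n)) < e)"

definition hclass :: "'a hspace \<Rightarrow> (nat \<Rightarrow> 'a) \<Rightarrow> (nat \<Rightarrow> 'a) set" where
  "hclass H s = {t. hcauchy H t \<and> (\<lambda>n. hnorm H (hdiff H (s n) (t n))) \<longlonglongrightarrow> 0}"

definition rep :: "'b set \<Rightarrow> 'b" where
  "rep A = (SOME a. a \<in> A)"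

definition hcompletion :: "'a hspace \<Rightarrow> (nat \<Rightarrow> 'a) set hspace" where
  "hcompletion H =
    \<lparr>hcarrier = {hclass H s |s. hcauchy H s},
     hzero = hclass H (\<lambda>_. hzero H),
     hadd = \<lambda>A B. hclass H (\<lambda>n. hadd H (rep A n) (rep B n)),
     hscale = \<lambda>c A. hclass H (\<lambda>n. hscale H c (rep A n)),
     hinner = \<lambda>A B. lim (\<lambda>n. hinner H (rep A n) (rep B n))\<rparr>"

text \<open>The list \<open>[(x\<^sub>1, y\<^sub>1), \<dots>, (x\<^sub>k, y\<^sub>k)]\<close> stands for \<open>x\<^sub>1 \<otimes> y\<^sub>1 + \<dots> + x\<^sub>k \<otimes> y\<^sub>k\<close>. Lists become a
  vector space, namely the algebraic tensor product, only after identifying those at distance zero;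
  this identification is part of \<open>hcompletion\<close>.\<close>

definition formal_tensors :: "'a hspace \<Rightarrow> 'b hspace \<Rightarrow> ('a \<times> 'b) list hspace" where
  "formal_tensors H K =
    \<lparr>hcarrier = lists (hcarrier H \<times> hcarrier K),
     hzero = [],
     hadd = (@),
     hscale = \<lambda>c. map (\<lambda>(x, y). (hscale H c x, y)),
     hinner = \<lambda>u v. \<Sum>(x, y)\<leftarrow>u. \<Sum>(x', y')\<leftarrow>v. hinner H x x' * hinner K y y'\<rparr>"

definition tensor_hspace :: "'a hspace \<Rightarrow> 'b hspace \<Rightarrow> (nat \<Rightarrow> ('a \<times> 'b) list) set hspace" where
  "tensor_hspace H K = hcompletion (formal_tensors H K)"


section \<open>Unitary representations\<close>

definition tensor_rep ::
  "'a hspace \<Rightarrow> ('g \<Rightarrow> 'a \<Rightarrow> 'a) \<Rightarrow> 'b hspace \<Rightarrow> ('g \<Rightarrow> 'b \<Rightarrow> 'b) \<Rightarrow>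
   'g \<Rightarrow> (nat \<Rightarrow> ('a \<times> 'b) list) set \<Rightarrow> (nat \<Rightarrow> ('a \<times> 'b) list) set" where
  "tensor_rep H \<pi> K \<rho> g A =
    hclass (formal_tensors H K) (\<lambda>n. map (map_prod (\<pi> g) (\<rho> g)) (rep A n))"

definition spectral_gap ::
  "('g, 'm) monoid_scheme \<Rightarrow> 'a hspace \<Rightarrow> ('g \<Rightarrow> 'a \<Rightarrow> 'a) \<Rightarrow> bool" where
  "spectral_gap G H \<pi> \<longleftrightarrow>
    \<not> (\<exists>\<xi> :: nat \<Rightarrow> 'a.
        (\<forall>n. \<xi> n \<in> hcarrier H \<and> hnorm H (\<xi> n) = 1) \<and>
        (\<forall>g\<in>carrier G. (\<lambda>n. hnorm H (hdiff H (\<pi> g (\<xi> n)) (\<xi> n))) \<longlonglongrightarrow> 0))"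

text \<open>The conjugate representation consists of the same maps as \<open>\<pi>\<close>, acting on the conjugate space.\<close>

definition amenable_rep ::
  "('g, 'm) monoid_scheme \<Rightarrow> 'a hspace \<Rightarrow> ('g \<Rightarrow> 'a \<Rightarrow> 'a) \<Rightarrow> bool" where
  "amenable_rep G H \<pi> \<longleftrightarrow>
    \<not> spectral_gap G (tensor_hspace H (conj_hspace H)) (tensor_rep H \<pi> (conj_hspace H) \<pi>)"


section \<open>The Koopman representation\<close>

definition L2_fun :: "'y measure \<Rightarrow> ('y \<Rightarrow> complex) set" where
  "L2_fun M = {f \<in> borel_measurable M. integrable M (\<lambda>x. (cmod (f x))\<^sup>2)}"

definition ae_class :: "'y measure \<Rightarrow> ('y \<Rightarrow> complex) \<Rightarrow> ('y \<Rightarrow> complex) set" where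
  "ae_class M f = {g \<in> borel_measurable M. AE x in M. f x = g x}"

definition L2 :: "'y measure \<Rightarrow> ('y \<Rightarrow> complex) set hspace" where
  "L2 M =
    \<lparr>hcarrier = ae_class M ` L2_fun M,
     hzero = ae_class M (\<lambda>_. 0),
     hadd = \<lambda>A B. ae_class M (\<lambda>x. rep A x + rep B x),
     hscale = \<lambda>c A. ae_class M (\<lambda>x. c * rep A x),
     hinner = \<lambda>A B. \<integral>x. rep A x * cnj (rep B x) \<partial>M\<rparr>"

definition L2_0 :: "'y measure \<Rightarrow> ('y \<Rightarrow> complex) set hspace" where
  "L2_0 M =
    (L2 M)\<lparr>hcarrier := {A \<in> hcarrier (L2 M). hinner (L2 M) A (ae_class M (\<lambda>_. 1)) = 0}\<rparr>"

definition koopman ::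
  "('g, 'm) monoid_scheme \<Rightarrow> 'y measure \<Rightarrow> ('g \<Rightarrow> 'y \<Rightarrow> 'y) \<Rightarrow>
   'g \<Rightarrow> ('y \<Rightarrow> complex) set \<Rightarrow> ('y \<Rightarrow> complex) set" where
  "koopman G M \<psi> g A = ae_class M (\<lambda>y. rep A (\<psi> (inv\<^bsub>G\<^esub> g) y))"

end

theory Submission
  imports Defs
begin

text \<open>Suppose \<open>\<alpha>\<close> is a countable-to-one homomorphism to a modular action, and label a point \<open>x\<close> at
  level \<open>n\<close> by the pieces of the first \<open>n\<close> invariant partitions that contain \<open>\<alpha> x\<close>. As the fibres of
  \<open>\<alpha>\<close> are countable, one further countable label \<open>i\<close> makes the resulting partitions generate the
  \<open>\<sigma>\<close>-algebra modulo null sets. Each group element \<open>g\<close> cuts the space into countably many pieces, on each of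
  which it permutes the partition classes of all levels: \<open>\<alpha> (g x) = d (\<alpha> x)\<close> and \<open>i (g x) = j\<close> for
  fixed \<open>d\<close> and \<open>j\<close>. These pieces are eventually almost unions of classes, so the relatively
  independent self-joinings of \<open>\<mu>\<close> over the partitions are asymptotically \<open>g\<close>-invariant in total
  variation. They concentrate on the diagonal.

  Their images on \<open>Y \<times> Y\<close> have densities \<open>h\<^sub>n\<close> that are asymptotically invariant in \<open>L\<^sup>1\<close>, hence
  the unit vectors \<open>\<surd>h\<^sub>n\<close> are asymptotically invariant in \<open>L\<^sup>2\<close>. Because \<open>\<surd>h\<^sub>n\<close> is nonnegative and concentrates on
  \<open>A \<times> A \<union> A\<^sup>c \<times> A\<^sup>c\<close> for a set \<open>A\<close> of measure strictly between 0 and 1, it stays away from functions of the form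
  \<open>a x + b y\<close>. Its projections to \<open>L\<^sup>2\<^sub>0 \<otimes> L\<^sup>2\<^sub>0\<close> therefore do not vanish asymptotically, and normalising
  them shows that the Koopman representation is amenable.\<close>

text \<open>Countability of the fibres enters only through the label \<open>i\<close>. Conditional
  measures on countable sets are purely atomic, so for almost every \<open>x\<close> the masses of
  the basic cells around \<open>x\<close> stay above some positive rational \<open>r\<close>, and
  one of these cells has mass below \<open>2 * r\<close>. Within a fibre such a cell and such an
  \<open>r\<close> single out \<open>x\<close>, and there are only countably many such pairs.
  Atomicity is obtained from conditional expectations of cells alone: on a set where cells and
  labels behave continuously, a branch of cells of positive conditional mass ends in a point of the
  fibre, whereas a mass without atoms would produce a branch that misses all of the countably many
  points.

  Square roots turn L1 invariance into L2 invariance because (p - q)^2 <= |p^2 - q^2| for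
  nonnegative p and q. They are replaced by finite combinations of rectangles, which become finite
  lists of elementary tensors after centring. \<open>X0\<close> and the factor map are only
  measurable for the completed measure, so the joinings live on
  \<open>completion \<mu>\<close>.\<close>

section \<open>Standard Borel spaces\<close>

text \<open>The coordinates are the distances to a dense sequence, which embed the space
  homeomorphically in the Polish space of real sequences. Complete metrizability makes the image a
  G-delta set, so Borel sets go to Borel sets. This gives access to inner regularity.\<close>

lemma standard_borel_embedding:
  assumes "standard_borel M"
  obtains e :: "'x \<Rightarrow> nat \<Rightarrow> real" where
    "e \<in> borel_measurable M" "inj_on e (space M)" "\<And>B. B \<in> sets M \<Longrightarrow> e ` B \<in> sets borel"
proof (cases "space M = {}")
  case True
  show thesis
  proof (rule that[of "\<lambda>_ _. 0"])
    show "(\<lambda>_ _. 0) ` B \<in> sets borel" if "B \<in> sets M" for B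
      using sets.sets_into_space[OF that] True by auto
  qed (use True in auto)
next
  case False
  obtain T where T: "completely_metrizable_space T" "second_countable T" "topspace T = space M"
    and sM: "sets M = sigma_sets (space M) {U. openin T U}"
    using assms unfolding standard_borel_def by blast
  obtain X d where "Metric_space X d" and Td: "T = Metric_space.mtopology X d"
    using T(1) unfolding completely_metrizable_space_def by blast
  then interpret Metric_space X d by blast
  have X: "X = space M" using T(3) Td by simp
  obtain Q where Q: "countable Q" "Q \<subseteq> topspace T" "T closure_of Q = topspace T"
    using second_countable_imp_separable_space[OF T(2)] unfolding separable_space_def by blast
  have "Q \<noteq> {}" using Q False T(3) by auto
  define q where "q = from_nat_into Q"
  have rq: "range q = Q" using \<open>Q \<noteq> {}\<close> Q(1) by (simp add: q_def range_from_nat_into)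
  have qX: "q k \<in> X" for k using rq Q(2) T(3) X by blast
  have dense: "\<exists>k. d x (q k) < r" if "x \<in> X" "r > 0" for x r
  proof -
    have "x \<in> mtopology closure_of Q" using that Q(3) Td by simp
    then have "\<exists>y\<in>Q. y \<in> mball x r" using that by (auto simp: metric_closure_of)
    then obtain y where "y \<in> Q" "y \<in> mball x r" by blast
    then show ?thesis using rq by (auto simp: in_mball)
  qed
  define e where "e x k = d x (q k)" for x k
  \<comment> \<open>A single coordinate detects closeness: \<open>e x' k\<close> is below
    \<open>2 * r / 3\<close>, and adding \<open>d x (q k)\<close> stays below \<open>r\<close>.
    Injectivity of \<open>e\<close> and openness onto its image both rest on this.\<close>
  have near: "d x x' < r" if "x \<in> X" "x' \<in> X" "d x (q k) < r / 3" "\<bar>e x' k - e x k\<bar> < r / 3" for x x' r k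
  proof -
    have "d x x' \<le> d x (q k) + d (q k) x'" using triangle that(1,2) qX by blast
    moreover have "d (q k) x' = d x' (q k)" by (simp add: commute)
    ultimately show ?thesis using that(3,4) unfolding e_def by linarith
  qed
  have inj: "inj_on e X"
  proof (rule inj_onI, rule ccontr)
    fix x y assume xy: "x \<in> X" "y \<in> X" "e x = e y" "x \<noteq> y"
    then have "d x y > 0" by simp
    then obtain k where "d x (q k) < d x y / 3" using dense[of x "d x y / 3"] xy by auto
    from near[OF xy(1,2) this] xy(3) \<open>d x y > 0\<close> show False by simp
  qed
  have cont: "continuous_map T euclidean e"
  proof -
    have "continuous_map T euclidean (\<lambda>x. e x k)" for k
    proof -
      have *: "\<bar>d x (q k) - d y (q k)\<bar> \<le> d y x" if "x \<in> X" "y \<in> X" for x y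
        using triangle[of x y "q k"] triangle[of y x "q k"] that qX[of k] by (simp add: commute)
      have "continuous_map mtopology euclidean (\<lambda>x. d x (q k))"
        unfolding continuous_map_from_metric open_openin[symmetric]
      proof (intro conjI ballI allI impI)
        fix a U assume a: "a \<in> X" and U: "open U \<and> d a (q k) \<in> U"
        then obtain r where r: "r > 0" "\<And>t. \<bar>t - d a (q k)\<bar> < r \<Longrightarrow> t \<in> U"
          unfolding open_dist dist_real_def by blast
        then show "\<exists>r>0. \<forall>x. x \<in> X \<and> d a x < r \<longrightarrow> d x (q k) \<in> U"
          by (meson * a le_less_trans)
      qed auto
      then show ?thesis by (simp add: e_def Td)
    qed
    then have "continuous_map T (product_topology (\<lambda>_. euclidean) UNIV) e"
      by (simp add: continuous_map_componentwise_UNIV)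
    then show ?thesis by (simp add: euclidean_product_topology)
  qed
  have opn: "\<exists>V. open V \<and> e ` U = e ` X \<inter> V" if U: "openin T U" for U
  proof -
    have UX: "U \<subseteq> X" using U T(3) X openin_subset by blast
    have "\<exists>V. open V \<and> e x \<in> V \<and> e ` X \<inter> V \<subseteq> e ` U" if x: "x \<in> U" for x
    proof -
      obtain r where r: "r > 0" "mball x r \<subseteq> U" using U x unfolding Td openin_mtopology by blast
      have xX: "x \<in> X" using x UX by blast
      obtain k where k: "d x (q k) < r / 3" using dense[OF xX, of "r/3"] r by auto
      let ?V = "{y::nat\<Rightarrow>real. \<bar>y k - e x k\<bar> < r / 3}"
      have "open ?V"
        by (intro open_Collect_less continuous_on_product_coordinates continuous_on_const
            continuous_on_rabs[OF continuous_on_diff[OF continuous_on_product_coordinates continuous_on_const]])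
      moreover have "e x \<in> ?V" using r by simp
      moreover have "e ` X \<inter> ?V \<subseteq> e ` U" using near[OF xX _ k] r(2) xX by (auto simp: subset_iff)
      ultimately show ?thesis by blast
    qed
    then obtain V where V: "\<And>x. x \<in> U \<Longrightarrow> open (V x) \<and> e x \<in> V x \<and> e ` X \<inter> V x \<subseteq> e ` U" by metis
    have "e ` U = e ` X \<inter> (\<Union>x\<in>U. V x)" using V UX by blast
    moreover have "open (\<Union>x\<in>U. V x)" using V by blast
    ultimately show ?thesis by blast
  qed
  have hom: "homeomorphic_map T (top_of_set (e ` X)) e"
  proof -
    have tX: "topspace T = X" using X T(3) by simp
    have "open_map T (top_of_set (e ` X)) e"
      unfolding open_map_def openin_open using opn by blast
    moreover have "continuous_map T (top_of_set (e ` X)) e"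
      using cont tX by (auto simp: continuous_map_in_subtopology)
    ultimately show ?thesis using inj tX by (intro bijective_open_imp_homeomorphic_map) auto
  qed
  have "completely_metrizable_space (top_of_set (e ` X))"
    using T(1) hom homeomorphic_completely_metrizable_space homeomorphic_map_imp_homeomorphic_space by blast
  then have "gdelta_in euclidean (e ` X)"
    by (intro completely_metrizable_space_imp_gdelta_in metrizable_space_euclidean) auto
  then have "\<exists>\<U>. countable \<U> \<and> \<U> \<subseteq> {U. open U} \<and> \<Inter>\<U> = e ` X"
    by (auto simp: gdelta_in_alt intersection_of_def)
  then obtain \<U> where U: "countable \<U>" "\<U> \<subseteq> {U. open U}" "\<Inter>\<U> = e ` X" by blast
  have bX: "e ` X \<in> sets borel"
  proof (cases "\<U> = {}")
    case False
    moreover have "\<U> \<subseteq> sets borel" using U(2) by (auto intro: borel_open)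
    ultimately show ?thesis using U sets.countable_INT'[of \<U> id borel] by simp
  qed (use U in auto)
  show thesis
  proof (rule that[of e])
    show "inj_on e (space M)" using inj X by simp
    show "e \<in> borel_measurable M"
    proof (rule borel_measurableI)
      fix S :: "(nat \<Rightarrow> real) set" assume "open S"
      then have "openin T {x \<in> topspace T. e x \<in> S}"
        using cont by (simp add: openin_continuous_map_preimage)
      moreover have "{x \<in> topspace T. e x \<in> S} = e -` S \<inter> space M" using T(3) by auto
      ultimately show "e -` S \<inter> space M \<in> sets M" unfolding sM by auto
    qed
    show "e ` B \<in> sets borel" if "B \<in> sets M" for B
      using that unfolding sM
    proof (induction rule: sigma_sets.induct)
      case (Basic U) then show ?case using opn[of U] bX by auto
    next
      case Empty show ?case by simp
    next
      case (Compl B)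
      then have "B \<subseteq> space M" using sets.sets_into_space unfolding sM[symmetric] by blast
      then have "e ` (space M - B) = e ` X - e ` B" using inj X by (auto simp: inj_on_def)
      then show ?case using Compl bX by auto
    next
      case (Union A) then show ?case by (auto simp: image_UN)
    qed
  qed
qed

text \<open>A Lusin argument: the labels become continuous coordinates of \<open>E\<close>, and
  \<open>K\<close> comes from a compact part of the image of \<open>W\<close> under
  \<open>E\<close>. Prescribing a coordinate is a closed condition, so by compactness a label
  sequence all of whose finite prefixes occur in \<open>K\<close> occurs in \<open>K\<close>
  itself.\<close>

lemma lusin_labels:
  fixes f :: "nat \<Rightarrow> 'x \<Rightarrow> nat"
  assumes "standard_borel M" "finite_measure M"
    and f[measurable]: "\<And>k. f k \<in> M \<rightarrow>\<^sub>M count_space UNIV"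
    and W: "W \<in> sets M" "emeasure M W > 0"
  obtains K where "K \<in> sets M" "K \<subseteq> W" "emeasure M K > 0"
    "\<And>y. \<forall>n. \<exists>x\<in>K. \<forall>k<n. f k x = y k \<Longrightarrow> \<exists>x\<in>K. \<forall>k. f k x = y k"
proof -
  interpret finite_measure M by fact
  obtain e :: "'x \<Rightarrow> nat \<Rightarrow> real" where e[measurable]: "e \<in> borel_measurable M"
    and inj: "inj_on e (space M)" and eB: "\<And>B. B \<in> sets M \<Longrightarrow> e ` B \<in> sets borel"
    by (rule standard_borel_embedding[OF assms(1)]) blast
  define E where "E x = (\<lambda>k. (e x k, real (f k x)))" for x
  have [measurable]: "(\<lambda>x. e x k) \<in> borel_measurable M" for k
    using measurable_compose[OF e, of "\<lambda>y. y k" borel] by (simp add: borel_measurable_continuous_onI continuous_on_product_coordinates)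
  have E[measurable]: "E \<in> borel_measurable M"
    unfolding E_def by (intro measurable_coordinatewise_then_product) measurable
  have WM: "W \<subseteq> space M" using W(1) sets.sets_into_space by blast
  \<comment> \<open>The labels are only measurable, so the image is described through
    \<open>e\<close>: for each \<open>k\<close> separately, the first components must come from a
    point of \<open>W\<close> whose label is the number stored at \<open>k\<close>. Injectivity of
    \<open>e\<close> forces these points to coincide for all \<open>k\<close>.\<close>
  have EW: "E ` W \<in> sets borel"
  proof -
    define S where "S k j = {u. snd (u k) = real j} \<inter>
        (\<lambda>u::nat\<Rightarrow>real\<times>real. \<lambda>k. fst (u k)) -` (e ` (W \<inter> {x\<in>space M. f k x = j}))" for k j
    have c: "(\<lambda>u::nat\<Rightarrow>real\<times>real. (\<lambda>k. fst (u k))) \<in> borel \<rightarrow>\<^sub>M borel"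
      by (intro borel_measurable_continuous_onI continuous_on_coordinatewise_then_product continuous_on_fst continuous_on_product_coordinates)
    have c': "(\<lambda>u::nat\<Rightarrow>real\<times>real. snd (u k)) \<in> borel_measurable borel" for k
      by (intro borel_measurable_continuous_onI continuous_on_snd continuous_on_product_coordinates)
    have "S k j \<in> sets borel" for k j
    proof -
      have "e ` (W \<inter> {x\<in>space M. f k x = j}) \<in> sets borel" 
        using W(1) measurable_sets[OF f[of k], of "{j}"]
        by (intro eB sets.Int) (simp_all add: vimage_def Int_def conj_commute)
      from measurable_sets[OF c this]
      have "(\<lambda>u::nat\<Rightarrow>real\<times>real. \<lambda>k. fst (u k)) -` (e ` (W \<inter> {x\<in>space M. f k x = j})) \<in> sets borel" by simp
      moreover have "{u::nat\<Rightarrow>real\<times>real. snd (u k) = real j} \<in> sets borel"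
        using measurable_sets[OF c'[of k], of "{real j}"] by (simp add: vimage_def)
      ultimately show ?thesis unfolding S_def by blast
    qed
    then have "(\<Inter>k. \<Union>j. S k j) \<in> sets borel" by (auto intro!: sets.countable_INT sets.countable_UN)
    moreover have "E ` W = (\<Inter>k. \<Union>j. S k j)"
    proof (intro equalityI subsetI)
      fix u assume "u \<in> E ` W"
      then show "u \<in> (\<Inter>k. \<Union>j. S k j)" using WM by (auto simp: E_def S_def)
    next
      fix u assume u: "u \<in> (\<Inter>k. \<Union>j. S k j)"
      then have "u \<in> (\<Union>j. S 0 j)" by blast
      then obtain x where x: "x \<in> W" "(\<lambda>k. fst (u k)) = e x" by (auto simp: S_def)
      have "snd (u k) = real (f k x)" for k
      proof -
        obtain j where "u \<in> S k j" using u by blast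
        then obtain x' where x': "x' \<in> W" "f k x' = j" "(\<lambda>k. fst (u k)) = e x'" "snd (u k) = real j"
          by (auto simp: S_def)
        then have "x' = x" using inj x WM by (metis inj_onD subsetD)
        then show ?thesis using x' by simp
      qed
      moreover have "fst (u k) = e x k" for k using x(2) by metis
      ultimately have "u = E x" unfolding E_def by (metis prod.collapse)
      then show "u \<in> E ` W" using x by blast
    qed
    ultimately show ?thesis by simp
  qed
  let ?D = "distr M borel E"
  have Einj: "inj_on E (space M)"
  proof (rule inj_onI)
    fix x y assume xy: "x \<in> space M" "y \<in> space M" "E x = E y"
    have "fst (E x k) = fst (E y k)" for k using xy(3) by simp
    then have "e x = e y" by (auto simp: E_def)
    then show "x = y" using inj xy by (auto dest: inj_onD)
  qed
  have pre: "E -` (E ` W) \<inter> space M = W" using Einj WM by (auto simp: inj_on_def)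
  have "emeasure ?D (E ` W) = (SUP K \<in> {K. K \<subseteq> E ` W \<and> compact K}. emeasure ?D K)"
    by (rule inner_regular) (use EW emeasure_finite in \<open>auto simp: emeasure_distr\<close>)
  moreover have "emeasure ?D (E ` W) > 0" using W pre EW by (simp add: emeasure_distr)
  ultimately obtain L where L: "L \<subseteq> E ` W" "compact L" "emeasure ?D L > 0"
    by (auto simp: less_SUP_iff)
  have LB: "L \<in> sets borel" using L(2) by (simp add: borel_compact)
  show thesis
  proof (rule that[of "E -` L \<inter> space M"])
    show "E -` L \<inter> space M \<in> sets M" using LB by simp
    show "E -` L \<inter> space M \<subseteq> W" using L(1) pre by blast
    show "emeasure M (E -` L \<inter> space M) > 0" using L(3) LB by (simp add: emeasure_distr)
    fix y assume y: "\<forall>n. \<exists>x\<in>E -` L \<inter> space M. \<forall>k<n. f k x = y k"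
    define C where "C n = L \<inter> {u. \<forall>k<n. snd (u k) = real (y k)}" for n
    have cl: "closed {u::nat\<Rightarrow>real\<times>real. \<forall>k<n. snd (u k) = real (y k)}" for n
    proof -
      have "{u::nat\<Rightarrow>real\<times>real. \<forall>k<n. snd (u k) = real (y k)} = (\<Inter>k\<in>{..<n}. {u. snd (u k) = real (y k)})" by auto
      moreover have "closed {u::nat\<Rightarrow>real\<times>real. snd (u k) = real (y k)}" for k
        by (intro closed_Collect_eq continuous_on_snd continuous_on_product_coordinates continuous_on_const)
      ultimately show ?thesis by auto
    qed
    have CL: "closed (C n)" for n
      unfolding C_def by (intro closed_Int cl compact_imp_closed L)
    have "L \<inter> (\<Inter>n. C n) \<noteq> {}"
    proof (rule compact_imp_fip_image[OF L(2)])
      fix I :: "nat set" assume I: "finite I"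
      obtain x where x: "x\<in>E -` L \<inter> space M" "\<forall>k<Max (insert 0 I). f k x = y k" using y by blast
      have "\<forall>k<n. f k x = y k" if "n \<in> I" for n
      proof -
        have "n \<le> Max (insert 0 I)" using that I by (intro Max_ge) auto
        then show ?thesis using x(2) by (meson less_le_trans)
      qed
      then have "E x \<in> L \<inter> (\<Inter>n\<in>I. C n)" using x(1) by (auto simp: C_def E_def)
      then show "L \<inter> (\<Inter>n\<in>I. C n) \<noteq> {}" by blast
    qed (rule CL)
    then obtain u where u: "\<And>n. u \<in> C n" by blast
    have "u \<in> L" using u[of 0] by (simp add: C_def)
    then obtain x where x: "x \<in> W" "u = E x" using L(1) by blast
    have "f k x = y k" for k using u[of "Suc k"] x by (auto simp: C_def E_def)
    moreover have "x \<in> E -` L \<inter> space M" using x WM u[of 0] by (auto simp: C_def)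
    ultimately show "\<exists>x\<in>E -` L \<inter> space M. \<forall>k. f k x = y k" by blast
  qed
qed

section \<open>Fibre measures of countable-to-one maps\<close>

lemma additive_tree_mono:
  fixes v :: "bool list \<Rightarrow> real"
  assumes nn: "\<And>s. v s \<ge> 0" and add: "\<And>s. v s = v (s @ [True]) + v (s @ [False])"
  shows "v (s @ t) \<le> v s"
proof (induction t rule: rev_induct)
  case (snoc b t)
  have "v (s @ [b]) \<le> v s" for s using add[of s] nn[of "s @ [True]"] nn[of "s @ [False]"] by (cases b) auto
  then show ?case using snoc by (metis append_assoc order_trans)
qed simp

text \<open>A diagonal argument. \<open>v\<close> is a finite measure on the branches of the binary
  tree, and the branches in \<open>Y\<close> are null; from every node of positive mass one can
  therefore go on to a node of positive mass that is off any given branch of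
  \<open>Y\<close>.\<close>

lemma additive_tree_branch:
  fixes v :: "bool list \<Rightarrow> real"
  assumes nn: "\<And>s. v s \<ge> 0" and add: "\<And>s. v s = v (s @ [True]) + v (s @ [False])"
    and pos: "v [] > 0" and Y: "countable Y"
    and small: "\<And>y q. y \<in> Y \<Longrightarrow> q > 0 \<Longrightarrow> \<exists>n. v (map y [0..<n]) \<le> q"
  shows "\<exists>y. y \<notin> Y \<and> (\<forall>n. v (map y [0..<n]) > 0)"
proof -
  have mono: "v (s @ t) \<le> v s" for s t using nn add by (rule additive_tree_mono)
  have step: "\<exists>t. t \<noteq> [] \<and> v (s @ t) > 0 \<and> (y \<in> Y \<longrightarrow> map y [0..<length (s @ t)] \<noteq> s @ t)"
    if s: "v s > 0" for s y
  proof (rule ccontr)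
    assume "\<not> ?thesis"
    then have con: "y \<in> Y \<and> map y [0..<length (s @ t)] = s @ t" if "t \<noteq> []" "v (s @ t) > 0" for t
      using that by blast
    obtain b where "v (s @ [b]) > 0" using add[of s] s nn by (metis add_0 less_eq_real_def)
    from con[OF _ this] have yY: "y \<in> Y" and sb: "map y [0..<Suc (length s)] = s @ [b]" by auto
    \<comment> \<open>If leaving \<open>y\<close> always meant zero mass, all siblings of the nodes
      on \<open>y\<close> below \<open>s\<close> would be null and the whole of \<open>v s\<close>
      would travel along \<open>y\<close>, against \<open>small\<close>.\<close>
    have "v (s @ map (\<lambda>i. y (length s + i)) [0..<m]) = v s" for m
    proof (induction m)
      case (Suc m)
      let ?t = "map (\<lambda>i. y (length s + i)) [0..<m]"
      have "v (s @ ?t @ [\<not> y (length s + m)]) = 0"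
      proof (rule ccontr)
        assume "v (s @ ?t @ [\<not> y (length s + m)]) \<noteq> 0"
        then have "v (s @ ?t @ [\<not> y (length s + m)]) > 0" using nn[of "s @ ?t @ [\<not> y (length s + m)]"] by linarith
        from con[OF _ this] have "map y [0..<Suc (length s + m)] = s @ ?t @ [\<not> y (length s + m)]" by simp
        then have "last (map y [0..<Suc (length s + m)]) = last (s @ ?t @ [\<not> y (length s + m)])" by simp
        then show False by simp
      qed
      then show ?case using add[of "s @ ?t"] Suc by (cases "y (length s + m)") auto
    qed simp
    moreover have "map y [0..<length s + m] = s @ map (\<lambda>i. y (length s + i)) [0..<m]" for m
    proof -
      have "map y [0..<length s] = s" using sb by simp
      moreover have "map y [0..<length s + m] = map y [0..<length s] @ map (\<lambda>i. y (length s + i)) [0..<m]"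
        by (intro nth_equalityI) (auto simp: nth_append)
      ultimately show ?thesis by simp
    qed
    ultimately have big: "v (map y [0..<length s + m]) = v s" for m by simp
    obtain n where n: "v (map y [0..<n]) \<le> v s / 2" using small[OF yY, of "v s / 2"] s by auto
    have "map y [0..<length s + n] = map y [0..<n] @ map y [n..<length s + n]"
      by (metis le_add2 map_append upt_add_eq_append zero_le add.commute add_0)
    then have "v s \<le> v (map y [0..<n])" using big[of n] mono[of "map y [0..<n]"] by metis
    then show False using n s by simp
  qed
  then obtain f where f: "\<And>s y. v s > 0 \<Longrightarrow> f s y \<noteq> [] \<and> v (s @ f s y) > 0 \<and>
      (y \<in> Y \<longrightarrow> map y [0..<length (s @ f s y)] \<noteq> s @ f s y)" by metis
  \<comment> \<open>Stage \<open>i\<close> leaves the \<open>i\<close>-th branch of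
    \<open>Y\<close>. For empty \<open>Y\<close> the enumeration has arbitrary values; the
    extensions are still nonempty and of positive mass, since only the avoidance clause for
    \<open>f\<close> depends on membership in \<open>Y\<close>.\<close>
  define S where "S = rec_nat [] (\<lambda>i s. s @ f s (from_nat_into Y i))"
  have S0: "S 0 = []" and SS: "S (Suc i) = S i @ f (S i) (from_nat_into Y i)" for i by (auto simp: S_def)
  have Sp: "v (S i) > 0" for i by (induction i) (use pos f in \<open>auto simp: S0 SS\<close>)
  have Sl: "i \<le> length (S i)" for i
  proof (induction i)
    case (Suc i) then show ?case using f[OF Sp[of i], of "from_nat_into Y i"] by (cases "f (S i) (from_nat_into Y i)") (auto simp: SS)
  qed simp
  have Sle: "\<exists>t. S j = S i @ t" if "i \<le> j" for i j
    using that by (induction rule: dec_induct) (auto simp: SS)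
  define y where "y k = S (Suc k) ! k" for k
  have yS: "y k = S j ! k" if "k < length (S j)" for j k
  proof -
    obtain t where t: "S (max j (Suc k)) = S j @ t" using Sle[of j "max j (Suc k)"] by auto
    obtain t' where t': "S (max j (Suc k)) = S (Suc k) @ t'" using Sle[of "Suc k" "max j (Suc k)"] by auto
    have "k < length (S (Suc k))" using Sl[of "Suc k"] by simp
    then show ?thesis unfolding y_def using t t' that by (metis nth_append)
  qed
  show ?thesis
  proof (intro exI conjI allI)
    show "v (map y [0..<n]) > 0" for n
    proof -
      have "map y [0..<n] = take n (S n)" by (rule nth_equalityI) (use Sl[of n] yS[of _ n] in auto)
      then have "v (S n) \<le> v (map y [0..<n])" using mono[of "take n (S n)" "drop n (S n)"] by simp
      then show ?thesis using Sp[of n] by simp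
    qed
    show "y \<notin> Y"
    proof
      assume "y \<in> Y"
      then obtain i where i: "from_nat_into Y i = y" using Y from_nat_into_surj by metis
      have "map y [0..<length (S (Suc i))] = S (Suc i)" by (rule nth_equalityI) (use yS in auto)
      then show False using f[OF Sp[of i], of y] \<open>y \<in> Y\<close> SS[of i] i by auto
    qed
  qed
qed

section \<open>Binary codes, cells and the algebra generated by the labels\<close>

definition code :: "(nat \<Rightarrow> 'x set) \<Rightarrow> 'x \<Rightarrow> nat \<Rightarrow> bool list" where
  "code B x n = map (\<lambda>k. x \<in> B k) [0..<n]"

definition cell :: "'x measure \<Rightarrow> (nat \<Rightarrow> 'x set) \<Rightarrow> bool list \<Rightarrow> 'x set" where
  "cell M B s = {x \<in> space M. code B x (length s) = s}"

definition label_algebra :: "'x measure \<Rightarrow> ('x \<Rightarrow> nat \<Rightarrow> nat) \<Rightarrow> 'x measure" where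
  "label_algebra M a = sigma (space M) {{x \<in> space M. a x k = j} |k j. True}"

lemma length_code [simp]: "length (code B x n) = n"
  by (simp add: code_def)

lemma code_eq_iff: "code B x n = s \<longleftrightarrow> length s = n \<and> (\<forall>k<n. s ! k = (x \<in> B k))"
  by (auto simp: code_def list_eq_iff_nth_eq)

lemma cell_Nil [simp]: "cell M B [] = space M"
  by (auto simp: cell_def code_def)

lemma cell_measurable [measurable]:
  assumes [measurable]: "\<And>k. B k \<in> sets M"
  shows "cell M B s \<in> sets M"
  unfolding cell_def code_eq_iff by measurable

lemma code_measurable [measurable]:
  assumes [measurable]: "\<And>k. B k \<in> sets M"
  shows "(\<lambda>x. code B x n) \<in> M \<rightarrow>\<^sub>M count_space UNIV"
proof -
  have "(\<lambda>x. code B x n) -` {s} \<inter> space M = (if length s = n then cell M B s else {})" for s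
    by (auto simp: cell_def)
  then have "(\<lambda>x. code B x n) -` {s} \<inter> space M \<in> sets M" for s by simp
  then show ?thesis by (simp add: measurable_count_space_eq2_countable)
qed

lemma cell_split:
  "cell M B s = cell M B (s @ [True]) \<union> cell M B (s @ [False])"
  "cell M B (s @ [True]) \<inter> cell M B (s @ [False]) = {}"
  by (auto simp: cell_def code_eq_iff nth_append less_Suc_eq)

lemma space_label_algebra [simp]: "space (label_algebra M a) = space M"
  by (simp add: label_algebra_def space_measure_of_conv)

lemma sets_label_algebra:
  "sets (label_algebra M a) = sigma_sets (space M) {{x \<in> space M. a x k = j} |k j. True}"
  by (auto simp: label_algebra_def intro!: sets_measure_of)

lemma label_algebra_label: "(\<lambda>x. a x k) \<in> label_algebra M a \<rightarrow>\<^sub>M count_space UNIV"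
proof -
  have "(\<lambda>x. a x k) \<in> space (label_algebra M a) \<rightarrow> UNIV \<and> (\<forall>j\<in>UNIV. (\<lambda>x. a x k) -` {j} \<inter> space (label_algebra M a) \<in> sets (label_algebra M a))"
  proof (intro conjI ballI)
    fix j
    have "(\<lambda>x. a x k) -` {j} \<inter> space M = {x \<in> space M. a x k = j}" by auto
    then show "(\<lambda>x. a x k) -` {j} \<inter> space (label_algebra M a) \<in> sets (label_algebra M a)"
      by (auto simp: sets_label_algebra intro!: sigma_sets.Basic)
  qed auto
  then show ?thesis by (simp add: measurable_count_space_eq2_countable)
qed

lemma subalgebra_label_algebra:
  assumes [measurable]: "\<And>k. (\<lambda>x. a x k) \<in> M \<rightarrow>\<^sub>M count_space UNIV"
  shows "subalgebra M (label_algebra M a)"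
  unfolding subalgebra_def sets_label_algebra
  by (auto intro!: sets.sigma_sets_subset)

lemma label_algebra_saturated:
  assumes "A \<in> sets (label_algebra M a)" "x \<in> space M" "x' \<in> space M" "a x = a x'"
  shows "x \<in> A \<longleftrightarrow> x' \<in> A"
  using assms(1) unfolding sets_label_algebra
  by (induction rule: sigma_sets.induct) (use assms(2-) in auto)

text \<open>This holds at every point, not just almost everywhere. Values of a fixed version of a
  conditional expectation can therefore be compared at different points of one fibre of
  \<open>a\<close>.\<close>

lemma label_algebra_constant:
  fixes f :: "'x \<Rightarrow> real"
  assumes [measurable]: "f \<in> borel_measurable (label_algebra M a)"
    and "x \<in> space M" "x' \<in> space M" "a x = a x'"
  shows "f x = f x'"
proof -
  have "{y \<in> space (label_algebra M a). f y = f x} \<in> sets (label_algebra M a)" by measurable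
  from label_algebra_saturated[OF this assms(2-)] show ?thesis using assms(2,3) by simp
qed

context sigma_finite_subalgebra
begin

lemma real_cond_exp_indicator_disjoint:
  assumes D: "D \<in> sets F" and S: "S \<in> sets M" and fin: "emeasure M S < \<infinity>" and "S \<inter> D = {}"
  shows "AE x in M. x \<in> D \<longrightarrow> real_cond_exp M F (indicator S) x = 0"
proof -
  have "integrable M (indicator S :: 'a \<Rightarrow> real)" using S fin by simp
  moreover have z: "(\<lambda>x. indicator D x * indicator S x :: real) = (\<lambda>x. 0)"
    using assms(4) by (auto simp: indicator_def fun_eq_iff)
  ultimately have "AE x in M. real_cond_exp M F (\<lambda>x. 0) x = indicator D x * real_cond_exp M F (indicator S) x"
    using real_cond_exp_mult[of "indicator D" "indicator S"] D S by (auto simp: z)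
  moreover have "AE x in M. real_cond_exp M F (\<lambda>x. 0) x = 0" by (rule real_cond_exp_F_meas) auto
  ultimately show ?thesis by eventually_elim auto
qed

text \<open>Over the set where the conditional probability is not positive its integral is at most
  0, but that integral is the measure of the part of \<open>S\<close> lying there.\<close>

lemma real_cond_exp_indicator_pos:
  assumes S: "S \<in> sets M" and fin: "emeasure M S < \<infinity>"
  shows "AE x in M. x \<in> S \<longrightarrow> real_cond_exp M F (indicator S) x > 0"
proof -
  let ?v = "real_cond_exp M F (indicator S)"
  define D where "D = {x \<in> space F. ?v x \<le> 0}"
  have D: "D \<in> sets F" unfolding D_def by measurable
  then have DM: "D \<in> sets M" using subalg by (auto simp: subalgebra_def)
  have i: "integrable M (indicator S :: 'a \<Rightarrow> real)" using S fin by simp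
  have "measure M (D \<inter> S) = (\<integral>x\<in>D. indicator S x \<partial>M)"
    unfolding set_lebesgue_integral_def using DM S sets.sets_into_space
    by (simp add: indicator_inter_arith[symmetric] Int_commute inf.absorb1 le_infI1)
  also have "\<dots> = (\<integral>x\<in>D. ?v x \<partial>M)" by (rule real_cond_exp_intA[OF i D])
  also have "\<dots> \<le> 0" unfolding set_lebesgue_integral_def
    using integral_nonneg_AE[of "\<lambda>x. - (indicator D x *\<^sub>R ?v x)" M]
    by (auto simp: D_def indicator_def mult_nonneg_nonpos split: if_splits)
  finally have "measure M (D \<inter> S) = 0" by (simp add: measure_le_0_iff)
  moreover have "emeasure M (D \<inter> S) < \<infinity>" using emeasure_mono[of "D \<inter> S" S M] S fin by (auto intro: le_less_trans)
  ultimately have "D \<inter> S \<in> null_sets M" using DM S by (auto simp: null_sets_def emeasure_eq_ennreal_measure)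
  then have "AE x in M. x \<notin> D \<inter> S" by (rule AE_not_in)
  then show ?thesis using AE_space by eventually_elim (use subalg in \<open>auto simp: D_def subalgebra_def not_le\<close>)
qed

end

lemma AE_pos_witness:
  assumes "AE x in M. P x" "K \<in> sets M" "emeasure M K > 0"
  shows "\<exists>x\<in>K. P x"
proof (rule ccontr)
  assume "\<not> ?thesis"
  then have "AE x in M. x \<notin> K" using assms(1) by (auto elim!: AE_mp)
  then have "K \<in> null_sets M" using assms(2) by (simp add: AE_iff_null_sets)
  then show False using assms(3) by auto
qed

text \<open>A disintegration of \<^term>\<open>M\<close> over \<^term>\<open>a\<close> would have atomic fibre measures because the fibres
  are countable. The conclusion expresses this through the masses that the fibre measures give
  to the cells shrinking to a point, so that no disintegration has to be constructed.\<close>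

lemma fibre_measures_atomic:
  fixes a :: "'x \<Rightarrow> nat \<Rightarrow> nat" and B :: "nat \<Rightarrow> 'x set"
  assumes sb: "standard_borel M" and pr: "prob_space M"
    and a[measurable]: "\<And>k. (\<lambda>x. a x k) \<in> M \<rightarrow>\<^sub>M count_space UNIV"
    and B[measurable]: "\<And>k. B k \<in> sets M"
    and X1[measurable]: "X1 \<in> sets M" and full: "AE x in M. x \<in> X1"
    and ctbl: "\<And>z. countable {x \<in> X1. a x = z}"
  defines "w \<equiv> \<lambda>s. real_cond_exp M (label_algebra M a) (indicator (cell M B s))"
  shows "AE x in M. \<exists>q>0. \<forall>n. w (code B x n) x > q"
proof -
  interpret prob_space M by fact
  define F where "F = label_algebra M a"
  have sub: "subalgebra M F" unfolding F_def by (rule subalgebra_label_algebra) measurable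
  interpret finite_measure_subalgebra M F by unfold_locales (rule sub)
  have Fspace: "space F = space M" using sub by (auto simp: subalgebra_def)
  have [measurable]: "(\<lambda>x. a x k) \<in> F \<rightarrow>\<^sub>M count_space UNIV" for k unfolding F_def by (rule label_algebra_label)
  have wF: "w s \<in> borel_measurable F" for s unfolding w_def F_def[symmetric] by measurable
  then have [measurable]: "w s \<in> borel_measurable M" for s using measurable_from_subalg[OF sub] by blast
  have [measurable]: "(\<lambda>x. w (code B x n) x) \<in> borel_measurable M" for n
    by (rule measurable_compose_countable[where f = w]) measurable
  \<comment> \<open>The points at which the fibre measure has no atom: the masses of the cells
    around them have no positive lower bound.\<close>
  define W0 where "W0 = {x \<in> space M. x \<in> X1 \<and> \<not> (\<exists>q>0. \<forall>n. w (code B x n) x > q)}"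
  have alt: "(\<exists>q>0. \<forall>n. f n > q) \<longleftrightarrow> (\<exists>m. \<forall>n. f n > 1 / real (Suc m))" for f :: "nat \<Rightarrow> real"
  proof
    assume "\<exists>q>0. \<forall>n. f n > q"
    then obtain q where q: "q > 0" "\<And>n. f n > q" by blast
    obtain m where "1 / real (Suc m) < q" using q(1) nat_approx_posE by blast
    then show "\<exists>m. \<forall>n. f n > 1 / real (Suc m)" using q(2) by (meson less_trans)
  next
    assume "\<exists>m. \<forall>n. f n > 1 / real (Suc m)"
    then show "\<exists>q>0. \<forall>n. f n > q" by (metis of_nat_0_less_iff zero_less_Suc zero_less_divide_1_iff)
  qed
  have W0[measurable]: "W0 \<in> sets M" unfolding W0_def alt by measurable
  have "emeasure M W0 = 0"
  proof (rule ccontr)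
    assume "emeasure M W0 \<noteq> 0"
    then have W0pos: "emeasure M W0 > 0" by (simp add: zero_less_iff_neq_zero)
    \<comment> \<open>Even positions record the binary code and odd positions the labels of
      \<open>a\<close>, so that one application of \<open>lusin_labels\<close> controls
      both.\<close>
    define f where "f k x = (if even k then (if x \<in> B (k div 2) then 1 else 0) else a x (k div 2))" for k x
    have fm: "f k \<in> M \<rightarrow>\<^sub>M count_space UNIV" for k 
    proof (cases "even k")
      case True
      then have "f k = (\<lambda>x. if x \<in> B (k div 2) then 1 else 0)" by (simp add: f_def fun_eq_iff)
      moreover have "(\<lambda>x. if x \<in> B (k div 2) then 1 else 0 :: nat) \<in> M \<rightarrow>\<^sub>M count_space UNIV" by measurable
      ultimately show ?thesis by simp
    next
      case False
      then have "f k = (\<lambda>x. a x (k div 2))" by (simp add: f_def fun_eq_iff)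
      then show ?thesis by simp
    qed
    obtain K where K[measurable]: "K \<in> sets M" and KW: "K \<subseteq> W0" and Kpos: "emeasure M K > 0"
      and Kc: "\<And>y. \<forall>n. \<exists>x\<in>K. \<forall>k<n. f k x = y k \<Longrightarrow> \<exists>x\<in>K. \<forall>k. f k x = y k"
      by (rule lusin_labels[where f = f, OF sb finite_measure_axioms fm W0 W0pos]) blast
    have KM: "K \<subseteq> space M" using sets.sets_into_space[OF K] .
    \<comment> \<open>Conditional masses are restricted to \<open>K\<close>: positive mass of a cell
      then yields points of \<open>K\<close> in it, to which the property of \<open>K\<close>
      applies.\<close>
    define v where "v s = real_cond_exp M F (indicator (K \<inter> cell M B s))" for s
    have [simp]: "integrable M (indicator A :: 'x \<Rightarrow> real)" if "A \<in> sets M" for A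
      using that by (simp add: less_top[symmetric])
    have E1: "AE x in M. \<forall>s. v s x \<ge> 0"
      unfolding AE_all_countable v_def by (intro allI real_cond_exp_pos) auto
    have E2: "AE x in M. \<forall>s. v s x \<le> w s x"
      unfolding AE_all_countable v_def w_def F_def[symmetric]
      by (intro allI real_cond_exp_mono) (auto simp: indicator_def)
    have E3: "AE x in M. \<forall>s. v s x = v (s @ [True]) x + v (s @ [False]) x"
      unfolding AE_all_countable
    proof
      fix s
      have "indicator (K \<inter> cell M B s) = (\<lambda>x. indicator (K \<inter> cell M B (s @ [True])) x + indicator (K \<inter> cell M B (s @ [False])) x :: real)"
        using cell_split[of M B s] by (auto simp: fun_eq_iff indicator_def)
      then show "AE x in M. v s x = v (s @ [True]) x + v (s @ [False]) x"
        unfolding v_def by (simp only:) (intro real_cond_exp_add, simp_all)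
    qed
    have E4: "AE x in M. x \<in> K \<longrightarrow> v [] x > 0"
    proof -
      have "K \<inter> cell M B [] = K" using KM by auto
      then show ?thesis unfolding v_def
        using real_cond_exp_indicator_pos[of K] by (simp add: less_top[symmetric])
    qed
    \<comment> \<open>Comparing only finitely many labels keeps \<open>D s m\<close> in
      \<open>F\<close>. Agreement of the complete label sequences is recovered later from the
      property of \<open>K\<close>.\<close>
    define D where "D s m = {x \<in> space F. \<exists>x'\<in>K \<inter> cell M B s. \<forall>k<m. a x' k = a x k}" for s m
    have E5: "AE x in M. \<forall>s m. v s x > 0 \<longrightarrow> x \<in> D s m"
      unfolding AE_all_countable
    proof (intro allI)
      fix s m
      define A where "A = (\<lambda>x'. map (a x') [0..<m]) ` (K \<inter> cell M B s)"
      have "D s m = (\<Union>l\<in>A. {x \<in> space F. \<forall>k<m. l ! k = a x k})"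
        by (auto simp: D_def A_def)
      also have "\<dots> \<in> sets F" by (intro sets.countable_UN'') (auto intro: countableI_type)
      finally have D: "D s m \<in> sets F" .
      have "AE x in M. x \<in> space F - D s m \<longrightarrow> v s x = 0"
        unfolding v_def
      proof (rule real_cond_exp_indicator_disjoint)
        show "space F - D s m \<in> sets F" using D by blast
        show "K \<inter> cell M B s \<inter> (space F - D s m) = {}" by (auto simp: D_def)
      qed (auto simp: less_top[symmetric])
      then show "AE x in M. v s x > 0 \<longrightarrow> x \<in> D s m"
        using AE_space by eventually_elim (auto simp: Fspace)
    qed
    have "AE x in M. (\<forall>s. v s x \<ge> 0) \<and> (\<forall>s. v s x \<le> w s x) \<and> (\<forall>s. v s x = v (s @ [True]) x + v (s @ [False]) x)
        \<and> (x \<in> K \<longrightarrow> v [] x > 0) \<and> (\<forall>s m. v s x > 0 \<longrightarrow> x \<in> D s m)"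
      using E1 E2 E3 E4 E5 by eventually_elim blast
    from AE_pos_witness[OF this K Kpos] obtain x where x: "x \<in> K" "\<And>s. v s x \<ge> 0" "\<And>s. v s x \<le> w s x"
      "\<And>s. v s x = v (s @ [True]) x + v (s @ [False]) x" "v [] x > 0" "\<And>s m. v s x > 0 \<Longrightarrow> x \<in> D s m" by blast
    \<comment> \<open>The codes of the countably many points of \<open>K\<close> in the fibre of
      \<open>x\<close>. A branch of positive mass outside \<open>Y\<close> would be realised by a
      point of \<open>K\<close> in this same fibre, whose code is in \<open>Y\<close>.\<close>
    define Y where "Y = (\<lambda>x' k. x' \<in> B k) ` {x' \<in> K. a x' = a x}"
    have "countable {x' \<in> K. a x' = a x}"
      by (rule countable_subset[OF _ ctbl[of "a x"]]) (use KW in \<open>auto simp: W0_def\<close>)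
    then have cY: "countable Y" unfolding Y_def by simp
    have "\<exists>y. y \<notin> Y \<and> (\<forall>n. v (map y [0..<n]) x > 0)"
    proof (rule additive_tree_branch[OF x(2,4,5) cY])
      fix y q assume y: "y \<in> Y" and q: "(q::real) > 0"
      then obtain x' where x': "x' \<in> K" "a x' = a x" "y = (\<lambda>k. x' \<in> B k)" by (auto simp: Y_def)
      have "x' \<in> W0" using x' KW by blast
      then have "\<not> (\<exists>q>0. \<forall>n. w (code B x' n) x' > q)" by (simp add: W0_def)
      then obtain n where n: "w (code B x' n) x' \<le> q" using q not_less by metis
      \<comment> \<open>The small mass is known at \<open>x'\<close>, whereas the tree of masses
        belongs to \<open>x\<close>; both points lie in one fibre.\<close>
      have "w (code B x' n) x' = w (code B x' n) x"
        by (rule label_algebra_constant[OF wF[unfolded F_def]]) (use x' x(1) KM in auto)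
      then have "v (map y [0..<n]) x \<le> q" using n x(3)[of "code B x' n"] x' by (simp add: code_def)
      then show "\<exists>n. v (map y [0..<n]) x \<le> q" by blast
    qed
    then obtain y where y: "y \<notin> Y" "\<And>n. v (map y [0..<n]) x > 0" by blast
    define y' where "y' k = (if even k then (if y (k div 2) then 1 else 0) else a x (k div 2))" for k
    have "\<exists>x'\<in>K. \<forall>k. f k x' = y' k"
    proof (intro Kc allI)
      fix n
      obtain x' where x': "x' \<in> K" "x' \<in> cell M B (map y [0..<n])" "\<And>k. k < n \<Longrightarrow> a x' k = a x k"
        using x(6)[OF y(2)[of n], of n] by (auto simp: D_def)
      have "f k x' = y' k" if "k < n" for k
      proof -
        have k: "k div 2 < n" using that by (simp add: le_less_trans[OF div_le_dividend])
        have "(x' \<in> B (k div 2)) = y (k div 2)" using x'(2) k by (auto simp: cell_def code_eq_iff)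
        then show ?thesis using x'(3)[OF k] by (simp add: f_def y'_def)
      qed
      then show "\<exists>x'\<in>K. \<forall>k<n. f k x' = y' k" using x'(1) by blast
    qed
    then obtain x' where x': "x' \<in> K" "\<And>k. f k x' = y' k" by blast
    have "a x' k = a x k" for k using x'(2)[of "2 * k + 1"] by (simp add: f_def y'_def)
    then have "a x' = a x" by blast
    moreover have "(x' \<in> B k) = y k" for k
      using x'(2)[of "2 * k"] by (simp add: f_def y'_def split: if_splits)
    ultimately have "y \<in> Y" using x'(1) unfolding Y_def by (auto intro!: image_eqI[of _ _ x'])
    then show False using y(1) by blast
  qed
  then have "AE x in M. x \<notin> W0" using W0 by (intro AE_not_in) auto
  then show ?thesis using full AE_space by eventually_elim (auto simp: W0_def)
qed

lemma standard_borel_countably_generated: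
  assumes "standard_borel M"
  obtains B :: "nat \<Rightarrow> 'x set" where "sets M = sigma_sets (space M) (range B)"
proof -
  obtain T where T: "second_countable T" "topspace T = space M"
    and sM: "sets M = sigma_sets (space M) {U. openin T U}"
    using assms unfolding standard_borel_def by blast
  obtain \<B> where \<B>: "countable \<B>" "\<And>V. V \<in> \<B> \<Longrightarrow> openin T V"
    "\<And>U x. openin T U \<Longrightarrow> x \<in> U \<Longrightarrow> \<exists>V\<in>\<B>. x \<in> V \<and> V \<subseteq> U"
    using T(1) unfolding second_countable_def by metis
  define B where "B = from_nat_into (insert {} \<B>)"
  have rB: "range B = insert {} \<B>" unfolding B_def by (rule range_from_nat_into) (use \<B>(1) in auto)
  have "sigma_sets (space M) (range B) = sigma_sets (space M) {U. openin T U}"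
  proof (rule sigma_sets_eqI)
    show "a \<in> sigma_sets (space M) {U. openin T U}" if "a \<in> range B" for a
      using that \<B>(2) unfolding rB by (auto intro: sigma_sets.Empty)
    fix U assume "U \<in> {U. openin T U}"
    then have "U = \<Union>{V \<in> \<B>. V \<subseteq> U}" using \<B>(3) by blast
    moreover have "\<Union>{V \<in> \<B>. V \<subseteq> U} \<in> sigma_sets (space M) (range B)"
    proof (rule sigma_sets_UNION)
      show "countable {V \<in> \<B>. V \<subseteq> U}" by (rule countable_subset[OF _ \<B>(1)]) auto
      show "V \<in> sigma_sets (space M) (range B)" if "V \<in> {V \<in> \<B>. V \<subseteq> U}" for V
        using that unfolding rB by auto
    qed
    ultimately show "U \<in> sigma_sets (space M) (range B)" by simp
  qed
  then have "sets M = sigma_sets (space M) (range B)" using sM by simp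
  then show thesis by (rule that)
qed

section \<open>Approximating measurable sets by unions of classes\<close>

locale refining_labels = prob_space M for M :: "'x measure" +
  fixes c :: "nat \<Rightarrow> 'x \<Rightarrow> 'c::countable"
  assumes c_measurable [measurable]: "\<And>n. c n \<in> M \<rightarrow>\<^sub>M count_space UNIV"
    and c_refine: "\<And>m n x y. m \<le> n \<Longrightarrow> c n x = c n y \<Longrightarrow> c m x = c m y"
begin

definition err :: "'x set \<Rightarrow> nat \<Rightarrow> 'c set \<Rightarrow> real" where
  "err A n S = measure M {x \<in> space M. (x \<in> A) \<noteq> (c n x \<in> S)}"

text \<open>For measurable \<open>A\<close> this is membership, up to a null set, in the
  \<sigma>-algebra generated by all the \<open>c n\<close>.\<close>

definition approximable :: "'x set \<Rightarrow> bool" where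
  "approximable A \<longleftrightarrow> (\<forall>e>0. \<exists>n S. err A n S < e)"

lemma approximable_at:
  assumes "approximable A" "e > 0"
  obtains n where "\<And>m. n \<le> m \<Longrightarrow> \<exists>S. err A m S < e"
proof -
  obtain n S where nS: "err A n S < e"
    using assms unfolding approximable_def by blast
  have "\<exists>S. err A m S < e" if "n \<le> m" for m
  proof -
    \<comment> \<open>A union of classes of level \<open>n\<close> is turned into a set of labels of
      level \<open>m\<close> by collecting the labels of its points; refinement ensures that no
      further points are added.\<close>
    have "c m x \<in> c m ` {y. c n y \<in> S} \<longleftrightarrow> c n x \<in> S" for x
      unfolding image_iff Bex_def mem_Collect_eq using c_refine[OF that] by metis
    then have "err A m (c m ` {y. c n y \<in> S}) = err A n S" unfolding err_def by simp
    then show ?thesis using nS by metis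
  qed
  then show thesis using that by blast
qed

lemma approximable_label: "approximable {x \<in> space M. c n x \<in> S}"
proof -
  have "{x' \<in> space M. (x' \<in> {x \<in> space M. c n x \<in> S}) \<noteq> (c n x' \<in> S)} = {}" by blast
  then have "err {x \<in> space M. c n x \<in> S} n S = 0" unfolding err_def by (metis measure_empty)
  then show ?thesis unfolding approximable_def by metis
qed

lemma approximable_cong_AE:
  assumes "approximable A" and [measurable]: "A \<in> sets M" "B \<in> sets M"
    and "AE x in M. x \<in> A \<longleftrightarrow> x \<in> B"
  shows "approximable B"
  unfolding approximable_def
proof (intro allI impI)
  fix e :: real assume "e > 0"
  then obtain n S where "err A n S < e"
    using assms(1) unfolding approximable_def by metis
  moreover have "err A n S = err B n S"
    unfolding err_def by (rule measure_eq_AE) (use assms(4) in auto)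
  ultimately show "\<exists>n S. err B n S < e" by metis
qed

lemma approximable_Compl:
  assumes "approximable A"
  shows "approximable (space M - A)"
  unfolding approximable_def
proof (intro allI impI)
  fix e :: real assume "e > 0"
  then obtain n S where "err A n S < e"
    using assms unfolding approximable_def by blast
  moreover have "{x \<in> space M. (x \<in> A) \<noteq> (c n x \<in> S)} = {x \<in> space M. (x \<in> space M - A) \<noteq> (c n x \<in> - S)}" by auto
  then have "err A n S = err (space M - A) n (- S)" unfolding err_def by simp
  ultimately show "\<exists>n S. err (space M - A) n S < e" by metis
qed

lemma approximable_Un:
  assumes "approximable A" "approximable B" and [measurable]: "A \<in> sets M" "B \<in> sets M"
  shows "approximable (A \<union> B)"
  unfolding approximable_def
proof (intro allI impI)
  fix e :: real assume "e > 0"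
  then have e: "e / 2 > 0" by simp
  obtain n1 where n1: "\<And>m. n1 \<le> m \<Longrightarrow> \<exists>S. err A m S < e / 2"
    using approximable_at[OF assms(1) e] by blast
  obtain n2 where n2: "\<And>m. n2 \<le> m \<Longrightarrow> \<exists>S. err B m S < e / 2"
    using approximable_at[OF assms(2) e] by blast
  define m where "m = max n1 n2"
  obtain S where S: "err A m S < e / 2" using n1[of m] by (auto simp: m_def)
  obtain R where R: "err B m R < e / 2" using n2[of m] by (auto simp: m_def)
  have "err (A \<union> B) m (S \<union> R) \<le>
      measure M ({x \<in> space M. (x \<in> A) \<noteq> (c m x \<in> S)} \<union> {x \<in> space M. (x \<in> B) \<noteq> (c m x \<in> R)})"
    unfolding err_def by (rule finite_measure_mono) auto
  also have "\<dots> \<le> err A m S + err B m R"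
    unfolding err_def by (rule measure_Un_le) measurable
  also have "\<dots> < e" using S R by simp
  finally show "\<exists>n S. err (A \<union> B) n S < e" by blast
qed

lemma approximable_UN:
  fixes A :: "nat \<Rightarrow> 'x set"
  assumes A: "\<And>i. approximable (A i)" and Am[measurable]: "\<And>i. A i \<in> sets M"
  shows "approximable (\<Union>i. A i)"
  unfolding approximable_def
proof (intro allI impI)
  fix e :: real assume e: "e > 0"
  have fin: "approximable (\<Union>i<N. A i)" for N
  proof (induction N)
    case 0 show ?case using approximable_label[of 0 "{}"] by simp
  next
    case (Suc N)
    have "(\<Union>i<Suc N. A i) = (\<Union>i<N. A i) \<union> A N" by (auto simp: less_Suc_eq)
    then show ?case using approximable_Un[OF Suc A] by simp
  qed
  have "(\<lambda>N. measure M (\<Union>i<N. A i)) \<longlonglongrightarrow> measure M (\<Union>N. \<Union>i<N. A i)"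
  proof (rule finite_Lim_measure_incseq)
    show "incseq (\<lambda>N. \<Union>i<N. A i)" unfolding incseq_def by (intro allI impI UN_mono) auto
  qed auto
  moreover have U: "(\<Union>N. \<Union>i<N. A i) = (\<Union>i. A i)" by blast
  ultimately have "\<forall>\<^sub>F N in sequentially. measure M (\<Union>i<N. A i) > measure M (\<Union>i. A i) - e / 2"
    using e by (intro order_tendstoD(1)) auto
  then obtain N where N: "measure M (\<Union>i<N. A i) > measure M (\<Union>i. A i) - e / 2"
    by (auto simp: eventually_sequentially)
  have d: "measure M ((\<Union>i. A i) - (\<Union>i<N. A i)) < e / 2"
    using N by (subst finite_measure_Diff) auto
  obtain n S where S: "err (\<Union>i<N. A i) n S < e / 2"
    using fin[of N] e unfolding approximable_def by (metis half_gt_zero)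
  have "err (\<Union>i. A i) n S \<le>
      measure M ({x \<in> space M. (x \<in> (\<Union>i<N. A i)) \<noteq> (c n x \<in> S)} \<union> ((\<Union>i. A i) - (\<Union>i<N. A i)))"
    unfolding err_def by (rule finite_measure_mono) auto
  also have "\<dots> \<le> err (\<Union>i<N. A i) n S + measure M ((\<Union>i. A i) - (\<Union>i<N. A i))"
    unfolding err_def by (rule measure_Un_le) measurable
  also have "\<dots> < e" using S d by simp
  finally show "\<exists>n S. err (\<Union>i. A i) n S < e" by blast
qed

lemma approximable_sigma_sets:
  assumes "\<And>A. A \<in> \<A> \<Longrightarrow> A \<in> sets M \<and> approximable A" "A \<in> sigma_sets (space M) \<A>"
  shows "A \<in> sets M \<and> approximable A"
  using assms(2)
proof (induction rule: sigma_sets.induct)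
  case Empty show ?case using approximable_label[of 0 "{}"] by simp
qed (use assms(1) approximable_Compl approximable_UN in auto)

end

text \<open>Used to see that, among the nodes of a given length below \<open>s\<close>, at most one
  can have more than half of the mass of \<open>s\<close>.\<close>

lemma additive_tree_disjoint:
  fixes v :: "bool list \<Rightarrow> real"
  assumes nn: "\<And>s. v s \<ge> 0" and add: "\<And>s. v s = v (s @ [True]) + v (s @ [False])"
    and "length t = length u" "t \<noteq> u"
  shows "v (s @ t) + v (s @ u) \<le> v s"
proof -
  have mono: "v (s @ t) \<le> v s" for s t using nn add by (rule additive_tree_mono)
  show ?thesis using assms(3,4)
  proof (induction t arbitrary: u rule: rev_induct)
    case (snoc b t)
    obtain u' b' where u: "u = u' @ [b']" using snoc.prems by (cases u rule: rev_cases) auto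
    show ?case
    proof (cases "t = u'")
      case True
      then have "b \<noteq> b'" using snoc.prems u by auto
      then have "v (s @ t @ [b]) + v (s @ t @ [b']) = v (s @ t)" using add[of "s @ t"] by (cases b; cases b') auto
      then show ?thesis using mono[of s t] u True by simp
    next
      case False
      then have "v (s @ t) + v (s @ u') \<le> v s" using snoc u by auto
      then show ?thesis using mono[of "s @ t" "[b]"] mono[of "s @ u'" "[b']"] u by simp
    qed
  qed simp
qed

text \<open>Stands in for the Lusin--Novikov theorem: up to null sets, \<^term>\<open>a\<close> becomes injective
  on the pieces of the partition given by \<open>i\<close>.\<close>

lemma countable_fibres_partition:
  fixes a :: "'x \<Rightarrow> nat \<Rightarrow> nat"
  assumes sb: "standard_borel M" and pr: "prob_space M"
    and a[measurable]: "\<And>k. (\<lambda>x. a x k) \<in> M \<rightarrow>\<^sub>M count_space UNIV"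
    and X1[measurable]: "X1 \<in> sets M" and full: "AE x in M. x \<in> X1"
    and ctbl: "\<And>z. countable {x \<in> X1. a x = z}"
  obtains i :: "'x \<Rightarrow> nat" where "i \<in> M \<rightarrow>\<^sub>M count_space UNIV"
    "refining_labels M (\<lambda>n x. (map (a x) [0..<n], i x))"
    "\<And>A. A \<in> sets M \<Longrightarrow> refining_labels.approximable M (\<lambda>n x. (map (a x) [0..<n], i x)) A"
proof -
  interpret prob_space M by fact
  obtain B :: "nat \<Rightarrow> 'x set" where gen: "sets M = sigma_sets (space M) (range B)"
    using standard_borel_countably_generated[OF sb] .
  have B[measurable]: "B k \<in> sets M" for k unfolding gen by auto
  define F where "F = label_algebra M a"
  have sub: "subalgebra M F" unfolding F_def by (rule subalgebra_label_algebra) measurable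
  interpret finite_measure_subalgebra M F by unfold_locales (rule sub)
  have Fspace: "space F = space M" using sub by (auto simp: subalgebra_def)
  define w where "w s = real_cond_exp M F (indicator (cell M B s))" for s
  have wF[measurable]: "w s \<in> borel_measurable F" for s unfolding w_def by measurable
  have wM[measurable]: "w s \<in> borel_measurable M" for s using measurable_from_subalg[OF sub wF] .
  have [measurable]: "(\<lambda>x. w (code B x n) x) \<in> borel_measurable M" for n
    by (rule measurable_compose_countable[where f = w]) measurable
  have I [simp]: "integrable M (indicator A :: 'x \<Rightarrow> real)" if "A \<in> sets M" for A
    using that by (simp add: less_top[symmetric])
  have E1: "AE x in M. \<forall>s. w s x \<ge> 0"
    unfolding AE_all_countable w_def by (intro allI real_cond_exp_pos) auto
  have E3: "AE x in M. \<forall>s. w s x = w (s @ [True]) x + w (s @ [False]) x"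
    unfolding AE_all_countable
  proof
    fix s
    have "indicator (cell M B s) = (\<lambda>x. indicator (cell M B (s @ [True])) x + indicator (cell M B (s @ [False])) x :: real)"
      using cell_split[of M B s] by (auto simp: fun_eq_iff indicator_def)
    then show "AE x in M. w s x = w (s @ [True]) x + w (s @ [False]) x"
      unfolding w_def by (simp only:) (intro real_cond_exp_add, simp_all)
  qed
  have E4: "AE x in M. \<exists>q>0. \<forall>n. w (code B x n) x > q"
    unfolding w_def F_def by (rule fibre_measures_atomic[OF sb pr a B X1 full ctbl])
  \<comment> \<open>An index encodes a cell \<open>s\<close> around \<open>x\<close> and a rational
    \<open>r\<close> such that all cells around \<open>x\<close> have mass above \<open>r\<close>
    while \<open>s\<close> has mass below \<open>2 * r\<close>. In one fibre this pins
    \<open>x\<close> down: two different branches below \<open>s\<close> cannot both keep mass above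
    \<open>r\<close>.\<close>
  define V where "V j = (case from_nat j of (s, r) \<Rightarrow>
      {x \<in> space M. code B x (length s) = s \<and> (\<forall>n. w (code B x n) x > real_of_rat r) \<and> w s x < 2 * real_of_rat r})" for j
  have [measurable]: "V j \<in> sets M" for j unfolding V_def by (auto split: prod.split)
  \<comment> \<open>Points in no \<open>V j\<close> get an arbitrary value; by \<open>E5\<close>
    they form a null set.\<close>
  define i where "i x = (LEAST j. x \<in> V j)" for x
  have i[measurable]: "i \<in> M \<rightarrow>\<^sub>M count_space UNIV" unfolding i_def by measurable
  have E5: "AE x in M. x \<in> V (i x)"
    using E1 E3 E4 AE_space
  proof eventually_elim
    case (elim x)
    then obtain q where q: "q > 0" "\<And>n. w (code B x n) x > q" by blast
    define m where "m = Inf (range (\<lambda>n. w (code B x n) x))"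
    have bdd: "bdd_below (range (\<lambda>n. w (code B x n) x))" using q(2) by (auto intro!: bdd_belowI[of _ q] less_imp_le)
    have mq: "m \<ge> q" unfolding m_def by (rule cINF_greatest) (use q(2) in \<open>auto intro: less_imp_le\<close>)
    \<comment> \<open>\<open>m\<close> is the mass of the atom at \<open>x\<close>. From
      \<open>m / 2 < r\<close> some cell around \<open>x\<close> has mass below
      \<open>2 * r\<close>, and \<open>r < m\<close> makes every cell around \<open>x\<close> exceed
      \<open>r\<close>.\<close>
    obtain r where r: "m / 2 < real_of_rat r" "real_of_rat r < m"
      using of_rat_dense[of "m / 2" m] mq q(1) by auto
    have "m < 2 * real_of_rat r" using r by simp
    then obtain n where n: "w (code B x n) x < 2 * real_of_rat r"
      unfolding m_def by (subst (asm) cINF_less_iff) (use bdd in auto)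
    have "w (code B x k) x > real_of_rat r" for k
      using cINF_lower[OF bdd, of k] r(2) unfolding m_def by simp
    then have "x \<in> V (to_nat (code B x n, r))" using n elim(4) by (simp add: V_def)
    then show ?case unfolding i_def by (rule LeastI)
  qed
  define c where "c = (\<lambda>n x. (map (a x) [0..<n], i x))"
  have amap[measurable]: "(\<lambda>x. map (a x) [0..<n]) \<in> M \<rightarrow>\<^sub>M count_space UNIV" for n
  proof -
    have "map (a x) [0..<n] = l \<longleftrightarrow> length l = n \<and> (\<forall>k<n. a x k = l ! k)" for x l
      by (metis (no_types, lifting) length_map length_upt minus_nat.diff_0 nth_equalityI nth_map_upt add_0)
    then have "(\<lambda>x. map (a x) [0..<n]) -` {l} \<inter> space M = {x \<in> space M. length l = n \<and> (\<forall>k<n. a x k = l ! k)}" for l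
      by (simp add: vimage_def Int_def conj_commute)
    moreover have "{x \<in> space M. length l = n \<and> (\<forall>k<n. a x k = l ! k)} \<in> sets M" for l by measurable
    ultimately have "(\<lambda>x. map (a x) [0..<n]) -` {l} \<inter> space M \<in> sets M" for l by simp
    then show ?thesis by (simp add: measurable_count_space_eq2_countable)
  qed
  have rl: "refining_labels M c"
  proof
    show "c n \<in> M \<rightarrow>\<^sub>M count_space UNIV" for n unfolding c_def by measurable
    show "c m x = c m y" if "m \<le> n" "c n x = c n y" for m n x y using that by (auto simp: c_def)
  qed
  interpret R: refining_labels M c by (rule rl)
  have apF: "A \<in> sets M \<and> R.approximable A" if "A \<in> sets F" for A
  proof (rule R.approximable_sigma_sets)
    show "A \<in> sigma_sets (space M) {{x \<in> space M. a x k = j} |k j. True}"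
      using that unfolding F_def sets_label_algebra .
    fix A assume "A \<in> {{x \<in> space M. a x k = j} |k j. True}"
    then obtain k j where A: "A = {x \<in> space M. a x k = j}" by blast
    then have "A = {x \<in> space M. c (Suc k) x \<in> {(l, z). l ! k = j}}" by (auto simp: c_def nth_append)
    then have "R.approximable A" using R.approximable_label by metis
    then show "A \<in> sets M \<and> R.approximable A" using A by simp
  qed
  have api: "R.approximable {x \<in> space M. i x = j}" for j
    using R.approximable_label[of 0 "{(l, z). z = j}"] by (simp add: c_def)
  have apInt: "R.approximable (A \<inter> A')" if "R.approximable A" "R.approximable A'" "A \<in> sets M" "A' \<in> sets M" for A A'
  proof -
    have "A \<inter> A' = space M - ((space M - A) \<union> (space M - A'))" using that sets.sets_into_space by blast
    then show ?thesis using that by (auto intro!: R.approximable_Compl R.approximable_Un)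
  qed
  have apB: "R.approximable (B k)" for k
  proof -
    \<comment> \<open>\<open>G j\<close> depends on the fibre of \<open>x\<close> only: it asks
      whether some node of mass above \<open>r\<close> below \<open>s\<close> has bit
      \<open>k\<close> set. Where \<open>i x = j\<close>, such a node must be the code of
      \<open>x\<close>. The length \<open>max (length s) (Suc k)\<close> is the least that both
      extends \<open>s\<close> and shows bit \<open>k\<close>.\<close>
    define G where "G j = (case from_nat j of (s, r) \<Rightarrow> {x \<in> space F. \<exists>t. length t = max (length s) (Suc k) \<and>
        t ! k \<and> take (length s) t = s \<and> w t x > real_of_rat r})" for j
    have G: "G j \<in> sets F" for j unfolding G_def by (auto split: prod.split)
    have "R.approximable (\<Union>j. {x \<in> space M. i x = j} \<inter> G j)"
      by (intro R.approximable_UN apInt api) (use apF[OF G] in auto)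
    then show ?thesis
    proof (rule R.approximable_cong_AE)
      show "AE x in M. x \<in> (\<Union>j. {x \<in> space M. i x = j} \<inter> G j) \<longleftrightarrow> x \<in> B k"
        using E1 E3 E5 AE_space
      proof eventually_elim
        case (elim x)
        obtain s :: "bool list" and r :: rat where sr: "from_nat (i x) = (s, r)" by fastforce
        let ?m = "max (length s) (Suc k)"
        have s: "code B x (length s) = s" and big: "\<And>n. w (code B x n) x > real_of_rat r"
          and small: "w s x < 2 * real_of_rat r" using elim(3) sr by (auto simp: V_def)
        have tk: "take (length s) (code B x ?m) = s"
          by (subst (3) s[symmetric]) (auto simp: code_def take_map)
        have "(\<exists>t. length t = ?m \<and> t ! k \<and> take (length s) t = s \<and> w t x > real_of_rat r) \<longleftrightarrow> x \<in> B k"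
        proof
          assume "x \<in> B k"
          then show "\<exists>t. length t = ?m \<and> t ! k \<and> take (length s) t = s \<and> w t x > real_of_rat r"
            using tk big by (intro exI[of _ "code B x ?m"]) (auto simp: code_def)
        next
          assume "\<exists>t. length t = ?m \<and> t ! k \<and> take (length s) t = s \<and> w t x > real_of_rat r"
          then obtain t where t: "length t = ?m" "t ! k" "take (length s) t = s" "w t x > real_of_rat r" by blast
          show "x \<in> B k"
          proof (rule ccontr)
            assume "x \<notin> B k"
            then have ne: "t \<noteq> code B x ?m" using t(1,2) by (auto simp: code_def)
            have t': "t = s @ drop (length s) t" using t(3) by (metis append_take_drop_id)
            have c': "code B x ?m = s @ drop (length s) (code B x ?m)" using tk by (metis append_take_drop_id)
            have "w (s @ drop (length s) t) x + w (s @ drop (length s) (code B x ?m)) x \<le> w s x"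
            proof (rule additive_tree_disjoint[where v = "\<lambda>s. w s x"])
              show "drop (length s) t \<noteq> drop (length s) (code B x ?m)" using ne t' c' by metis
              show "w s x \<ge> 0" for s using elim(1) by blast
              show "w s x = w (s @ [True]) x + w (s @ [False]) x" for s using elim(2) by blast
            qed (use t(1) in simp)
            then have "w t x + w (code B x ?m) x \<le> w s x" using t' c' by simp
            then show False using t(4) big[of ?m] small by linarith
          qed
        qed
        then show ?case using elim(4) sr by (auto simp: G_def Fspace)
      qed
      have "G j \<in> sets M" "{x \<in> space M. i x = j} \<in> sets M" for j using apF[OF G] by auto
      then show "(\<Union>j. {x \<in> space M. i x = j} \<inter> G j) \<in> sets M" by (intro sets.countable_UN) auto
    qed simp
  qed
  show thesis
  proof (rule that[OF i rl[unfolded c_def]])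
    fix A assume "A \<in> sets M"
    then have "A \<in> sigma_sets (space M) (range B)" using gen by simp
    then have "A \<in> sets M \<and> R.approximable A"
    proof (rule R.approximable_sigma_sets[rotated])
      show "A' \<in> sets M \<and> R.approximable A'" if "A' \<in> range B" for A' using that apB B by blast
    qed
    then have "R.approximable A" by simp
    then show "refining_labels.approximable M (\<lambda>n x. (map (a x) [0..<n], i x)) A" by (simp add: c_def)
  qed
qed

section \<open>Self-joinings over countable partitions\<close>

text \<open>Density with respect to \<^term>\<open>M \<Otimes>\<^sub>M M\<close> of the relatively independent self-joining of \<^term>\<open>M\<close>
  over the countable partition into the classes of \<open>c\<close>.\<close>

definition kern :: "'x measure \<Rightarrow> ('x \<Rightarrow> 'c) \<Rightarrow> 'x \<times> 'x \<Rightarrow> real" where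
  "kern M c = (\<lambda>(x, y). if c x = c y then 1 / measure M {z \<in> space M. c z = c x} else 0)"

lemma kern_nonneg [simp]: "kern M c p \<ge> 0"
  by (auto simp: kern_def split: prod.split)

lemma kern_commute: "kern M c (x, y) = kern M c (y, x)"
  by (simp add: kern_def)

lemma measurable_label_eq:
  fixes f g :: "'x \<Rightarrow> 'c::countable"
  assumes [measurable]: "f \<in> M \<rightarrow>\<^sub>M count_space UNIV" "g \<in> M \<rightarrow>\<^sub>M count_space UNIV"
  shows "Measurable.pred M (\<lambda>x. f x = g x)"
proof -
  have "(\<lambda>x. f x = g x) = (\<lambda>x. \<exists>k. f x = k \<and> g x = k)" by auto
  also have "Measurable.pred M \<dots>" by measurable
  finally show ?thesis .
qed

lemma kern_measurable [measurable]:
  fixes c :: "'x \<Rightarrow> 'c::countable"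
  assumes [measurable]: "c \<in> M \<rightarrow>\<^sub>M count_space UNIV"
  shows "kern M c \<in> borel_measurable (M \<Otimes>\<^sub>M M)"
proof -
  have [measurable]: "(\<lambda>x. measure M {z \<in> space M. c z = c x}) \<in> borel_measurable M"
    by (rule measurable_compose[OF assms, where g = "\<lambda>k. measure M {z \<in> space M. c z = k}"]) simp
  have [measurable]: "Measurable.pred (M \<Otimes>\<^sub>M M) (\<lambda>p. c (fst p) = c (snd p))"
    by (rule measurable_label_eq) measurable
  show ?thesis unfolding kern_def split_beta by measurable
qed

context prob_space
begin

lemma AE_pair_fst:
  assumes "AE x in M. Q x"
  shows "AE p in M \<Otimes>\<^sub>M M. Q (fst p)"
proof -
  have "AE x in distr (M \<Otimes>\<^sub>M M) M fst. Q x" 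
    unfolding distr_pair_fst by (rule assms)
  then show ?thesis by (rule AE_distrD[rotated]) measurable
qed

text \<open>A class of measure zero has density \<open>1 / 0 = 0\<close> in \<open>kern\<close>.
  There are only countably many labels, so these classes do not disturb the marginals of the
  joining.\<close>

lemma AE_label_pos:
  fixes c :: "'a \<Rightarrow> 'c::countable"
  assumes [measurable]: "c \<in> M \<rightarrow>\<^sub>M count_space UNIV"
  shows "AE x in M. measure M {z \<in> space M. c z = c x} > 0"
proof -
  have "AE x in M. \<forall>k. measure M {z \<in> space M. c z = k} = 0 \<longrightarrow> c x \<noteq> k"
    unfolding AE_all_countable
  proof (intro allI)
    fix k
    show "AE x in M. measure M {z \<in> space M. c z = k} = 0 \<longrightarrow> c x \<noteq> k"
    proof (cases "measure M {z \<in> space M. c z = k} = 0")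
      case True
      then have "{z \<in> space M. c z = k} \<in> null_sets M" by (auto simp: null_sets_def emeasure_eq_measure)
      then have "AE x in M. x \<notin> {z \<in> space M. c z = k}" by (rule AE_not_in)
      then show ?thesis using AE_space by eventually_elim auto
    qed simp
  qed
  then show ?thesis by eventually_elim (metis measure_nonneg order_le_less)
qed

lemma kern_nn_integral_fst:
  fixes c :: "'a \<Rightarrow> 'c::countable"
  assumes c[measurable]: "c \<in> M \<rightarrow>\<^sub>M count_space UNIV" and f[measurable]: "f \<in> borel_measurable M"
  shows "(\<integral>\<^sup>+p. ennreal (kern M c p) * f (fst p) \<partial>(M \<Otimes>\<^sub>M M)) = (\<integral>\<^sup>+x. f x \<partial>M)"
proof -
  have "(\<integral>\<^sup>+p. ennreal (kern M c p) * f (fst p) \<partial>(M \<Otimes>\<^sub>M M)) = (\<integral>\<^sup>+x. (\<integral>\<^sup>+y. ennreal (kern M c (x, y)) * f x \<partial>M) \<partial>M)"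
    by (subst nn_integral_fst[symmetric]) simp_all
  also have "\<dots> = (\<integral>\<^sup>+x. f x \<partial>M)"
  proof (rule nn_integral_cong_AE)
    show "AE x in M. (\<integral>\<^sup>+y. ennreal (kern M c (x, y)) * f x \<partial>M) = f x"
      using AE_label_pos[OF c] AE_space
    proof eventually_elim
      case (elim x)
      let ?A = "{z \<in> space M. c z = c x}"
      have "(\<integral>\<^sup>+y. ennreal (kern M c (x, y)) * f x \<partial>M) = (\<integral>\<^sup>+y. (ennreal (1 / measure M ?A) * f x) * indicator ?A y \<partial>M)"
        by (intro nn_integral_cong) (auto simp: kern_def indicator_def)
      also have "\<dots> = ennreal (1 / measure M ?A) * f x * emeasure M ?A"
        by (rule nn_integral_cmult_indicator) measurable
      also have "\<dots> = (ennreal (1 / measure M ?A) * ennreal (measure M ?A)) * f x"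
        by (simp add: emeasure_eq_measure mult_ac)
      also have "ennreal (1 / measure M ?A) * ennreal (measure M ?A) = 1"
        using elim(1) by (simp add: ennreal_mult[symmetric])
      finally show ?case by simp
    qed
  qed
  finally show ?thesis .
qed

lemma kern_nn_integral_snd:
  fixes c :: "'a \<Rightarrow> 'c::countable"
  assumes c[measurable]: "c \<in> M \<rightarrow>\<^sub>M count_space UNIV" and f[measurable]: "f \<in> borel_measurable M"
  shows "(\<integral>\<^sup>+p. ennreal (kern M c p) * f (snd p) \<partial>(M \<Otimes>\<^sub>M M)) = (\<integral>\<^sup>+x. f x \<partial>M)"
proof -
  interpret P: pair_sigma_finite M M ..
  have "(\<integral>\<^sup>+p. ennreal (kern M c p) * f (snd p) \<partial>(M \<Otimes>\<^sub>M M)) = (\<integral>\<^sup>+y. (\<integral>\<^sup>+x. ennreal (kern M c (x, y)) * f y \<partial>M) \<partial>M)"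
    by (subst P.nn_integral_snd[symmetric]) simp_all
  also have "\<dots> = (\<integral>\<^sup>+x. (\<integral>\<^sup>+y. ennreal (kern M c (x, y)) * f x \<partial>M) \<partial>M)"
    by (subst kern_commute) simp
  also have "\<dots> = (\<integral>\<^sup>+p. ennreal (kern M c p) * f (fst p) \<partial>(M \<Otimes>\<^sub>M M))"
    by (subst nn_integral_fst[symmetric]) simp_all
  finally show ?thesis using kern_nn_integral_fst[OF c f] by simp
qed

lemma
  fixes c :: "'a \<Rightarrow> 'c::countable"
  assumes c[measurable]: "c \<in> M \<rightarrow>\<^sub>M count_space UNIV"
  shows integrable_kern: "integrable (M \<Otimes>\<^sub>M M) (kern M c)"
    and integral_kern: "(\<integral>p. kern M c p \<partial>(M \<Otimes>\<^sub>M M)) = 1"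
proof -
  have 1: "(\<integral>\<^sup>+p. ennreal (kern M c p) \<partial>(M \<Otimes>\<^sub>M M)) = ennreal 1"
    using kern_nn_integral_fst[OF c, of "\<lambda>_. 1"] by (simp add: emeasure_space_1)
  show "integrable (M \<Otimes>\<^sub>M M) (kern M c)" by (rule integrableI_nn_integral_finite[OF _ _ 1]) auto
  show "(\<integral>p. kern M c p \<partial>(M \<Otimes>\<^sub>M M)) = 1" using 1 by (intro integral_eq_nn_integral[THEN trans]) auto
qed

lemma integrable_kern_indicator:
  fixes c :: "'a \<Rightarrow> 'c::countable"
  assumes [measurable]: "c \<in> M \<rightarrow>\<^sub>M count_space UNIV" "S \<in> sets (M \<Otimes>\<^sub>M M)"
  shows "integrable (M \<Otimes>\<^sub>M M) (\<lambda>p. kern M c p * indicator S p)"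
  by (rule Bochner_Integration.integrable_bound[OF integrable_kern[OF assms(1)]])
     (auto simp: indicator_def)

text \<open>The probability that two points drawn from the joining over \<open>c\<close>, hence
  independently within a common class, have different \<open>d\<close>. It quantifies how far
  \<open>d\<close> is from being a function of \<open>c\<close>.\<close>

definition joint_mass :: "('a \<Rightarrow> 'c) \<Rightarrow> ('a \<Rightarrow> 'd) \<Rightarrow> real" where
  "joint_mass c d = (\<integral>p. kern M c p * indicator {p. d (fst p) \<noteq> d (snd p)} p \<partial>(M \<Otimes>\<^sub>M M))"

lemma measurable_label_neq:
  fixes d :: "'a \<Rightarrow> 'd::countable"
  assumes [measurable]: "d \<in> M \<rightarrow>\<^sub>M count_space UNIV"
  shows "Measurable.pred (M \<Otimes>\<^sub>M M) (\<lambda>p. d (fst p) \<noteq> d (snd p))"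
proof -
  have [measurable]: "Measurable.pred (M \<Otimes>\<^sub>M M) (\<lambda>p. d (fst p) = d (snd p))"
    by (rule measurable_label_eq) measurable
  show ?thesis by measurable
qed

lemma integrable_joint_mass:
  fixes c :: "'a \<Rightarrow> 'c::countable" and d :: "'a \<Rightarrow> 'd::countable"
  assumes [measurable]: "c \<in> M \<rightarrow>\<^sub>M count_space UNIV" "d \<in> M \<rightarrow>\<^sub>M count_space UNIV"
  shows "integrable (M \<Otimes>\<^sub>M M) (\<lambda>p. kern M c p * indicator {p. d (fst p) \<noteq> d (snd p)} p)"
proof -
  have [measurable]: "Measurable.pred (M \<Otimes>\<^sub>M M) (\<lambda>p. d (fst p) \<noteq> d (snd p))"
    by (rule measurable_label_neq) measurable
  have "integrable (M \<Otimes>\<^sub>M M) (\<lambda>p. kern M c p * indicator {p \<in> space (M \<Otimes>\<^sub>M M). d (fst p) \<noteq> d (snd p)} p)"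
    by (rule integrable_kern_indicator) measurable
  then show ?thesis by (rule Bochner_Integration.integrable_cong[THEN iffD1, rotated 2]) (auto simp: indicator_def)
qed

lemma joint_mass_nonneg: "joint_mass c d \<ge> 0"
  unfolding joint_mass_def by (intro integral_nonneg_AE) auto

lemma joint_mass_mono:
  fixes c :: "'a \<Rightarrow> 'c::countable" and d :: "'a \<Rightarrow> 'd::countable" and e :: "'a \<Rightarrow> 'e::countable"
  assumes [measurable]: "c \<in> M \<rightarrow>\<^sub>M count_space UNIV" "d \<in> M \<rightarrow>\<^sub>M count_space UNIV" "e \<in> M \<rightarrow>\<^sub>M count_space UNIV"
    and "\<And>x y. x \<in> space M \<Longrightarrow> y \<in> space M \<Longrightarrow> c x = c y \<Longrightarrow> e x = e y \<Longrightarrow> d x = d y"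
  shows "joint_mass c d \<le> joint_mass c e"
  unfolding joint_mass_def
proof (intro integral_mono integrable_joint_mass)
  fix p assume "p \<in> space (M \<Otimes>\<^sub>M M)"
  then obtain x y where p: "p = (x, y)" "x \<in> space M" "y \<in> space M" by (auto simp: space_pair_measure)
  show "kern M c p * indicator {p. d (fst p) \<noteq> d (snd p)} p \<le> kern M c p * indicator {p. e (fst p) \<noteq> e (snd p)} p"
  proof (cases "c x = c y \<and> d x \<noteq> d y")
    case True
    then have "e x \<noteq> e y" using assms(4) p by metis
    then show ?thesis by (simp add: p True)
  next
    case False
    then have "kern M c p * indicator {p. d (fst p) \<noteq> d (snd p)} p = 0" by (auto simp: p kern_def)
    then show ?thesis by (simp only:) (intro mult_nonneg_nonneg kern_nonneg indicator_pos_le)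
  qed
qed measurable

text \<open>Both densities have integral 1, and on pairs with equal \<open>d\<close> passing to the
  smaller class can only increase the density. The L1 distance is therefore twice the mass that is
  lost, and this mass sits on the pairs separated by \<open>d\<close>.\<close>

lemma kern_refine_distance:
  fixes c :: "'a \<Rightarrow> 'c::countable" and d :: "'a \<Rightarrow> 'd::countable"
  assumes c[measurable]: "c \<in> M \<rightarrow>\<^sub>M count_space UNIV" and d[measurable]: "d \<in> M \<rightarrow>\<^sub>M count_space UNIV"
    and ref: "\<And>x y. d x = d y \<Longrightarrow> c x = c y"
  shows "(\<integral>p. \<bar>kern M c p - kern M d p\<bar> \<partial>(M \<Otimes>\<^sub>M M)) = 2 * joint_mass c d"
proof -
  let ?P = "M \<Otimes>\<^sub>M M"
  let ?N = "{p. d (fst p) \<noteq> d (snd p)}"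
  interpret P: pair_sigma_finite M M ..
  have A: "AE p in ?P. measure M {z \<in> space M. d z = d (fst p)} > 0"
    using AE_label_pos[OF d] by (rule AE_pair_fst)
  have "(\<integral>p. \<bar>kern M c p - kern M d p\<bar> \<partial>?P) = (\<integral>p. (kern M d p - kern M c p) + 2 * (kern M c p * indicator ?N p) \<partial>?P)"
  proof (rule integral_cong_AE)
    have [measurable]: "Measurable.pred ?P (\<lambda>p. d (fst p) \<noteq> d (snd p))" by (rule measurable_label_neq) measurable
    show "(\<lambda>p. (kern M d p - kern M c p) + 2 * (kern M c p * indicator ?N p)) \<in> borel_measurable ?P" 
      unfolding indicator_def mem_Collect_eq by measurable
    show "AE p in ?P. \<bar>kern M c p - kern M d p\<bar> = (kern M d p - kern M c p) + 2 * (kern M c p * indicator ?N p)"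
      using A
    proof eventually_elim
      case (elim p)
      obtain x y where p: "p = (x, y)" by (cases p)
      show ?case
      proof (cases "d x = d y")
        case True
        have "measure M {z \<in> space M. d z = d x} \<le> measure M {z \<in> space M. c z = c x}"
          by (rule finite_measure_mono) (auto intro: ref)
        then have "1 / measure M {z \<in> space M. c z = c x} \<le> 1 / measure M {z \<in> space M. d z = d x}"
          using elim p by (intro divide_left_mono) auto
        then show ?thesis using True ref[OF True] by (auto simp: p kern_def)
      next
        case False
        then have "kern M d p = 0" by (simp add: kern_def p)
        then show ?thesis using False by (simp add: p)
      qed
    qed
  qed measurable
  also have "\<dots> = 2 * joint_mass c d"
    unfolding joint_mass_def
    using integrable_kern[OF c] integrable_kern[OF d] integrable_joint_mass[OF c d] integral_kern[OF c] integral_kern[OF d]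
    by simp
  finally show ?thesis .
qed

text \<open>In general neither partition refines the other, so both are compared with their common
  refinement.\<close>

lemma kern_distance:
  fixes c :: "'a \<Rightarrow> 'c::countable" and d :: "'a \<Rightarrow> 'd::countable"
  assumes c[measurable]: "c \<in> M \<rightarrow>\<^sub>M count_space UNIV" and d[measurable]: "d \<in> M \<rightarrow>\<^sub>M count_space UNIV"
  shows "(\<integral>p. \<bar>kern M c p - kern M d p\<bar> \<partial>(M \<Otimes>\<^sub>M M)) \<le> 2 * joint_mass c d + 2 * joint_mass d c"
proof -
  let ?e = "\<lambda>x. (c x, d x)"
  have e[measurable]: "?e \<in> M \<rightarrow>\<^sub>M count_space UNIV" by measurable
  note I = integrable_kern[OF c] integrable_kern[OF d] integrable_kern[OF e]
  have "(\<integral>p. \<bar>kern M c p - kern M d p\<bar> \<partial>(M \<Otimes>\<^sub>M M)) \<le>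
      (\<integral>p. \<bar>kern M c p - kern M ?e p\<bar> + \<bar>kern M d p - kern M ?e p\<bar> \<partial>(M \<Otimes>\<^sub>M M))"
    by (intro integral_mono Bochner_Integration.integrable_add integrable_abs Bochner_Integration.integrable_diff I) auto
  also have "\<dots> = 2 * joint_mass c ?e + 2 * joint_mass d ?e"
    using kern_refine_distance[OF c e] kern_refine_distance[OF d e] I by simp
  also have "\<dots> \<le> 2 * joint_mass c d + 2 * joint_mass d c"
    using joint_mass_mono[OF c e d] joint_mass_mono[OF d e c] by simp
  finally show ?thesis .
qed

text \<open>A separated pair within a class of \<open>c\<close> has a coordinate in
  \<open>B\<close>, and both marginals of the joining are \<open>M\<close>; this accounts for the
  factor 2.\<close>

lemma joint_mass_bound:
  fixes c :: "'a \<Rightarrow> 'c::countable" and e :: "'a \<Rightarrow> 'e::countable"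
  assumes c[measurable]: "c \<in> M \<rightarrow>\<^sub>M count_space UNIV" and e[measurable]: "e \<in> M \<rightarrow>\<^sub>M count_space UNIV"
    and B[measurable]: "B \<in> sets M"
    and good: "\<And>x y. x \<in> space M - B \<Longrightarrow> y \<in> space M - B \<Longrightarrow> c x = c y \<Longrightarrow> e x = e y"
  shows "joint_mass c e \<le> 2 * measure M B"
proof -
  let ?P = "M \<Otimes>\<^sub>M M"
  have "ennreal (joint_mass c e) = (\<integral>\<^sup>+p. ennreal (kern M c p * indicator {p. e (fst p) \<noteq> e (snd p)} p) \<partial>?P)"
    unfolding joint_mass_def
    by (rule nn_integral_eq_integral[symmetric]) (use integrable_joint_mass[OF c e] in auto)
  also have "\<dots> \<le> (\<integral>\<^sup>+p. ennreal (kern M c p) * indicator B (fst p) + ennreal (kern M c p) * indicator B (snd p) \<partial>?P)"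
  proof (rule nn_integral_mono)
    fix p assume "p \<in> space ?P"
    then obtain x y where p: "p = (x, y)" "x \<in> space M" "y \<in> space M" by (auto simp: space_pair_measure)
    show "ennreal (kern M c p * indicator {p. e (fst p) \<noteq> e (snd p)} p) \<le>
        ennreal (kern M c p) * indicator B (fst p) + ennreal (kern M c p) * indicator B (snd p)"
    proof (cases "x \<in> B \<or> y \<in> B")
      case True
      then show ?thesis by (auto simp: p indicator_def)
    next
      case False
      then have "c x = c y \<Longrightarrow> e x = e y" using good p by blast
      then have "kern M c p * indicator {p. e (fst p) \<noteq> e (snd p)} p = 0" by (auto simp: p kern_def)
      then show ?thesis by (metis ennreal_0 zero_le)
    qed
  qed
  also have "\<dots> = emeasure M B + emeasure M B"
    using kern_nn_integral_fst[OF c, of "indicator B"] kern_nn_integral_snd[OF c, of "indicator B"]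
    by (subst nn_integral_add) simp_all
  also have "\<dots> = ennreal (2 * measure M B)" by (simp add: emeasure_eq_measure ennreal_plus[symmetric] del: ennreal_plus)
  finally show ?thesis by (simp add: ennreal_le_iff)
qed

end

context refining_labels
begin

lemma joint_mass_tendsto_0:
  fixes e :: "'x \<Rightarrow> 'e::countable"
  assumes e[measurable]: "e \<in> M \<rightarrow>\<^sub>M count_space UNIV"
    and ap: "\<And>A. A \<in> sets M \<Longrightarrow> approximable A"
  shows "(\<lambda>n. joint_mass (c n) e) \<longlonglongrightarrow> 0"
proof (rule LIMSEQ_I)
  fix r :: real assume "r > 0"
  define A where "A j = {x \<in> space M. to_nat (e x) = j}" for j
  have A[measurable]: "A j \<in> sets M" for j unfolding A_def by measurable
  define R where "R J = {x \<in> space M. to_nat (e x) \<ge> J}" for J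
  have R[measurable]: "R J \<in> sets M" for J unfolding R_def by measurable
  have "(\<lambda>J. measure M (R J)) \<longlonglongrightarrow> measure M (\<Inter>J. R J)"
    by (rule finite_Lim_measure_decseq) (auto simp: decseq_def R_def)
  moreover have "(\<Inter>J. R J) = {}"
  proof -
    have "x \<notin> R (Suc (to_nat (e x)))" for x by (simp add: R_def)
    then show ?thesis by blast
  qed
  ultimately have "\<forall>\<^sub>F J in sequentially. measure M (R J) < r / 8"
    using \<open>r > 0\<close> by (intro order_tendstoD(2)) auto
  then obtain J where J: "measure M (R J) < r / 8" by (auto simp: eventually_sequentially)
  \<comment> \<open>The tail \<open>R J\<close> and the \<open>J\<close> approximation errors
    together contribute at most \<open>r / 8 + r / 8\<close>, and \<open>joint_mass_bound\<close>
    doubles this. The summand 1 covers \<open>J = 0\<close>.\<close>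
  have pos: "r / (8 * (real J + 1)) > 0" using \<open>r > 0\<close> by simp
  have "\<exists>n. \<forall>m\<ge>n. \<exists>S. err (A j) m S < r / (8 * (real J + 1))" for j
    using approximable_at[OF ap[OF A] pos, of j] by metis
  then obtain n where n: "\<And>j m. n j \<le> m \<Longrightarrow> \<exists>S. err (A j) m S < r / (8 * (real J + 1))" by metis
  define N where "N = Max (insert 0 (n ` {..<J}))"
  have "norm (joint_mass (c m) e - 0) < r" if m: "N \<le> m" for m
  proof -
    have "\<exists>S. err (A j) m S < r / (8 * (real J + 1))" if "j < J" for j
    proof (rule n)
      have "n j \<le> N" unfolding N_def by (rule Max_ge) (use that in auto)
      then show "n j \<le> m" using m by simp
    qed
    then obtain S where S: "\<And>j. j < J \<Longrightarrow> err (A j) m (S j) < r / (8 * (real J + 1))" by metis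
    define D where "D j = {x \<in> space M. (x \<in> A j) \<noteq> (c m x \<in> S j)}" for j
    have D[measurable]: "D j \<in> sets M" for j unfolding D_def by measurable
    have "joint_mass (c m) e \<le> 2 * measure M (R J \<union> (\<Union>j<J. D j))"
    proof (rule joint_mass_bound)
      fix x y assume x: "x \<in> space M - (R J \<union> (\<Union>j<J. D j))" and y: "y \<in> space M - (R J \<union> (\<Union>j<J. D j))"
        and cc: "c m x = c m y"
      define j where "j = to_nat (e x)"
      have j: "j < J" using x by (auto simp: R_def j_def)
      have "x \<in> A j" using x by (simp add: A_def j_def)
      moreover have "x \<notin> D j" "y \<notin> D j" using x y j by auto
      ultimately have "y \<in> A j" using x y cc by (auto simp: D_def)
      then show "e x = e y" by (simp add: A_def j_def)
    qed measurable
    also have "measure M (R J \<union> (\<Union>j<J. D j)) \<le> measure M (R J) + measure M (\<Union>j<J. D j)"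
      by (rule measure_Un_le) measurable
    also have "measure M (\<Union>j<J. D j) \<le> (\<Sum>j<J. measure M (D j))"
      by (rule measure_UNION_le) auto
    also have "\<dots> \<le> (\<Sum>j<J. r / (8 * (real J + 1)))"
      by (rule sum_mono) (use S in \<open>auto simp: D_def err_def intro: less_imp_le\<close>)
    also have "\<dots> = r / 8 * (real J / (real J + 1))" by (simp add: field_simps)
    also have "\<dots> \<le> r / 8 * 1" using \<open>r > 0\<close> by (intro mult_left_mono) auto
    finally have "joint_mass (c m) e < r" using J \<open>r > 0\<close> by simp
    then show ?thesis using joint_mass_nonneg[of "c m" e] by simp
  qed
  then show "\<exists>N. \<forall>m\<ge>N. norm (joint_mass (c m) e - 0) < r" by blast
qed

end

section \<open>Joinings under measure-preserving maps\<close>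

lemma distr_map_prod_preserving:
  assumes "prob_space M" "prob_space N" and T[measurable]: "T \<in> M \<rightarrow>\<^sub>M N" and "distr M N T = N"
  shows "distr (M \<Otimes>\<^sub>M M) (N \<Otimes>\<^sub>M N) (map_prod T T) = N \<Otimes>\<^sub>M N"
proof -
  interpret N: prob_space N by fact
  have "distr M N T \<Otimes>\<^sub>M distr M N T = distr (M \<Otimes>\<^sub>M M) (N \<Otimes>\<^sub>M N) (\<lambda>(x, y). (T x, T y))"
    by (rule pair_measure_distr[OF T T]) (simp add: assms(4) N.sigma_finite_measure_axioms)
  then show ?thesis by (simp add: assms(4) map_prod_def)
qed

lemma measurable_map_prod [measurable (raw)]:
  assumes [measurable]: "T \<in> M \<rightarrow>\<^sub>M N" "U \<in> M' \<rightarrow>\<^sub>M N'"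
  shows "map_prod T U \<in> M \<Otimes>\<^sub>M M' \<rightarrow>\<^sub>M N \<Otimes>\<^sub>M N'"
  unfolding map_prod_def by measurable

text \<open>A measure-preserving map keeps the measures of the classes, so moving the joining
  amounts to moving the labels.\<close>

lemma kern_comp:
  fixes c :: "'x \<Rightarrow> 'c::countable"
  assumes [measurable]: "c \<in> M \<rightarrow>\<^sub>M count_space UNIV" "T \<in> M \<rightarrow>\<^sub>M M" and "distr M M T = M"
  shows "kern M (c \<circ> T) p = kern M c (map_prod T T p)"
proof -
  have "measure M {z \<in> space M. c (T z) = k} = measure M {z \<in> space M. c z = k}" for k
  proof -
    have "measure M {z \<in> space M. c z = k} = measure (distr M M T) {z \<in> space M. c z = k}" by (simp add: assms(3))
    also have "\<dots> = measure M (T -` {z \<in> space M. c z = k} \<inter> space M)" by (rule measure_distr) measurable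
    also have "T -` {z \<in> space M. c z = k} \<inter> space M = {z \<in> space M. c (T z) = k}"
      using measurable_space[OF assms(2)] by auto
    finally show ?thesis by simp
  qed
  then show ?thesis by (cases p) (simp add: kern_def)
qed

text \<open>The two joint masses in \<open>kern_distance\<close> compare \<open>c n\<close> with its
  shift in both directions. One is controlled by \<open>e\<close> directly; the other is moved to
  the inverse map \<open>T'\<close> and controlled by its cutting \<open>e'\<close>. Neither
  \<open>e\<close> nor \<open>e'\<close> depends on \<open>n\<close>, so both bounds tend to
  0.\<close>

lemma (in refining_labels) kern_asymptotically_invariant:
  fixes e e' :: "'x \<Rightarrow> 'e::countable"
  assumes ap: "\<And>A. A \<in> sets M \<Longrightarrow> approximable A"
    and T[measurable]: "T \<in> M \<rightarrow>\<^sub>M M" and Tp: "distr M M T = M"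
    and T'[measurable]: "T' \<in> M \<rightarrow>\<^sub>M M" and inv: "\<And>x. x \<in> space M \<Longrightarrow> T' (T x) = x"
    and e[measurable]: "e \<in> M \<rightarrow>\<^sub>M count_space UNIV" "e' \<in> M \<rightarrow>\<^sub>M count_space UNIV"
    and eT: "\<And>n x y. x \<in> space M \<Longrightarrow> y \<in> space M \<Longrightarrow> c n x = c n y \<Longrightarrow> e x = e y \<Longrightarrow> c n (T x) = c n (T y)"
    and eT': "\<And>n x y. x \<in> space M \<Longrightarrow> y \<in> space M \<Longrightarrow> c n x = c n y \<Longrightarrow> e' x = e' y \<Longrightarrow> c n (T' x) = c n (T' y)"
  shows "(\<lambda>n. \<integral>p. \<bar>kern M (c n) (map_prod T T p) - kern M (c n) p\<bar> \<partial>(M \<Otimes>\<^sub>M M)) \<longlonglongrightarrow> 0"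
proof -
  let ?P = "M \<Otimes>\<^sub>M M"
  have up: "(\<integral>p. \<bar>kern M (c n) (map_prod T T p) - kern M (c n) p\<bar> \<partial>?P) \<le> 2 * joint_mass (c n) e' + 2 * joint_mass (c n) e" for n
  proof -
    have m: "c n \<circ> T \<in> M \<rightarrow>\<^sub>M count_space UNIV" by measurable
    have "(\<integral>p. \<bar>kern M (c n) (map_prod T T p) - kern M (c n) p\<bar> \<partial>?P) \<le> 2 * joint_mass (c n \<circ> T) (c n) + 2 * joint_mass (c n) (c n \<circ> T)"
      using kern_distance[OF m c_measurable[of n]] by (simp add: kern_comp[OF c_measurable T Tp])
    also have "joint_mass (c n) (c n \<circ> T) \<le> joint_mass (c n) e"
      by (rule joint_mass_mono) (measurable, unfold comp_def, rule eT)
    also have "joint_mass (c n \<circ> T) (c n) = joint_mass (c n) (c n \<circ> T')"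
    proof -
      \<comment> \<open>Precomposing with \<open>T\<close> turns the pair of labels
        \<open>c n\<close> and \<open>c n \<circ> T'\<close> into the pair
        \<open>c n \<circ> T\<close> and \<open>c n\<close>, and \<open>T\<close> preserves the
        product measure.\<close>
      have "joint_mass (c n) (c n \<circ> T') =
        (\<integral>p. kern M (c n) p * indicator {p. (c n \<circ> T') (fst p) \<noteq> (c n \<circ> T') (snd p)} p \<partial>distr ?P ?P (map_prod T T))"
        unfolding joint_mass_def
        by (simp add: distr_map_prod_preserving[OF prob_space_axioms prob_space_axioms T Tp])
      also have "\<dots> = (\<integral>p. kern M (c n) (map_prod T T p) * indicator {p. (c n \<circ> T') (fst p) \<noteq> (c n \<circ> T') (snd p)} (map_prod T T p) \<partial>?P)"
      proof (rule integral_distr)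
        show "(\<lambda>p. kern M (c n) p * indicator {p. (c n \<circ> T') (fst p) \<noteq> (c n \<circ> T') (snd p)} p) \<in> borel_measurable ?P"
          using borel_measurable_integrable[OF integrable_joint_mass[of "c n" "c n \<circ> T'"]] by simp
      qed measurable
      also have "\<dots> = joint_mass (c n \<circ> T) (c n)"
        unfolding joint_mass_def kern_comp[OF c_measurable T Tp]
        by (rule Bochner_Integration.integral_cong) (auto simp: inv indicator_def space_pair_measure)
      finally show ?thesis by simp
    qed
    also have "joint_mass (c n) (c n \<circ> T') \<le> joint_mass (c n) e'"
      by (rule joint_mass_mono) (measurable, unfold comp_def, rule eT')
    finally show ?thesis by simp
  qed
  have "(\<lambda>n. 2 * joint_mass (c n) e' + 2 * joint_mass (c n) e) \<longlonglongrightarrow> 2 * 0 + 2 * 0"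
    by (intro tendsto_intros joint_mass_tendsto_0 ap e)
  then have "(\<lambda>n. 2 * joint_mass (c n) e' + 2 * joint_mass (c n) e) \<longlonglongrightarrow> 0" by simp
  then show ?thesis by (rule tendsto_sandwich[OF _ _ tendsto_const, rotated 2]) (use up in auto)
qed

section \<open>Passing to the factor\<close>

text \<open>\<open>map_prod p p\<close> sends the product measure to the product measure, so the
  image of the measure with density \<open>k\<close> is absolutely continuous; \<open>h\<close> is
  its Radon-Nikodym derivative.\<close>

lemma push_forward_density:
  fixes k :: "'x \<times> 'x \<Rightarrow> real" and p :: "'x \<Rightarrow> 'y"
  assumes "prob_space M" "prob_space N" and p[measurable]: "p \<in> M \<rightarrow>\<^sub>M N" and pN: "distr M N p = N"
    and k[measurable]: "integrable (M \<Otimes>\<^sub>M M) k" and k0: "\<And>z. k z \<ge> 0"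
  obtains h where "h \<in> borel_measurable (N \<Otimes>\<^sub>M N)" "\<And>z. h z \<ge> 0" "integrable (N \<Otimes>\<^sub>M N) h"
    "\<And>F. F \<in> borel_measurable (N \<Otimes>\<^sub>M N) \<Longrightarrow>
      (\<integral>z. h z * F z \<partial>(N \<Otimes>\<^sub>M N)) = (\<integral>z. k z * F (map_prod p p z) \<partial>(M \<Otimes>\<^sub>M M) :: real)"
proof -
  interpret M: prob_space M by fact
  interpret N: prob_space N by fact
  interpret NN: pair_prob_space N N ..
  have km[measurable]: "k \<in> borel_measurable (M \<Otimes>\<^sub>M M)" using k by (rule borel_measurable_integrable)
  define D where "D = density (M \<Otimes>\<^sub>M M) (\<lambda>z. ennreal (k z))"
  have pD[measurable]: "map_prod p p \<in> D \<rightarrow>\<^sub>M N \<Otimes>\<^sub>M N" unfolding D_def by measurable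
  define H where "H = distr D (N \<Otimes>\<^sub>M N) (map_prod p p)"
  have "emeasure D (space D) = (\<integral>\<^sup>+z. ennreal (k z) \<partial>(M \<Otimes>\<^sub>M M))"
    unfolding D_def by (simp add: emeasure_density cong: nn_integral_cong)
  also have "\<dots> < \<infinity>" using k k0 by (simp add: integrable_iff_bounded)
  finally interpret D: finite_measure D by (intro finite_measureI) auto
  interpret H: finite_measure H unfolding H_def by (rule D.finite_measure_distr) (rule pD)
  have sH: "sets H = sets (N \<Otimes>\<^sub>M N)" by (simp add: H_def)
  have ac: "absolutely_continuous (N \<Otimes>\<^sub>M N) H"
    unfolding absolutely_continuous_def
  proof
    fix A assume A: "A \<in> null_sets (N \<Otimes>\<^sub>M N)"
    then have Am: "A \<in> sets (N \<Otimes>\<^sub>M N)" by auto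
    have "A \<in> null_sets (distr (M \<Otimes>\<^sub>M M) (N \<Otimes>\<^sub>M N) (map_prod p p))"
      using A distr_map_prod_preserving[OF assms(1,2) p pN] by simp
    then have "map_prod p p -` A \<inter> space (M \<Otimes>\<^sub>M M) \<in> null_sets (M \<Otimes>\<^sub>M M)"
      by (subst (asm) null_sets_distr_iff) auto
    then have "map_prod p p -` A \<inter> space (M \<Otimes>\<^sub>M M) \<in> null_sets D"
      unfolding D_def by (subst null_sets_density_iff) (auto dest: AE_not_in elim: eventually_mono)
    then show "A \<in> null_sets H" unfolding H_def using Am
      by (subst null_sets_distr_iff[OF pD]) (auto simp: D_def)
  qed
  obtain h where h[measurable]: "h \<in> borel_measurable (N \<Otimes>\<^sub>M N)"
    and hR: "AE x in N \<Otimes>\<^sub>M N. RN_deriv (N \<Otimes>\<^sub>M N) H x = ennreal (h x)" and h0: "\<And>x. 0 \<le> h x"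
    by (rule NN.P.real_RN_deriv[OF H.finite_measure_axioms ac sH]) blast
  have H_eq: "density (N \<Otimes>\<^sub>M N) (\<lambda>z. ennreal (h z)) = H"
  proof -
    have "density (N \<Otimes>\<^sub>M N) (\<lambda>z. ennreal (h z)) = density (N \<Otimes>\<^sub>M N) (RN_deriv (N \<Otimes>\<^sub>M N) H)"
      by (rule density_cong) (use hR in \<open>auto elim: eventually_mono\<close>)
    then show ?thesis using NN.P.density_RN_deriv[OF ac sH] by simp
  qed
  show thesis
  proof (rule that[OF h h0])
    have "(\<integral>\<^sup>+z. ennreal (h z) \<partial>(N \<Otimes>\<^sub>M N)) = emeasure H (space H)"
      using sets_eq_imp_space_eq[OF sH]
      by (subst H_eq[symmetric]) (simp add: emeasure_density cong: nn_integral_cong)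
    then show "integrable (N \<Otimes>\<^sub>M N) h" using h0 H.emeasure_finite[of "space H"]
      by (simp add: integrable_iff_bounded less_top[symmetric])
    fix F :: "'y \<times> 'y \<Rightarrow> real" assume F[measurable]: "F \<in> borel_measurable (N \<Otimes>\<^sub>M N)"
    have "(\<integral>z. h z * F z \<partial>(N \<Otimes>\<^sub>M N)) = (\<integral>z. F z \<partial>density (N \<Otimes>\<^sub>M N) (\<lambda>z. ennreal (h z)))"
      by (subst integral_density) (auto simp: h0)
    also have "\<dots> = (\<integral>z. F (map_prod p p z) \<partial>D)"
      unfolding H_eq unfolding H_def by (rule integral_distr) measurable
    also have "\<dots> = (\<integral>z. k z * F (map_prod p p z) \<partial>(M \<Otimes>\<^sub>M M))"
      unfolding D_def by (subst integral_density) (auto simp: k0)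
    finally show "(\<integral>z. h z * F z \<partial>(N \<Otimes>\<^sub>M N)) = (\<integral>z. k z * F (map_prod p p z) \<partial>(M \<Otimes>\<^sub>M M))" .
  qed
qed

text \<open>Taking image measures does not increase total variation. The L1 distance on the factor
  is tested against its sign function \<open>F\<close>, which \<open>hk\<close> pulls back to a test
  function on \<open>M\<close> bounded by 1.\<close>

lemma push_forward_contraction:
  fixes k :: "'x \<times> 'x \<Rightarrow> real" and h :: "'y \<times> 'y \<Rightarrow> real"
  assumes "prob_space M" "prob_space N" and p[measurable]: "p \<in> M \<rightarrow>\<^sub>M N"
    and k: "integrable (M \<Otimes>\<^sub>M M) k" and h: "integrable (N \<Otimes>\<^sub>M N) h"
    and hk: "\<And>F :: 'y \<times> 'y \<Rightarrow> real. F \<in> borel_measurable (N \<Otimes>\<^sub>M N) \<Longrightarrow>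
      (\<integral>z. h z * F z \<partial>(N \<Otimes>\<^sub>M N)) = (\<integral>z. k z * F (map_prod p p z) \<partial>(M \<Otimes>\<^sub>M M))"
    and S[measurable]: "S \<in> M \<rightarrow>\<^sub>M M" "distr M M S = M"
    and T[measurable]: "T \<in> N \<rightarrow>\<^sub>M N" "distr N N T = N"
    and T'[measurable]: "T' \<in> N \<rightarrow>\<^sub>M N" and inv: "\<And>y. y \<in> space N \<Longrightarrow> T' (T y) = y"
    and eq: "AE x in M. p (S x) = T (p x)"
  shows "(\<integral>z. \<bar>h (map_prod T T z) - h z\<bar> \<partial>(N \<Otimes>\<^sub>M N)) \<le> (\<integral>z. \<bar>k (map_prod S S z) - k z\<bar> \<partial>(M \<Otimes>\<^sub>M M))"
proof -
  interpret M: prob_space M by fact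
  interpret N: prob_space N by fact
  interpret PM: pair_sigma_finite M M ..
  let ?P = "M \<Otimes>\<^sub>M M" and ?Q = "N \<Otimes>\<^sub>M N"
  let ?S = "map_prod S S" and ?T = "map_prod T T" and ?T' = "map_prod T' T'" and ?p = "map_prod p p"
  have [measurable]: "h \<in> borel_measurable ?Q" "k \<in> borel_measurable ?P" using h k by auto
  have [measurable]: "?T \<in> ?Q \<rightarrow>\<^sub>M ?Q" "?T' \<in> ?Q \<rightarrow>\<^sub>M ?Q" "?S \<in> ?P \<rightarrow>\<^sub>M ?P" "?p \<in> ?P \<rightarrow>\<^sub>M ?Q"
    by (intro measurable_map_prod S T T' p)+
  note dS = distr_map_prod_preserving[OF assms(1,1) S] and dT = distr_map_prod_preserving[OF assms(2,2) T]
  have hT: "integrable ?Q (\<lambda>z. h (?T z))"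
    using h by (subst (asm) dT[symmetric], subst (asm) integrable_distr_eq) auto
  have kS: "integrable ?P (\<lambda>z. k (?S z))"
    using k by (subst (asm) dS[symmetric], subst (asm) integrable_distr_eq) auto
  define F where "F z = sgn (h (?T z) - h z)" for z
  have F[measurable]: "F \<in> borel_measurable ?Q" unfolding F_def by measurable
  have F1: "\<bar>F z\<bar> \<le> 1" for z by (simp add: F_def sgn_real_def)
  have bd: "integrable W (\<lambda>z. f z * G z)" if "integrable W f" "G \<in> borel_measurable W" "\<And>z. \<bar>G z\<bar> \<le> 1"
    for W :: "'w measure" and f G :: "'w \<Rightarrow> real"
  proof (rule Bochner_Integration.integrable_bound[OF that(1)])
    show "AE z in W. norm (f z * G z) \<le> norm (f z)"
      using that(3) by (intro AE_I2) (simp add: abs_mult mult_left_le)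
  qed (use that in auto)
  have e1: "AE z in ?P. p (S (fst z)) = T (p (fst z))" by (rule M.AE_pair_fst[OF eq])
  have e2: "AE z in ?P. p (S (snd z)) = T (p (snd z))"
  proof -
    have "AE z in distr ?P ?P (\<lambda>(x, y). (y, x)). p (S (fst z)) = T (p (fst z))"
      by (subst PM.distr_pair_swap[symmetric]) (rule e1)
    then have "AE z in ?P. p (S (fst (case z of (x, y) \<Rightarrow> (y, x)))) = T (p (fst (case z of (x, y) \<Rightarrow> (y, x))))"
      by (rule AE_distrD[rotated]) measurable
    then show ?thesis by (simp add: split_beta)
  qed
  \<comment> \<open>Writing \<open>F\<close> as \<open>F \<circ> ?T' \<circ> ?T\<close> makes the
    whole integrand a function of \<open>?T z\<close>. A change of variables then removes
    \<open>T\<close> on the factor, and after passing to \<open>M\<close> the reverse change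
    introduces \<open>S\<close>.\<close>
  have "(\<integral>z. h (?T z) * F z \<partial>?Q) = (\<integral>z. h (?T z) * F (?T' (?T z)) \<partial>?Q)"
    by (rule Bochner_Integration.integral_cong) (auto simp: space_pair_measure inv)
  also have "\<dots> = (\<integral>z. h z * F (?T' z) \<partial>distr ?Q ?Q ?T)"
    by (rule integral_distr[symmetric]) measurable
  also have "\<dots> = (\<integral>z. k z * F (?T' (?p z)) \<partial>?P)" unfolding dT by (rule hk) measurable
  also have "\<dots> = (\<integral>z. k z * F (?T' (?p z)) \<partial>distr ?P ?P ?S)" unfolding dS ..
  also have "\<dots> = (\<integral>z. k (?S z) * F (?T' (?p (?S z))) \<partial>?P)"
    by (rule integral_distr) measurable
  also have "\<dots> = (\<integral>z. k (?S z) * F (?p z) \<partial>?P)"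
  proof (rule integral_cong_AE)
    show "AE z in ?P. k (?S z) * F (?T' (?p (?S z))) = k (?S z) * F (?p z)"
      using e1 e2 AE_space
    proof eventually_elim
      case (elim z)
      then have "?T' (?p (?S z)) = ?p z"
        using measurable_space[OF p] by (cases z) (auto simp: inv space_pair_measure)
      then show ?case by simp
    qed
  qed measurable
  finally have A: "(\<integral>z. h (?T z) * F z \<partial>?Q) = (\<integral>z. k (?S z) * F (?p z) \<partial>?P)" .
  have "(\<integral>z. \<bar>h (?T z) - h z\<bar> \<partial>?Q) = (\<integral>z. h (?T z) * F z - h z * F z \<partial>?Q)"
    by (rule Bochner_Integration.integral_cong) (auto simp: F_def sgn_real_def abs_real_def)
  also have "\<dots> = (\<integral>z. h (?T z) * F z \<partial>?Q) - (\<integral>z. h z * F z \<partial>?Q)"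
    by (rule Bochner_Integration.integral_diff) (intro bd hT h F F1)+
  also have "\<dots> = (\<integral>z. k (?S z) * F (?p z) \<partial>?P) - (\<integral>z. k z * F (?p z) \<partial>?P)"
    using A hk[OF F] by simp
  also have "\<dots> = (\<integral>z. k (?S z) * F (?p z) - k z * F (?p z) \<partial>?P)"
    by (rule Bochner_Integration.integral_diff[symmetric]) (intro bd kS k F1, measurable)+
  also have "\<dots> \<le> (\<integral>z. \<bar>k (?S z) - k z\<bar> \<partial>?P)"
  proof (rule integral_mono)
    show "integrable ?P (\<lambda>z. k (?S z) * F (?p z) - k z * F (?p z))"
      by (rule Bochner_Integration.integrable_diff) (intro bd kS k F1, measurable)+
    show "integrable ?P (\<lambda>z. \<bar>k (?S z) - k z\<bar>)" using kS k by auto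
    fix z
    have "(k (?S z) - k z) * F (?p z) \<le> \<bar>k (?S z) - k z\<bar> * \<bar>F (?p z)\<bar>"
      by (metis abs_ge_self abs_mult)
    also have "\<dots> \<le> \<bar>k (?S z) - k z\<bar>" using F1[of "?p z"] by (simp add: mult_left_le)
    finally show "k (?S z) * F (?p z) - k z * F (?p z) \<le> \<bar>k (?S z) - k z\<bar>" by (simp add: algebra_simps)
  qed
  finally show ?thesis .
qed

context refining_labels
begin

text \<open>One cutting \<open>e\<close> serves all levels \<open>n\<close>; this uniformity is what
  lets its joint mass with \<open>c n\<close> tend to 0.\<close>

definition label_compatible :: "('x \<Rightarrow> 'x) \<Rightarrow> bool" where
  "label_compatible S \<longleftrightarrow> S \<in> M \<rightarrow>\<^sub>M M \<and> distr M M S = M \<and>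
    (\<exists>e :: 'x \<Rightarrow> nat. e \<in> M \<rightarrow>\<^sub>M count_space UNIV \<and>
      (\<forall>n. \<forall>x\<in>space M. \<forall>y\<in>space M. c n x = c n y \<longrightarrow> e x = e y \<longrightarrow> c n (S x) = c n (S y)))"

lemma factor_densities:
  fixes N :: "'y measure"
  assumes ap: "\<And>A. A \<in> sets M \<Longrightarrow> approximable A"
    and N: "prob_space N" and p[measurable]: "p \<in> M \<rightarrow>\<^sub>M N" and pN: "distr M N p = N"
  obtains h :: "nat \<Rightarrow> 'y \<times> 'y \<Rightarrow> real" where
    "\<And>n z. h n z \<ge> 0" "\<And>n. integrable (N \<Otimes>\<^sub>M N) (h n)" "\<And>n. (\<integral>z. h n z \<partial>(N \<Otimes>\<^sub>M N)) = 1"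
    "\<And>A. A \<in> sets N \<Longrightarrow> (\<lambda>n. \<integral>z. h n z * indicator {z. (fst z \<in> A) \<noteq> (snd z \<in> A)} z \<partial>(N \<Otimes>\<^sub>M N)) \<longlonglongrightarrow> 0"
    "\<And>S S' T T'. label_compatible S \<Longrightarrow> label_compatible S' \<Longrightarrow> (\<And>x. x \<in> space M \<Longrightarrow> S' (S x) = x) \<Longrightarrow>
      T \<in> N \<rightarrow>\<^sub>M N \<Longrightarrow> distr N N T = N \<Longrightarrow> T' \<in> N \<rightarrow>\<^sub>M N \<Longrightarrow> (\<And>y. y \<in> space N \<Longrightarrow> T' (T y) = y) \<Longrightarrow>
      (AE x in M. p (S x) = T (p x)) \<Longrightarrow> (\<lambda>n. \<integral>z. \<bar>h n (map_prod T T z) - h n z\<bar> \<partial>(N \<Otimes>\<^sub>M N)) \<longlonglongrightarrow> 0"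
proof -
  have "\<exists>h. (\<forall>z. h z \<ge> 0) \<and> integrable (N \<Otimes>\<^sub>M N) h \<and> (\<forall>F. F \<in> borel_measurable (N \<Otimes>\<^sub>M N) \<longrightarrow>
      (\<integral>z. h z * F z \<partial>(N \<Otimes>\<^sub>M N)) = (\<integral>z. kern M (c n) z * F (map_prod p p z) \<partial>(M \<Otimes>\<^sub>M M)))" for n
    by (rule push_forward_density[OF prob_space_axioms N p pN integrable_kern[OF c_measurable[of n]] kern_nonneg]) blast
  then obtain h where h0: "\<And>n z. h n z \<ge> 0" and hi: "\<And>n. integrable (N \<Otimes>\<^sub>M N) (h n)"
    and hF: "\<And>n F. F \<in> borel_measurable (N \<Otimes>\<^sub>M N) \<Longrightarrow>
      (\<integral>z. h n z * F z \<partial>(N \<Otimes>\<^sub>M N)) = (\<integral>z. kern M (c n) z * F (map_prod p p z) \<partial>(M \<Otimes>\<^sub>M M))" by metis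
  show thesis
  proof (rule that[OF h0 hi])
    show "(\<integral>z. h n z \<partial>(N \<Otimes>\<^sub>M N)) = 1" for n
      using hF[of "\<lambda>_. 1" n] integral_kern[OF c_measurable[of n]] by simp
    show "(\<lambda>n. \<integral>z. h n z * indicator {z. (fst z \<in> A) \<noteq> (snd z \<in> A)} z \<partial>(N \<Otimes>\<^sub>M N)) \<longlonglongrightarrow> 0" if A[measurable]: "A \<in> sets N" for A
    proof -
      \<comment> \<open>The mass off the diagonal blocks of \<open>A\<close> is the joint mass of
        \<open>c n\<close> with the two-valued label \<open>p x \<in> A\<close>.\<close>
      have "(\<integral>z. h n z * indicator {z. (fst z \<in> A) \<noteq> (snd z \<in> A)} z \<partial>(N \<Otimes>\<^sub>M N)) = joint_mass (c n) (\<lambda>x. p x \<in> A)" for n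
      proof -
        have "Measurable.pred (N \<Otimes>\<^sub>M N) (\<lambda>z. (fst z \<in> A) = (snd z \<in> A))"
          by (rule measurable_label_eq) measurable
        then have "(\<lambda>z. if (fst z \<in> A) = (snd z \<in> A) then 0 else 1 :: real) \<in> borel_measurable (N \<Otimes>\<^sub>M N)"
          by (intro measurable_If) simp_all
        from hF[OF this, of n]
        have "(\<integral>z. h n z * (if (fst z \<in> A) = (snd z \<in> A) then 0 else 1) \<partial>(N \<Otimes>\<^sub>M N)) =
            (\<integral>z. kern M (c n) z * (if (p (fst z) \<in> A) = (p (snd z) \<in> A) then 0 else 1) \<partial>(M \<Otimes>\<^sub>M M))" by simp
        moreover have "(\<integral>z. h n z * indicator {z. (fst z \<in> A) \<noteq> (snd z \<in> A)} z \<partial>(N \<Otimes>\<^sub>M N)) =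
            (\<integral>z. h n z * (if (fst z \<in> A) = (snd z \<in> A) then 0 else 1) \<partial>(N \<Otimes>\<^sub>M N))"
          by (intro Bochner_Integration.integral_cong refl) simp
        moreover have "joint_mass (c n) (\<lambda>x. p x \<in> A) =
            (\<integral>z. kern M (c n) z * (if (p (fst z) \<in> A) = (p (snd z) \<in> A) then 0 else 1) \<partial>(M \<Otimes>\<^sub>M M))"
          unfolding joint_mass_def by (intro Bochner_Integration.integral_cong refl) simp
        ultimately show ?thesis by (simp only:)
      qed
      moreover have "(\<lambda>n. joint_mass (c n) (\<lambda>x. p x \<in> A)) \<longlonglongrightarrow> 0"
        by (rule joint_mass_tendsto_0[OF _ ap]) measurable
      ultimately show ?thesis by (simp only:)
    qed
    fix S S' T T'
    assume S: "label_compatible S" and S': "label_compatible S'" and SS: "\<And>x. x \<in> space M \<Longrightarrow> S' (S x) = x"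
      and T: "T \<in> N \<rightarrow>\<^sub>M N" "distr N N T = N" and T': "T' \<in> N \<rightarrow>\<^sub>M N" and TT: "\<And>y. y \<in> space N \<Longrightarrow> T' (T y) = y"
      and eq: "AE x in M. p (S x) = T (p x)"
    obtain e :: "'x \<Rightarrow> nat" where e: "e \<in> M \<rightarrow>\<^sub>M count_space UNIV"
      "\<And>n x y. x \<in> space M \<Longrightarrow> y \<in> space M \<Longrightarrow> c n x = c n y \<Longrightarrow> e x = e y \<Longrightarrow> c n (S x) = c n (S y)"
      using S unfolding label_compatible_def by metis
    obtain e' :: "'x \<Rightarrow> nat" where e': "e' \<in> M \<rightarrow>\<^sub>M count_space UNIV"
      "\<And>n x y. x \<in> space M \<Longrightarrow> y \<in> space M \<Longrightarrow> c n x = c n y \<Longrightarrow> e' x = e' y \<Longrightarrow> c n (S' x) = c n (S' y)"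
      using S' unfolding label_compatible_def by metis
    have Sm: "S \<in> M \<rightarrow>\<^sub>M M" "distr M M S = M" "S' \<in> M \<rightarrow>\<^sub>M M" using S S' by (auto simp: label_compatible_def)
    have "(\<lambda>n. \<integral>z. \<bar>kern M (c n) (map_prod S S z) - kern M (c n) z\<bar> \<partial>(M \<Otimes>\<^sub>M M)) \<longlonglongrightarrow> 0"
      by (rule kern_asymptotically_invariant[OF ap Sm(1,2,3) SS e(1) e'(1) e(2) e'(2)])
    then show "(\<lambda>n. \<integral>z. \<bar>h n (map_prod T T z) - h n z\<bar> \<partial>(N \<Otimes>\<^sub>M N)) \<longlonglongrightarrow> 0"
    proof (rule tendsto_sandwich[OF _ _ tendsto_const, rotated 2])
      show "\<forall>\<^sub>F n in sequentially. (\<integral>z. \<bar>h n (map_prod T T z) - h n z\<bar> \<partial>(N \<Otimes>\<^sub>M N)) \<le>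
          (\<integral>z. \<bar>kern M (c n) (map_prod S S z) - kern M (c n) z\<bar> \<partial>(M \<Otimes>\<^sub>M M))"
        by (intro always_eventually allI push_forward_contraction[OF prob_space_axioms N p
            integrable_kern[OF c_measurable] hi hF Sm(1,2) T T' TT eq])
    qed auto
  qed
qed

end

section \<open>Approximation by rectangles\<close>

text \<open>The squared L2 norm, with values in \<open>ennreal\<close> so that estimates can be
  chained before finiteness is known.\<close>

definition sqint :: "'w measure \<Rightarrow> ('w \<Rightarrow> real) \<Rightarrow> ennreal" where
  "sqint W f = (\<integral>\<^sup>+z. ennreal ((f z)\<^sup>2) \<partial>W)"

lemma sqint_cong: "(\<And>z. z \<in> space W \<Longrightarrow> f z = g z) \<Longrightarrow> sqint W f = sqint W g"
  unfolding sqint_def by (intro nn_integral_cong) auto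

lemma sqint_add:
  assumes [measurable]: "f \<in> borel_measurable W" "g \<in> borel_measurable W"
  shows "sqint W (\<lambda>z. f z + g z) \<le> 2 * sqint W f + 2 * sqint W g"
proof -
  have "sqint W (\<lambda>z. f z + g z) \<le> (\<integral>\<^sup>+z. 2 * ennreal ((f z)\<^sup>2) + 2 * ennreal ((g z)\<^sup>2) \<partial>W)"
    unfolding sqint_def
  proof (rule nn_integral_mono)
    fix z
    have "(f z + g z)\<^sup>2 \<le> 2 * (f z)\<^sup>2 + 2 * (g z)\<^sup>2"
      using zero_le_power2[of "f z - g z"] by (simp add: power2_eq_square algebra_simps)
    then have "ennreal ((f z + g z)\<^sup>2) \<le> ennreal (2 * (f z)\<^sup>2 + 2 * (g z)\<^sup>2)" by (rule ennreal_leI)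
    then show "ennreal ((f z + g z)\<^sup>2) \<le> 2 * ennreal ((f z)\<^sup>2) + 2 * ennreal ((g z)\<^sup>2)"
      by (simp add: ennreal_mult)
  qed
  also have "\<dots> = 2 * sqint W f + 2 * sqint W g"
    unfolding sqint_def by (simp add: nn_integral_add nn_integral_cmult)
  finally show ?thesis .
qed

lemma sqint_cmult:
  assumes [measurable]: "f \<in> borel_measurable W"
  shows "sqint W (\<lambda>z. c * f z) = ennreal (c\<^sup>2) * sqint W f"
  unfolding sqint_def by (simp add: power_mult_distrib ennreal_mult nn_integral_cmult)

text \<open>Combinations of rectangles are kept as lists because vectors of the tensor product are
  built from lists of elementary tensors: after centring, each rectangle becomes one elementary
  tensor.\<close>

definition rect :: "(real \<times> 'a set \<times> 'b set) list \<Rightarrow> 'a \<times> 'b \<Rightarrow> real" where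
  "rect l z = (\<Sum>(r, A, B)\<leftarrow>l. r * indicator A (fst z) * indicator B (snd z))"

definition rect_lists :: "'a measure \<Rightarrow> 'b measure \<Rightarrow> (real \<times> 'a set \<times> 'b set) list set" where
  "rect_lists N N' = lists (UNIV \<times> sets N \<times> sets N')"

definition rect_scale :: "real \<Rightarrow> (real \<times> 'a set \<times> 'b set) list \<Rightarrow> (real \<times> 'a set \<times> 'b set) list" where
  "rect_scale c = map (\<lambda>(r, A, B). (c * r, A, B))"

lemma rect_simps [simp]:
  "rect [] z = 0"
  "rect ((r, A, B) # l) z = r * indicator A (fst z) * indicator B (snd z) + rect l z"
  "rect (l @ l') z = rect l z + rect l' z"
  by (simp_all add: rect_def)

lemma rect_rect_scale [simp]: "rect (rect_scale c l) z = c * rect l z"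
  by (induction l) (auto simp: rect_scale_def algebra_simps)

lemma rect_lists_simps [simp]:
  "[] \<in> rect_lists N N'"
  "(r, A, B) # l \<in> rect_lists N N' \<longleftrightarrow> A \<in> sets N \<and> B \<in> sets N' \<and> l \<in> rect_lists N N'"
  "l @ l' \<in> rect_lists N N' \<longleftrightarrow> l \<in> rect_lists N N' \<and> l' \<in> rect_lists N N'"
  by (auto simp: rect_lists_def)

lemma rect_scale_in [simp]: "l \<in> rect_lists N N' \<Longrightarrow> rect_scale c l \<in> rect_lists N N'"
  by (induction l) (auto simp: rect_scale_def)

lemma rect_measurable [measurable]:
  "l \<in> rect_lists N N' \<Longrightarrow> rect l \<in> borel_measurable (N \<Otimes>\<^sub>M N')"
proof (induction l)
  case (Cons a l)
  obtain r A B where a: "a = (r, A, B)" by (cases a)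
  have [measurable]: "A \<in> sets N" "B \<in> sets N'" "rect l \<in> borel_measurable (N \<Otimes>\<^sub>M N')" using Cons a by auto
  show ?case unfolding a rect_simps(2)[abs_def] by measurable
next
  case Nil
  show ?case unfolding rect_simps(1)[abs_def] by simp
qed

definition rect_limit :: "'a measure \<Rightarrow> 'b measure \<Rightarrow> ('a \<times> 'b \<Rightarrow> real) \<Rightarrow> bool" where
  "rect_limit N N' f \<longleftrightarrow> f \<in> borel_measurable (N \<Otimes>\<^sub>M N') \<and>
    (\<forall>e>0. \<exists>l\<in>rect_lists N N'. sqint (N \<Otimes>\<^sub>M N') (\<lambda>z. f z - rect l z) \<le> ennreal e)"

lemma rect_limit_cong:
  assumes "rect_limit N N' f" "\<And>z. z \<in> space (N \<Otimes>\<^sub>M N') \<Longrightarrow> f z = g z"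
  shows "rect_limit N N' g"
proof -
  have "sqint (N \<Otimes>\<^sub>M N') (\<lambda>z. f z - rect l z) = sqint (N \<Otimes>\<^sub>M N') (\<lambda>z. g z - rect l z)" for l
    by (rule sqint_cong) (simp add: assms(2))
  moreover have "g \<in> borel_measurable (N \<Otimes>\<^sub>M N')"
    using assms measurable_cong[of "N \<Otimes>\<^sub>M N'" f g borel] unfolding rect_limit_def by blast
  ultimately show ?thesis using assms(1) by (simp add: rect_limit_def)
qed

lemma rect_limit_limit:
  assumes f[measurable]: "f \<in> borel_measurable (N \<Otimes>\<^sub>M N')"
    and "\<And>e. e > 0 \<Longrightarrow> \<exists>g. rect_limit N N' g \<and> sqint (N \<Otimes>\<^sub>M N') (\<lambda>z. f z - g z) \<le> ennreal e"
  shows "rect_limit N N' f"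
  unfolding rect_limit_def
proof (intro conjI f allI impI)
  fix e :: real assume e: "e > 0"
  \<comment> \<open>\<open>sqint_add\<close> costs a factor 2 on each of two terms, hence the
    quarter.\<close>
  then have e4: "e / 4 > 0" by simp
  obtain g where g: "rect_limit N N' g" "sqint (N \<Otimes>\<^sub>M N') (\<lambda>z. f z - g z) \<le> ennreal (e / 4)"
    using assms(2)[OF e4] by blast
  then obtain l where l: "l \<in> rect_lists N N'" "sqint (N \<Otimes>\<^sub>M N') (\<lambda>z. g z - rect l z) \<le> ennreal (e / 4)"
    using e4 unfolding rect_limit_def by blast
  have [measurable]: "g \<in> borel_measurable (N \<Otimes>\<^sub>M N')" "rect l \<in> borel_measurable (N \<Otimes>\<^sub>M N')"
    using g(1) l(1) by (auto simp: rect_limit_def)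
  have "sqint (N \<Otimes>\<^sub>M N') (\<lambda>z. f z - rect l z) = sqint (N \<Otimes>\<^sub>M N') (\<lambda>z. (f z - g z) + (g z - rect l z))" by simp
  also have "\<dots> \<le> 2 * sqint (N \<Otimes>\<^sub>M N') (\<lambda>z. f z - g z) + 2 * sqint (N \<Otimes>\<^sub>M N') (\<lambda>z. g z - rect l z)"
    by (rule sqint_add) measurable
  also have "\<dots> \<le> 2 * ennreal (e / 4) + 2 * ennreal (e / 4)"
    using g(2) l(2) by (intro add_mono mult_left_mono) auto
  also have "\<dots> = ennreal e"
    using e by (simp add: ennreal_mult[symmetric] ennreal_plus[symmetric] ennreal_numeral[symmetric] del: ennreal_plus ennreal_numeral)
  finally show "\<exists>l\<in>rect_lists N N'. sqint (N \<Otimes>\<^sub>M N') (\<lambda>z. f z - rect l z) \<le> ennreal e" using l(1) by blast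
qed

lemma rect_limit_rect: "l \<in> rect_lists N N' \<Longrightarrow> rect_limit N N' (rect l)"
  unfolding rect_limit_def by (intro conjI allI impI bexI[of _ l]) (auto simp: sqint_def)

lemma rect_limit_add:
  assumes "rect_limit N N' f" "rect_limit N N' g"
  shows "rect_limit N N' (\<lambda>z. f z + g z)"
proof (rule rect_limit_limit)
  have [measurable]: "f \<in> borel_measurable (N \<Otimes>\<^sub>M N')" "g \<in> borel_measurable (N \<Otimes>\<^sub>M N')"
    using assms by (auto simp: rect_limit_def)
  show "(\<lambda>z. f z + g z) \<in> borel_measurable (N \<Otimes>\<^sub>M N')" by measurable
  fix e :: real assume e: "e > 0"
  then have e4: "e / 4 > 0" by simp
  obtain l where l: "l \<in> rect_lists N N'" "sqint (N \<Otimes>\<^sub>M N') (\<lambda>z. f z - rect l z) \<le> ennreal (e / 4)"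
    using assms(1) e4 unfolding rect_limit_def by blast
  obtain l' where l': "l' \<in> rect_lists N N'" "sqint (N \<Otimes>\<^sub>M N') (\<lambda>z. g z - rect l' z) \<le> ennreal (e / 4)"
    using assms(2) e4 unfolding rect_limit_def by blast
  have [measurable]: "rect l \<in> borel_measurable (N \<Otimes>\<^sub>M N')" "rect l' \<in> borel_measurable (N \<Otimes>\<^sub>M N')"
    using l(1) l'(1) by auto
  have "sqint (N \<Otimes>\<^sub>M N') (\<lambda>z. f z + g z - rect (l @ l') z) =
      sqint (N \<Otimes>\<^sub>M N') (\<lambda>z. (f z - rect l z) + (g z - rect l' z))" by (simp add: algebra_simps)
  also have "\<dots> \<le> 2 * sqint (N \<Otimes>\<^sub>M N') (\<lambda>z. f z - rect l z) + 2 * sqint (N \<Otimes>\<^sub>M N') (\<lambda>z. g z - rect l' z)"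
    by (rule sqint_add) measurable
  also have "\<dots> \<le> 2 * ennreal (e / 4) + 2 * ennreal (e / 4)"
    using l(2) l'(2) by (intro add_mono mult_left_mono) auto
  also have "\<dots> = ennreal e"
    using e by (simp add: ennreal_mult[symmetric] ennreal_plus[symmetric] ennreal_numeral[symmetric] del: ennreal_plus ennreal_numeral)
  finally show "\<exists>h. rect_limit N N' h \<and> sqint (N \<Otimes>\<^sub>M N') (\<lambda>z. f z + g z - h z) \<le> ennreal e"
    using l(1) l'(1) rect_limit_rect[of "l @ l'" N N'] by auto
qed

lemma rect_limit_cmult:
  assumes "rect_limit N N' f"
  shows "rect_limit N N' (\<lambda>z. c * f z)"
proof (rule rect_limit_limit)
  have [measurable]: "f \<in> borel_measurable (N \<Otimes>\<^sub>M N')" using assms by (auto simp: rect_limit_def)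
  show "(\<lambda>z. c * f z) \<in> borel_measurable (N \<Otimes>\<^sub>M N')" by measurable
  fix e :: real assume e: "e > 0"
  \<comment> \<open>The summand 1 avoids division by zero for \<open>c = 0\<close>.\<close>
  then have e': "e / (c\<^sup>2 + 1) > 0" by (simp add: add_nonneg_pos)
  obtain l where l: "l \<in> rect_lists N N'" "sqint (N \<Otimes>\<^sub>M N') (\<lambda>z. f z - rect l z) \<le> ennreal (e / (c\<^sup>2 + 1))"
    using assms(1) e' unfolding rect_limit_def by blast
  have [measurable]: "rect l \<in> borel_measurable (N \<Otimes>\<^sub>M N')" using l(1) by auto
  have "sqint (N \<Otimes>\<^sub>M N') (\<lambda>z. c * f z - rect (rect_scale c l) z) = sqint (N \<Otimes>\<^sub>M N') (\<lambda>z. c * (f z - rect l z))"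
    by (simp add: algebra_simps)
  also have "\<dots> = ennreal (c\<^sup>2) * sqint (N \<Otimes>\<^sub>M N') (\<lambda>z. f z - rect l z)"
    by (rule sqint_cmult) measurable
  also have "\<dots> \<le> ennreal (c\<^sup>2) * ennreal (e / (c\<^sup>2 + 1))" using l(2) by (intro mult_left_mono) auto
  also have "\<dots> = ennreal (c\<^sup>2 * (e / (c\<^sup>2 + 1)))"
    using e by (subst ennreal_mult[symmetric]) (simp_all add: add_nonneg_nonneg)
  also have "\<dots> \<le> ennreal e"
  proof (rule ennreal_leI)
    have "c\<^sup>2 + 1 > 0" by (simp add: add_nonneg_pos)
    then show "c\<^sup>2 * (e / (c\<^sup>2 + 1)) \<le> e" using e by (simp add: divide_simps algebra_simps)
  qed
  finally show "\<exists>h. rect_limit N N' h \<and> sqint (N \<Otimes>\<^sub>M N') (\<lambda>z. c * f z - h z) \<le> ennreal e"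
    using l(1) rect_limit_rect[of "rect_scale c l" N N'] by auto
qed

lemma rect_limit_sum:
  assumes "finite I" "\<And>i. i \<in> I \<Longrightarrow> rect_limit N N' (f i)"
  shows "rect_limit N N' (\<lambda>z. \<Sum>i\<in>I. f i z)"
  using assms
proof (induction I rule: finite_induct)
  case empty
  have "rect_limit N N' (rect [])" by (intro rect_limit_rect) simp
  then show ?case by (rule rect_limit_cong) simp
qed (simp add: rect_limit_add)

text \<open>Rectangles are stable under intersection, so a Dynkin argument applies and only disjoint
  unions have to be treated, where the indicator of a finite union is a sum.\<close>

lemma rect_limit_indicator:
  assumes "prob_space N" "prob_space N'" "C \<in> sets (N \<Otimes>\<^sub>M N')"
  shows "rect_limit N N' (indicator C)"
proof -
  interpret N: prob_space N by fact
  interpret N': prob_space N' by fact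
  interpret P: pair_prob_space N N' ..
  let ?P = "N \<Otimes>\<^sub>M N'"
  have sP: "sets ?P = sigma_sets (space N \<times> space N') {a \<times> b |a b. a \<in> sets N \<and> b \<in> sets N'}"
    by (rule sets_pair_measure)
  have C: "C \<in> sigma_sets (space N \<times> space N') {a \<times> b |a b. a \<in> sets N \<and> b \<in> sets N'}"
    using assms(3) unfolding sP .
  show ?thesis
    using Int_stable_pair_measure_generator[of N N'] pair_measure_closed[of N N'] C
  proof (induction rule: sigma_sets_induct_disjoint)
    case (basic A)
    then obtain a b where ab: "A = a \<times> b" "a \<in> sets N" "b \<in> sets N'" by blast
    then have "rect_limit N N' (rect [(1, a, b)])" by (intro rect_limit_rect) simp
    then show ?case by (rule rect_limit_cong) (auto simp: ab indicator_def)
  next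
    case empty
    have "rect_limit N N' (rect [])" by (intro rect_limit_rect) simp
    then show ?case by (rule rect_limit_cong) auto
  next
    case (compl A)
    have "rect_limit N N' (\<lambda>z. rect [(1, space N, space N')] z + (-1) * indicator A z)"
      by (intro rect_limit_add rect_limit_cmult rect_limit_rect compl) simp
    then show ?case by (rule rect_limit_cong) (auto simp: indicator_def space_pair_measure)
  next
    case (union A)
    have A[measurable]: "A i \<in> sets ?P" for i using union(2) unfolding sP by blast
    have part: "indicator (\<Union>i<n. A i) z = (\<Sum>i<n. indicator (A i) z :: real)" for n z
    proof -
      have "disjoint_family_on A {..<n}" using union(1) by (auto simp: disjoint_family_on_def)
      then show ?thesis by (simp add: indicator_UN_disjoint)
    qed
    have pl: "rect_limit N N' (indicator (\<Union>i<n. A i))" for n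
    proof -
      have "rect_limit N N' (\<lambda>z. \<Sum>i<n. indicator (A i) z)" by (intro rect_limit_sum union) simp
      then show ?thesis by (rule rect_limit_cong) (simp add: part)
    qed
    show ?case
    proof (rule rect_limit_limit)
      show "indicator (\<Union>i. A i) \<in> borel_measurable ?P" by measurable
      fix e :: real assume e: "e > 0"
      have "(\<lambda>n. P.prob (\<Union>i<n. A i)) \<longlonglongrightarrow> P.prob (\<Union>n. \<Union>i<n. A i)"
      proof (rule P.finite_Lim_measure_incseq)
        show "incseq (\<lambda>n. \<Union>i<n. A i)" unfolding incseq_def by (intro allI impI UN_mono) auto
      qed auto
      moreover have "(\<Union>n. \<Union>i<n. A i) = (\<Union>i. A i)" by blast
      ultimately have "\<forall>\<^sub>F n in sequentially. P.prob (\<Union>i<n. A i) > P.prob (\<Union>i. A i) - e"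
        using e by (intro order_tendstoD(1)) auto
      then obtain n where n: "P.prob (\<Union>i<n. A i) > P.prob (\<Union>i. A i) - e"
        by (auto simp: eventually_sequentially)
      have "sqint ?P (\<lambda>z. indicator (\<Union>i. A i) z - indicator (\<Union>i<n. A i) z) = (\<integral>\<^sup>+z. indicator ((\<Union>i. A i) - (\<Union>i<n. A i)) z \<partial>?P)"
        unfolding sqint_def by (intro nn_integral_cong) (auto simp: indicator_def)
      also have "\<dots> = ennreal (P.prob ((\<Union>i. A i) - (\<Union>i<n. A i)))"
        by (subst nn_integral_indicator) (auto simp: P.emeasure_eq_measure)
      also have "\<dots> \<le> ennreal e"
        using n by (subst P.finite_measure_Diff) (auto intro!: ennreal_leI)
      finally show "\<exists>g. rect_limit N N' g \<and> sqint ?P (\<lambda>z. indicator (\<Union>i. A i) z - g z) \<le> ennreal e"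
        using pl by blast
    qed
  qed
qed

lemma rect_limit_L2:
  assumes N: "prob_space N" "prob_space N'" and f[measurable]: "f \<in> borel_measurable (N \<Otimes>\<^sub>M N')"
    and fin: "sqint (N \<Otimes>\<^sub>M N') f < \<infinity>"
  shows "rect_limit N N' f"
proof (rule rect_limit_limit[OF f])
  let ?P = "N \<Otimes>\<^sub>M N'"
  fix e :: real assume e: "e > 0"
  obtain F where F: "\<And>i. simple_function ?P (F i)" "\<And>z. z \<in> space ?P \<Longrightarrow> (\<lambda>i. F i z) \<longlonglongrightarrow> f z"
    "\<And>i z. z \<in> space ?P \<Longrightarrow> dist (F i z) 0 \<le> 2 * dist (f z) 0"
    using borel_measurable_implies_sequence_metric[OF f, of 0] by blast
  have Fm[measurable]: "F i \<in> borel_measurable ?P" for i using F(1) by (rule borel_measurable_simple_function)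
  have "(\<lambda>i. \<integral>\<^sup>+z. ennreal ((f z - F i z)\<^sup>2) \<partial>?P) \<longlonglongrightarrow> (\<integral>\<^sup>+z. 0 \<partial>?P)"
  \<comment> \<open>The approximating simple functions are bounded by twice the absolute value of
    \<open>f\<close>, so the differences are bounded by three times that value; its square gives the
    9.\<close>
  proof (rule nn_integral_dominated_convergence[where w = "\<lambda>z. 9 * ennreal ((f z)\<^sup>2)"])
    show "(\<integral>\<^sup>+z. 9 * ennreal ((f z)\<^sup>2) \<partial>?P) < \<infinity>"
      using fin by (simp add: nn_integral_cmult sqint_def ennreal_mult_less_top)
    show "AE z in ?P. ennreal ((f z - F i z)\<^sup>2) \<le> 9 * ennreal ((f z)\<^sup>2)" for i
    proof (rule AE_I2)
      fix z assume "z \<in> space ?P"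
      then have "\<bar>F i z\<bar> \<le> 2 * \<bar>f z\<bar>" using F(3)[of z i] by simp
      then have "\<bar>f z - F i z\<bar> \<le> \<bar>3 * f z\<bar>" by linarith
      then have "(f z - F i z)\<^sup>2 \<le> (3 * f z)\<^sup>2" by (simp only: abs_le_square_iff)
      then have "ennreal ((f z - F i z)\<^sup>2) \<le> ennreal (9 * (f z)\<^sup>2)" by (intro ennreal_leI) (simp add: power_mult_distrib)
      then show "ennreal ((f z - F i z)\<^sup>2) \<le> 9 * ennreal ((f z)\<^sup>2)" by (simp add: ennreal_mult)
    qed
    show "AE z in ?P. (\<lambda>i. ennreal ((f z - F i z)\<^sup>2)) \<longlonglongrightarrow> 0"
    proof (rule AE_I2)
      fix z assume "z \<in> space ?P"
      then have "(\<lambda>i. ennreal ((f z - F i z)\<^sup>2)) \<longlonglongrightarrow> ennreal ((f z - f z)\<^sup>2)"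
        by (intro tendsto_ennrealI tendsto_intros F(2))
      then show "(\<lambda>i. ennreal ((f z - F i z)\<^sup>2)) \<longlonglongrightarrow> 0" by simp
    qed
  qed measurable
  then have "(\<lambda>i. sqint ?P (\<lambda>z. f z - F i z)) \<longlonglongrightarrow> 0" by (simp add: sqint_def)
  then have "\<forall>\<^sub>F i in sequentially. sqint ?P (\<lambda>z. f z - F i z) < ennreal e"
    using e by (intro order_tendstoD(2)) auto
  then obtain i where i: "sqint ?P (\<lambda>z. f z - F i z) < ennreal e" by (auto simp: eventually_sequentially)
  have "rect_limit N N' (\<lambda>z. \<Sum>y\<in>F i ` space ?P. y * indicator (F i -` {y} \<inter> space ?P) z)"
    using F(1)[of i] unfolding simple_function_def
    by (intro rect_limit_sum rect_limit_cmult rect_limit_indicator N) auto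
  then have "rect_limit N N' (F i)"
  proof (rule rect_limit_cong)
    fix z assume z: "z \<in> space ?P"
    have "finite (F i ` space ?P)" using F(1)[of i] by (simp add: simple_function_def)
    then have "(\<Sum>y\<in>F i ` space ?P. y * indicator (F i -` {y} \<inter> space ?P) z) =
        (\<Sum>y\<in>F i ` space ?P. if y = F i z then F i z else 0)"
      using z by (intro sum.cong) (auto simp: indicator_def)
    also have "\<dots> = F i z" using \<open>finite _\<close> z by simp
    finally show "(\<Sum>y\<in>F i ` space ?P. y * indicator (F i -` {y} \<inter> space ?P) z) = F i z" .
  qed
  then show "\<exists>g. rect_limit N N' g \<and> sqint ?P (\<lambda>z. f z - g z) \<le> ennreal e" using i by (auto intro: less_imp_le)
qed

section \<open>Centred functions on products\<close>

text \<open>The projection onto functions of mean zero, applied in both variables to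
  \<open>rect l\<close>.\<close>

definition centred :: "'a measure \<Rightarrow> (real \<times> 'a set \<times> 'a set) list \<Rightarrow> 'a \<times> 'a \<Rightarrow> real" where
  "centred N l z = (\<Sum>(r, A, B)\<leftarrow>l. r * (indicator A (fst z) - measure N A) * (indicator B (snd z) - measure N B))"

lemma centred_simps [simp]:
  "centred N [] z = 0"
  "centred N ((r, A, B) # l) z = r * (indicator A (fst z) - measure N A) * (indicator B (snd z) - measure N B) + centred N l z"
  "centred N (l @ l') z = centred N l z + centred N l' z"
  by (simp_all add: centred_def)

lemma centred_rect_scale [simp]: "centred N (rect_scale c l) z = c * centred N l z"
  by (induction l) (auto simp: rect_scale_def algebra_simps)

lemma centred_measurable [measurable]:
  "l \<in> rect_lists N N \<Longrightarrow> centred N l \<in> borel_measurable (N \<Otimes>\<^sub>M N)"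
proof (induction l)
  case (Cons a l)
  obtain r A B where a: "a = (r, A, B)" by (cases a)
  have [measurable]: "A \<in> sets N" "B \<in> sets N" "centred N l \<in> borel_measurable (N \<Otimes>\<^sub>M N)" using Cons a by auto
  show ?case unfolding a centred_simps(2)[abs_def] by measurable
next
  case Nil
  show ?case unfolding centred_simps(1)[abs_def] by simp
qed

lemma centred_bounded: "\<exists>K. \<forall>z. \<bar>centred N l z\<bar> \<le> K"
proof (induction l)
  case (Cons a l)
  then obtain K where K: "\<And>z. \<bar>centred N l z\<bar> \<le> K" by blast
  obtain r A B where a: "a = (r, A, B)" by (cases a)
  have "\<bar>r * (indicator A (fst z) - measure N A) * (indicator B (snd z) - measure N B)\<bar> \<le>
      \<bar>r\<bar> * (1 + measure N A) * (1 + measure N B)" for z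
    unfolding abs_mult
    by (intro mult_mono) (auto simp: indicator_def abs_real_def)
  then have "\<bar>centred N (a # l) z\<bar> \<le> \<bar>r\<bar> * (1 + measure N A) * (1 + measure N B) + K" for z
    unfolding a centred_simps(2) 
    by (rule order_trans[OF abs_triangle_ineq add_mono[OF _ K[of z]]])
  then show ?case by blast
qed auto

lemma (in prob_space) nn_integral_variance_le:
  fixes f :: "'a \<Rightarrow> real"
  assumes [measurable]: "f \<in> borel_measurable M" and bd: "\<And>x. \<bar>f x\<bar> \<le> K"
  shows "(\<integral>\<^sup>+x. ennreal ((f x - expectation f)\<^sup>2) \<partial>M) \<le> (\<integral>\<^sup>+x. ennreal ((f x)\<^sup>2) \<partial>M)"
proof -
  have i1: "integrable M f" by (rule integrable_const_bound[of _ K]) (use bd in auto)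
  have i2: "integrable M (\<lambda>x. (f x)\<^sup>2)"
  proof (rule integrable_const_bound[of _ "K\<^sup>2"])
    have "(f x)\<^sup>2 \<le> K\<^sup>2" for x using bd[of x] by (simp add: abs_le_square_iff[symmetric])
    then show "AE x in M. norm ((f x)\<^sup>2) \<le> K\<^sup>2" by simp
  qed measurable
  have i3: "integrable M (\<lambda>x. (f x - expectation f)\<^sup>2)"
    using i1 i2 by (simp add: power2_diff)
  have "(\<integral>\<^sup>+x. ennreal ((f x - expectation f)\<^sup>2) \<partial>M) = ennreal (variance f)"
    by (rule nn_integral_eq_integral[OF i3]) auto
  also have "\<dots> \<le> ennreal (expectation (\<lambda>x. (f x)\<^sup>2))"
    by (rule ennreal_leI) (simp add: variance_eq[OF i1 i2])
  also have "\<dots> = (\<integral>\<^sup>+x. ennreal ((f x)\<^sup>2) \<partial>M)"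
    by (rule nn_integral_eq_integral[OF i2, symmetric]) auto
  finally show ?thesis .
qed

lemma (in prob_space) nn_integral_centred_sum_le:
  fixes w :: "'i \<Rightarrow> real" and A :: "'i \<Rightarrow> 'a set"
  assumes "\<And>i. i \<in> set l \<Longrightarrow> A i \<in> sets M"
  shows "(\<integral>\<^sup>+x. ennreal ((\<Sum>i\<leftarrow>l. w i * (indicator (A i) x - measure M (A i)))\<^sup>2) \<partial>M) \<le>
    (\<integral>\<^sup>+x. ennreal ((\<Sum>i\<leftarrow>l. w i * indicator (A i) x)\<^sup>2) \<partial>M)"
proof -
  define f where "f x = (\<Sum>i\<leftarrow>l. w i * indicator (A i) x)" for x
  have "f \<in> borel_measurable M \<and> integrable M f \<and> expectation f = (\<Sum>i\<leftarrow>l. w i * measure M (A i)) \<and> (\<exists>K. \<forall>x. \<bar>f x\<bar> \<le> K)"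
    using assms unfolding f_def
  proof (induction l)
    case (Cons i l)
    let ?g = "\<lambda>x. \<Sum>i\<leftarrow>l. w i * indicator (A i) x :: real"
    have A[measurable]: "A i \<in> sets M" using Cons.prems by simp
    have IH: "?g \<in> borel_measurable M" "integrable M ?g" "expectation ?g = (\<Sum>i\<leftarrow>l. w i * measure M (A i))"
      and "\<exists>K. \<forall>x. \<bar>?g x\<bar> \<le> K" using Cons by auto
    then obtain K where K: "\<And>x. \<bar>?g x\<bar> \<le> K" by blast
    have "\<bar>w i * indicator (A i) x + ?g x\<bar> \<le> \<bar>w i\<bar> + K" for x
    proof -
      have "\<bar>w i * indicator (A i) x\<bar> \<le> \<bar>w i\<bar>" by (simp add: indicator_def)
      then show ?thesis using K[of x] abs_triangle_ineq[of "w i * indicator (A i) x" "?g x"] by linarith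
    qed
    moreover have "integrable M (\<lambda>x. w i * indicator (A i) x)" by (simp add: less_top[symmetric])
    ultimately show ?case using IH A by (auto simp: sets.sets_into_space)
  qed auto
  then obtain K where f: "f \<in> borel_measurable M" "expectation f = (\<Sum>i\<leftarrow>l. w i * measure M (A i))" "\<And>x. \<bar>f x\<bar> \<le> K" by blast
  have "(\<Sum>i\<leftarrow>l. w i * (indicator (A i) x - measure M (A i))) = f x - expectation f" for x
    unfolding f(2) f_def by (induction l) (auto simp: algebra_simps)
  then show ?thesis using nn_integral_variance_le[OF f(1,3)] unfolding f_def[symmetric] by simp
qed

text \<open>The projection is a product of two projections, one in each variable; \<open>mid\<close>
  is centred in the second variable only. With the other variable fixed, each step is the inequality
  between variance and second moment.\<close>

lemma sqint_centred_le:
  assumes "prob_space N" and l: "l \<in> rect_lists N N"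
  shows "sqint (N \<Otimes>\<^sub>M N) (centred N l) \<le> sqint (N \<Otimes>\<^sub>M N) (rect l)"
proof -
  interpret N: prob_space N by fact
  interpret P: pair_sigma_finite N N ..
  have mem: "fst (snd i) \<in> sets N" "snd (snd i) \<in> sets N" if "i \<in> set l" for i
    using l that by (auto simp: rect_lists_def lists_eq_set)
  define mid where "mid z = (\<Sum>(r, A, B)\<leftarrow>l. r * indicator A (fst z) * (indicator B (snd z) - measure N B))" for z
  have mid[measurable]: "mid \<in> borel_measurable (N \<Otimes>\<^sub>M N)"
    using l unfolding mid_def[abs_def]
  proof (induction l)
    case (Cons a l)
    obtain r A B where a: "a = (r, A, B)" by (cases a)
    have [measurable]: "A \<in> sets N" "B \<in> sets N" "(\<lambda>z. \<Sum>(r, A, B)\<leftarrow>l. r * indicator A (fst z) * (indicator B (snd z) - measure N B)) \<in> borel_measurable (N \<Otimes>\<^sub>M N)"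
      using Cons a by auto
    show ?case unfolding a by simp
  qed simp
  have [measurable]: "rect l \<in> borel_measurable (N \<Otimes>\<^sub>M N)" "centred N l \<in> borel_measurable (N \<Otimes>\<^sub>M N)" using l by auto
  have "sqint (N \<Otimes>\<^sub>M N) (centred N l) = (\<integral>\<^sup>+y. (\<integral>\<^sup>+x. ennreal ((centred N l (x, y))\<^sup>2) \<partial>N) \<partial>N)"
    unfolding sqint_def by (rule P.nn_integral_snd[symmetric]) measurable
  also have "\<dots> \<le> (\<integral>\<^sup>+y. (\<integral>\<^sup>+x. ennreal ((mid (x, y))\<^sup>2) \<partial>N) \<partial>N)"
  proof (rule nn_integral_mono)
    fix y
    have "centred N l (x, y) = (\<Sum>i\<leftarrow>l. (fst i * (indicator (snd (snd i)) y - measure N (snd (snd i)))) * (indicator (fst (snd i)) x - measure N (fst (snd i))))" for x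
      unfolding centred_def by (intro arg_cong[where f = sum_list] map_cong) (auto simp: algebra_simps split: prod.splits)
    moreover have "mid (x, y) = (\<Sum>i\<leftarrow>l. (fst i * (indicator (snd (snd i)) y - measure N (snd (snd i)))) * indicator (fst (snd i)) x)" for x
      unfolding mid_def by (intro arg_cong[where f = sum_list] map_cong) (auto simp: algebra_simps split: prod.splits)
    ultimately show "(\<integral>\<^sup>+x. ennreal ((centred N l (x, y))\<^sup>2) \<partial>N) \<le> (\<integral>\<^sup>+x. ennreal ((mid (x, y))\<^sup>2) \<partial>N)"
      using N.nn_integral_centred_sum_le[of l "\<lambda>i. fst (snd i)" "\<lambda>i. fst i * (indicator (snd (snd i)) y - measure N (snd (snd i)))"] mem by simp
  qed
  also have "\<dots> = (\<integral>\<^sup>+z. ennreal ((mid z)\<^sup>2) \<partial>(N \<Otimes>\<^sub>M N))" by (rule P.nn_integral_snd) measurable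
  also have "\<dots> = (\<integral>\<^sup>+x. (\<integral>\<^sup>+y. ennreal ((mid (x, y))\<^sup>2) \<partial>N) \<partial>N)" by (rule N.nn_integral_fst[symmetric]) measurable
  also have "\<dots> \<le> (\<integral>\<^sup>+x. (\<integral>\<^sup>+y. ennreal ((rect l (x, y))\<^sup>2) \<partial>N) \<partial>N)"
  proof (rule nn_integral_mono)
    fix x
    have "mid (x, y) = (\<Sum>i\<leftarrow>l. (fst i * indicator (fst (snd i)) x) * (indicator (snd (snd i)) y - measure N (snd (snd i))))" for y
      unfolding mid_def by (intro arg_cong[where f = sum_list] map_cong) (auto simp: algebra_simps split: prod.splits)
    moreover have "rect l (x, y) = (\<Sum>i\<leftarrow>l. (fst i * indicator (fst (snd i)) x) * indicator (snd (snd i)) y)" for y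
      unfolding rect_def by (intro arg_cong[where f = sum_list] map_cong) (auto simp: algebra_simps split: prod.splits)
    ultimately show "(\<integral>\<^sup>+y. ennreal ((mid (x, y))\<^sup>2) \<partial>N) \<le> (\<integral>\<^sup>+y. ennreal ((rect l (x, y))\<^sup>2) \<partial>N)"
      using N.nn_integral_centred_sum_le[of l "\<lambda>i. snd (snd i)" "\<lambda>i. fst i * indicator (fst (snd i)) x"] mem by simp
  qed
  also have "\<dots> = sqint (N \<Otimes>\<^sub>M N) (rect l)"
    unfolding sqint_def by (rule N.nn_integral_fst) measurable
  finally show ?thesis .
qed

text \<open>Mixed second difference: it annihilates functions of the form \<open>a x + b y\<close>, so it does not see
  the difference between a function and its projection to \<open>L\<^sup>2\<^sub>0 \<otimes> L\<^sup>2\<^sub>0\<close>.\<close>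

definition ddiff :: "('a \<times> 'a \<Rightarrow> real) \<Rightarrow> ('a \<times> 'a) \<times> ('a \<times> 'a) \<Rightarrow> real" where
  "ddiff f w = f (map_prod fst fst w) - f (map_prod fst snd w) - f (map_prod snd fst w) + f (map_prod snd snd w)"

lemma ddiff_centred: "ddiff (centred N l) w = ddiff (rect l) w"
  by (induction l) (auto simp: ddiff_def algebra_simps)

lemma (in prob_space) distr_pair_snd: "distr (M \<Otimes>\<^sub>M M) M snd = M"
proof -
  interpret P: pair_sigma_finite M M ..
  have "distr (M \<Otimes>\<^sub>M M) M snd = distr (distr (M \<Otimes>\<^sub>M M) (M \<Otimes>\<^sub>M M) (\<lambda>(x, y). (y, x))) M snd"
    using P.distr_pair_swap by simp
  also have "\<dots> = distr (M \<Otimes>\<^sub>M M) M (snd \<circ> (\<lambda>(x, y). (y, x)))" by (rule distr_distr) measurable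
  also have "snd \<circ> (\<lambda>(x, y). (y, x)) = (fst :: 'a \<times> 'a \<Rightarrow> 'a)" by (auto simp: fun_eq_iff)
  finally show ?thesis by (simp add: distr_pair_fst)
qed

text \<open>With \<open>w = ((x, x'), (y, y'))\<close> the maps \<open>map_prod i j\<close> select
  the four corners of a random rectangle. Each corner by itself is distributed according to the
  product measure.\<close>

lemma nn_integral_project:
  fixes f :: "'a \<times> 'a \<Rightarrow> ennreal"
  assumes "prob_space N" and i: "i = fst \<or> i = snd" and j: "j = fst \<or> j = snd"
    and [measurable]: "f \<in> borel_measurable (N \<Otimes>\<^sub>M N)"
  shows "(\<integral>\<^sup>+w. f (map_prod i j w) \<partial>((N \<Otimes>\<^sub>M N) \<Otimes>\<^sub>M (N \<Otimes>\<^sub>M N))) = (\<integral>\<^sup>+z. f z \<partial>(N \<Otimes>\<^sub>M N))"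
proof -
  interpret N: prob_space N by fact
  have [measurable]: "i \<in> N \<Otimes>\<^sub>M N \<rightarrow>\<^sub>M N" "j \<in> N \<Otimes>\<^sub>M N \<rightarrow>\<^sub>M N" using i j by auto
  have d: "distr (N \<Otimes>\<^sub>M N) N i = N" "distr (N \<Otimes>\<^sub>M N) N j = N"
    using i j N.distr_pair_fst[of N] N.distr_pair_snd by auto
  have "distr ((N \<Otimes>\<^sub>M N) \<Otimes>\<^sub>M (N \<Otimes>\<^sub>M N)) (N \<Otimes>\<^sub>M N) (map_prod i j) = N \<Otimes>\<^sub>M N"
    using pair_measure_distr[of i "N \<Otimes>\<^sub>M N" N j "N \<Otimes>\<^sub>M N" N] N.sigma_finite_measure_axioms by (simp add: d map_prod_def)
  then have "(\<integral>\<^sup>+z. f z \<partial>(N \<Otimes>\<^sub>M N)) = (\<integral>\<^sup>+z. f z \<partial>distr ((N \<Otimes>\<^sub>M N) \<Otimes>\<^sub>M (N \<Otimes>\<^sub>M N)) (N \<Otimes>\<^sub>M N) (map_prod i j))" by simp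
  also have "\<dots> = (\<integral>\<^sup>+w. f (map_prod i j w) \<partial>((N \<Otimes>\<^sub>M N) \<Otimes>\<^sub>M (N \<Otimes>\<^sub>M N)))"
    by (rule nn_integral_distr) measurable
  finally show ?thesis by simp
qed

lemma measurable_project [measurable]:
  "map_prod fst fst \<in> (N \<Otimes>\<^sub>M N) \<Otimes>\<^sub>M (N \<Otimes>\<^sub>M N) \<rightarrow>\<^sub>M N \<Otimes>\<^sub>M N"
  "map_prod fst snd \<in> (N \<Otimes>\<^sub>M N) \<Otimes>\<^sub>M (N \<Otimes>\<^sub>M N) \<rightarrow>\<^sub>M N \<Otimes>\<^sub>M N"
  "map_prod snd fst \<in> (N \<Otimes>\<^sub>M N) \<Otimes>\<^sub>M (N \<Otimes>\<^sub>M N) \<rightarrow>\<^sub>M N \<Otimes>\<^sub>M N"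
  "map_prod snd snd \<in> (N \<Otimes>\<^sub>M N) \<Otimes>\<^sub>M (N \<Otimes>\<^sub>M N) \<rightarrow>\<^sub>M N \<Otimes>\<^sub>M N"
  by (intro measurable_map_prod measurable_fst measurable_snd)+

lemma ddiff_measurable [measurable]:
  assumes [measurable]: "f \<in> borel_measurable (N \<Otimes>\<^sub>M N)"
  shows "ddiff f \<in> borel_measurable ((N \<Otimes>\<^sub>M N) \<Otimes>\<^sub>M (N \<Otimes>\<^sub>M N))"
  unfolding ddiff_def[abs_def] by measurable

lemma sum4_squared_le: "(a - b - c + d)\<^sup>2 \<le> 4 * (a\<^sup>2 + b\<^sup>2 + c\<^sup>2 + d\<^sup>2)" for a b c d :: real
  using zero_le_power2[of "a + b"] zero_le_power2[of "a + c"] zero_le_power2[of "a - d"]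
    zero_le_power2[of "b - c"] zero_le_power2[of "b + d"] zero_le_power2[of "c + d"]
  by (simp add: power2_eq_square algebra_simps)

text \<open>The constant is 4 from \<open>sum4_squared_le\<close> times the four corners.\<close>

lemma sqint_ddiff_le:
  assumes N: "prob_space N" and [measurable]: "f \<in> borel_measurable (N \<Otimes>\<^sub>M N)"
  shows "sqint ((N \<Otimes>\<^sub>M N) \<Otimes>\<^sub>M (N \<Otimes>\<^sub>M N)) (ddiff f) \<le> 16 * sqint (N \<Otimes>\<^sub>M N) f"
proof -
  let ?W = "(N \<Otimes>\<^sub>M N) \<Otimes>\<^sub>M (N \<Otimes>\<^sub>M N)"
  let ?q = "\<lambda>z. ennreal ((f z)\<^sup>2)"
  have "sqint ?W (ddiff f) \<le> (\<integral>\<^sup>+w. 4 * (?q (map_prod fst fst w) + ?q (map_prod fst snd w) + ?q (map_prod snd fst w) + ?q (map_prod snd snd w)) \<partial>?W)"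
    unfolding sqint_def
  proof (rule nn_integral_mono)
    fix w
    have "ennreal ((ddiff f w)\<^sup>2) \<le> ennreal (4 * ((f (map_prod fst fst w))\<^sup>2 + (f (map_prod fst snd w))\<^sup>2 + (f (map_prod snd fst w))\<^sup>2 + (f (map_prod snd snd w))\<^sup>2))"
      unfolding ddiff_def by (intro ennreal_leI sum4_squared_le)
    then show "ennreal ((ddiff f w)\<^sup>2) \<le> 4 * (?q (map_prod fst fst w) + ?q (map_prod fst snd w) + ?q (map_prod snd fst w) + ?q (map_prod snd snd w))"
      by (simp add: ennreal_mult)
  qed
  also have "\<dots> = 4 * (sqint (N \<Otimes>\<^sub>M N) f + sqint (N \<Otimes>\<^sub>M N) f + sqint (N \<Otimes>\<^sub>M N) f + sqint (N \<Otimes>\<^sub>M N) f)"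
    unfolding sqint_def
    by (simp add: nn_integral_cmult nn_integral_add nn_integral_project[OF N, of _ _ ?q])
  also have "\<dots> = 16 * sqint (N \<Otimes>\<^sub>M N) f"
  proof -
    have "4 * (x + x + x + x) = 16 * x" for x :: ennreal
      by (simp add: mult_2[symmetric] mult.assoc[symmetric] add.assoc)
    then show ?thesis by simp
  qed
  finally show ?thesis .
qed

lemma nn_integral_pair_mult:
  assumes "prob_space M" "prob_space N" and [measurable]: "f \<in> borel_measurable M" "g \<in> borel_measurable N"
  shows "(\<integral>\<^sup>+z. f (fst z) * g (snd z) \<partial>(M \<Otimes>\<^sub>M N)) = (\<integral>\<^sup>+x. f x \<partial>M) * (\<integral>\<^sup>+y. g y \<partial>N)"
proof -
  interpret N: prob_space N by fact
  show ?thesis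
    by (subst N.nn_integral_fst[symmetric]) (simp_all add: nn_integral_cmult nn_integral_multc)
qed

text \<open>Opposite corners of the random rectangle are independent, and the two coordinates of a
  corner are independent of each other.\<close>

lemma nn_integral_project_mult:
  fixes f :: "'a \<times> 'a \<Rightarrow> ennreal"
  assumes N: "prob_space N" and [measurable]: "f \<in> borel_measurable (N \<Otimes>\<^sub>M N)" "b \<in> borel_measurable N"
  shows "(\<integral>\<^sup>+w. f (map_prod fst fst w) * (b (snd (fst w)) * b (snd (snd w))) \<partial>((N \<Otimes>\<^sub>M N) \<Otimes>\<^sub>M (N \<Otimes>\<^sub>M N))) =
      (\<integral>\<^sup>+z. f z \<partial>(N \<Otimes>\<^sub>M N)) * (\<integral>\<^sup>+y. b y \<partial>N)\<^sup>2" (is ?A)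
    and "(\<integral>\<^sup>+w. f (map_prod snd snd w) * (b (fst (fst w)) * b (fst (snd w))) \<partial>((N \<Otimes>\<^sub>M N) \<Otimes>\<^sub>M (N \<Otimes>\<^sub>M N))) =
      (\<integral>\<^sup>+z. f z \<partial>(N \<Otimes>\<^sub>M N)) * (\<integral>\<^sup>+y. b y \<partial>N)\<^sup>2" (is ?B)
proof -
  interpret N: prob_space N by fact
  interpret P: pair_prob_space N N ..
  have "(\<integral>\<^sup>+w. f (map_prod fst fst w) * (b (snd (fst w)) * b (snd (snd w))) \<partial>((N \<Otimes>\<^sub>M N) \<Otimes>\<^sub>M (N \<Otimes>\<^sub>M N))) =
      (\<integral>\<^sup>+v. \<integral>\<^sup>+u. b (snd v) * (f (fst v, fst u) * b (snd u)) \<partial>(N \<Otimes>\<^sub>M N) \<partial>(N \<Otimes>\<^sub>M N))"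
    by (subst P.nn_integral_fst[symmetric]) (auto simp: map_prod_def split_beta mult_ac)
  also have "\<dots> = (\<integral>\<^sup>+v. b (snd v) * ((\<integral>\<^sup>+y. f (fst v, y) \<partial>N) * (\<integral>\<^sup>+y. b y \<partial>N)) \<partial>(N \<Otimes>\<^sub>M N))"
  proof (rule nn_integral_cong)
    fix v assume "v \<in> space (N \<Otimes>\<^sub>M N)"
    then have [measurable]: "fst v \<in> space N" by (auto simp: space_pair_measure)
    show "(\<integral>\<^sup>+u. b (snd v) * (f (fst v, fst u) * b (snd u)) \<partial>(N \<Otimes>\<^sub>M N)) = b (snd v) * ((\<integral>\<^sup>+y. f (fst v, y) \<partial>N) * (\<integral>\<^sup>+y. b y \<partial>N))"
      using nn_integral_pair_mult[OF N N, of "\<lambda>y. f (fst v, y)" b] by (subst nn_integral_cmult) auto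
  qed
  also have "\<dots> = (\<integral>\<^sup>+v. ((\<integral>\<^sup>+y. f (fst v, y) \<partial>N) * (\<integral>\<^sup>+y. b y \<partial>N)) * b (snd v) \<partial>(N \<Otimes>\<^sub>M N))"
    by (simp add: mult_ac)
  also have "\<dots> = (\<integral>\<^sup>+x. (\<integral>\<^sup>+y. f (x, y) \<partial>N) * (\<integral>\<^sup>+y. b y \<partial>N) \<partial>N) * (\<integral>\<^sup>+y. b y \<partial>N)"
    by (rule nn_integral_pair_mult[OF N N]) measurable
  also have "\<dots> = (\<integral>\<^sup>+z. f z \<partial>(N \<Otimes>\<^sub>M N)) * (\<integral>\<^sup>+y. b y \<partial>N)\<^sup>2"
  proof -
    have "(\<integral>\<^sup>+x. (\<integral>\<^sup>+y. f (x, y) \<partial>N) * (\<integral>\<^sup>+y. b y \<partial>N) \<partial>N) = (\<integral>\<^sup>+x. (\<integral>\<^sup>+y. f (x, y) \<partial>N) \<partial>N) * (\<integral>\<^sup>+y. b y \<partial>N)"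
      by (rule nn_integral_multc, rule N.borel_measurable_nn_integral_fst) measurable
    also have "(\<integral>\<^sup>+x. (\<integral>\<^sup>+y. f (x, y) \<partial>N) \<partial>N) = (\<integral>\<^sup>+z. f z \<partial>(N \<Otimes>\<^sub>M N))"
      by (rule N.nn_integral_fst) measurable
    finally show ?thesis by (simp only: power2_eq_square mult_ac)
  qed
  finally show ?A .
  have "(\<integral>\<^sup>+w. f (map_prod snd snd w) * (b (fst (fst w)) * b (fst (snd w))) \<partial>((N \<Otimes>\<^sub>M N) \<Otimes>\<^sub>M (N \<Otimes>\<^sub>M N))) =
      (\<integral>\<^sup>+v. \<integral>\<^sup>+u. b (fst v) * (b (fst u) * f (snd v, snd u)) \<partial>(N \<Otimes>\<^sub>M N) \<partial>(N \<Otimes>\<^sub>M N))"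
    by (subst P.nn_integral_fst[symmetric]) (auto simp: map_prod_def split_beta mult_ac)
  also have "\<dots> = (\<integral>\<^sup>+v. b (fst v) * ((\<integral>\<^sup>+y. b y \<partial>N) * (\<integral>\<^sup>+y. f (snd v, y) \<partial>N)) \<partial>(N \<Otimes>\<^sub>M N))"
  proof (rule nn_integral_cong)
    fix v assume "v \<in> space (N \<Otimes>\<^sub>M N)"
    then have [measurable]: "snd v \<in> space N" by (auto simp: space_pair_measure)
    show "(\<integral>\<^sup>+u. b (fst v) * (b (fst u) * f (snd v, snd u)) \<partial>(N \<Otimes>\<^sub>M N)) = b (fst v) * ((\<integral>\<^sup>+y. b y \<partial>N) * (\<integral>\<^sup>+y. f (snd v, y) \<partial>N))"
      using nn_integral_pair_mult[OF N N, of b "\<lambda>y. f (snd v, y)"] by (subst nn_integral_cmult) auto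
  qed
  also have "\<dots> = (\<integral>\<^sup>+y. b y \<partial>N) * (\<integral>\<^sup>+x. (\<integral>\<^sup>+y. b y \<partial>N) * (\<integral>\<^sup>+y. f (x, y) \<partial>N) \<partial>N)"
    by (rule nn_integral_pair_mult[OF N N]) measurable
  also have "\<dots> = (\<integral>\<^sup>+z. f z \<partial>(N \<Otimes>\<^sub>M N)) * (\<integral>\<^sup>+y. b y \<partial>N)\<^sup>2"
  proof -
    have m: "(\<lambda>x. \<integral>\<^sup>+y. f (x, y) \<partial>N) \<in> borel_measurable N" by (rule N.borel_measurable_nn_integral_fst) measurable
    have "(\<integral>\<^sup>+x. (\<integral>\<^sup>+y. b y \<partial>N) * (\<integral>\<^sup>+y. f (x, y) \<partial>N) \<partial>N) = (\<integral>\<^sup>+y. b y \<partial>N) * (\<integral>\<^sup>+x. (\<integral>\<^sup>+y. f (x, y) \<partial>N) \<partial>N)"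
      by (rule nn_integral_cmult[OF m])
    also have "(\<integral>\<^sup>+x. (\<integral>\<^sup>+y. f (x, y) \<partial>N) \<partial>N) = (\<integral>\<^sup>+z. f z \<partial>(N \<Otimes>\<^sub>M N))"
      by (rule N.nn_integral_fst) measurable
    finally show ?thesis by (simp only: power2_eq_square mult_ac)
  qed
  finally show ?B .
qed

lemma sum3_squared_le: "(a + b + c)\<^sup>2 \<le> 3 * (a\<^sup>2 + b\<^sup>2 + c\<^sup>2)" for a b c :: real
  using zero_le_power2[of "a - b"] zero_le_power2[of "a - c"] zero_le_power2[of "b - c"]
  by (simp add: power2_eq_square algebra_simps)

text \<open>Take \<open>x\<close>, \<open>y\<close> in \<open>A\<close> and \<open>x'\<close>,
  \<open>y'\<close> outside. The corners \<open>(x, y)\<close> and \<open>(x', y')\<close> lie in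
  the diagonal blocks, the other two off them. As \<open>u\<close> is nonnegative, the diagonal
  corners cannot cancel in the mixed difference, so a small mixed difference and a small mass off
  the diagonal force a small mass on it. The factor \<open>m\<^sup>2\<close> bounds from below the
  probability that the opposite corner falls into the opposite block.\<close>

lemma ddiff_lower_bound:
  fixes u t :: "'a \<times> 'a \<Rightarrow> real"
  assumes N: "prob_space N" and u[measurable]: "u \<in> borel_measurable (N \<Otimes>\<^sub>M N)" and t[measurable]: "t \<in> borel_measurable (N \<Otimes>\<^sub>M N)"
    and u0: "\<And>z. u z \<ge> 0" and A[measurable]: "A \<in> sets N"
    and m: "0 \<le> m" "m \<le> measure N A" "m \<le> measure N (space N - A)"
  shows "ennreal (m\<^sup>2) * (\<integral>\<^sup>+z. ennreal ((u z)\<^sup>2) * indicator {z. (fst z \<in> A) = (snd z \<in> A)} z \<partial>(N \<Otimes>\<^sub>M N)) \<le>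
    12 * (sqint ((N \<Otimes>\<^sub>M N) \<Otimes>\<^sub>M (N \<Otimes>\<^sub>M N)) (ddiff t) + 4 * sqint (N \<Otimes>\<^sub>M N) (\<lambda>z. u z - t z) +
      2 * (\<integral>\<^sup>+z. ennreal ((u z)\<^sup>2) * indicator {z. (fst z \<in> A) \<noteq> (snd z \<in> A)} z \<partial>(N \<Otimes>\<^sub>M N)))"
proof -
  interpret N: prob_space N by fact
  let ?Q = "N \<Otimes>\<^sub>M N" and ?W = "(N \<Otimes>\<^sub>M N) \<Otimes>\<^sub>M (N \<Otimes>\<^sub>M N)"
  let ?ff = "map_prod fst fst" and ?fs = "map_prod fst snd" and ?sf = "map_prod snd fst" and ?ss = "map_prod snd snd"
  define a b :: "'a \<Rightarrow> ennreal" where "a = indicator A" and "b = indicator (space N - A)"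
  have [measurable]: "a \<in> borel_measurable N" "b \<in> borel_measurable N" by (auto simp: a_def b_def)
  define f1 f2 off e where "f1 z = ennreal ((u z)\<^sup>2) * (a (fst z) * a (snd z))"
    and "f2 z = ennreal ((u z)\<^sup>2) * (b (fst z) * b (snd z))"
    and "off z = ennreal ((u z)\<^sup>2) * (a (fst z) * b (snd z) + b (fst z) * a (snd z))"
    and "e z = ennreal ((u z - t z)\<^sup>2)" for z
  have [measurable]: "f1 \<in> borel_measurable ?Q" "f2 \<in> borel_measurable ?Q" "off \<in> borel_measurable ?Q" "e \<in> borel_measurable ?Q"
    unfolding f1_def[abs_def] f2_def[abs_def] off_def[abs_def] e_def[abs_def] by measurable
  have diag: "(\<integral>\<^sup>+z. ennreal ((u z)\<^sup>2) * indicator {z. (fst z \<in> A) = (snd z \<in> A)} z \<partial>?Q) = (\<integral>\<^sup>+z. f1 z \<partial>?Q) + (\<integral>\<^sup>+z. f2 z \<partial>?Q)"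
    by (subst nn_integral_add[symmetric])
      (auto intro!: nn_integral_cong simp: f1_def f2_def a_def b_def indicator_def space_pair_measure)
  have offi: "(\<integral>\<^sup>+z. ennreal ((u z)\<^sup>2) * indicator {z. (fst z \<in> A) \<noteq> (snd z \<in> A)} z \<partial>?Q) = (\<integral>\<^sup>+z. off z \<partial>?Q)"
    by (auto intro!: nn_integral_cong simp: off_def a_def b_def indicator_def space_pair_measure)
  have ia: "(\<integral>\<^sup>+y. a y \<partial>N) = ennreal (measure N A)" "(\<integral>\<^sup>+y. b y \<partial>N) = ennreal (measure N (space N - A))"
    by (simp_all add: a_def b_def N.emeasure_eq_measure)
  have "ennreal (m\<^sup>2) * ((\<integral>\<^sup>+z. f1 z \<partial>?Q) + (\<integral>\<^sup>+z. f2 z \<partial>?Q)) \<le>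
      (\<integral>\<^sup>+z. f1 z \<partial>?Q) * (\<integral>\<^sup>+y. b y \<partial>N)\<^sup>2 + (\<integral>\<^sup>+z. f2 z \<partial>?Q) * (\<integral>\<^sup>+y. a y \<partial>N)\<^sup>2"
  proof -
    have "ennreal (m\<^sup>2) \<le> (\<integral>\<^sup>+y. b y \<partial>N)\<^sup>2" "ennreal (m\<^sup>2) \<le> (\<integral>\<^sup>+y. a y \<partial>N)\<^sup>2"
      using m unfolding ia by (auto simp: ennreal_power intro!: ennreal_leI power_mono)
    then show ?thesis unfolding distrib_left
      by (subst (1 2) mult.commute) (intro add_mono mult_left_mono; simp)
  qed
  also have "\<dots> = (\<integral>\<^sup>+w. f1 (?ff w) * (b (snd (fst w)) * b (snd (snd w))) \<partial>?W) +
      (\<integral>\<^sup>+w. f2 (?ss w) * (a (fst (fst w)) * a (fst (snd w))) \<partial>?W)"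
    by (simp add: nn_integral_project_mult[OF N])
  also have "\<dots> = (\<integral>\<^sup>+w. f1 (?ff w) * (b (snd (fst w)) * b (snd (snd w))) + f2 (?ss w) * (a (fst (fst w)) * a (fst (snd w))) \<partial>?W)"
    by (rule nn_integral_add[symmetric]) measurable
  also have "\<dots> \<le> (\<integral>\<^sup>+w. 12 * (ennreal ((ddiff t w)\<^sup>2) + (e (?ff w) + e (?fs w) + e (?sf w) + e (?ss w)) + (off (?fs w) + off (?sf w))) \<partial>?W)"
  proof (rule nn_integral_mono)
    fix w assume "w \<in> space ?W"
    then obtain x x' y y' where w: "w = ((x, x'), (y, y'))" "x \<in> space N" "x' \<in> space N" "y \<in> space N" "y' \<in> space N"
      by (auto simp: space_pair_measure)
    show "f1 (?ff w) * (b (snd (fst w)) * b (snd (snd w))) + f2 (?ss w) * (a (fst (fst w)) * a (fst (snd w))) \<le>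
        12 * (ennreal ((ddiff t w)\<^sup>2) + (e (?ff w) + e (?fs w) + e (?sf w) + e (?ss w)) + (off (?fs w) + off (?sf w)))"
    proof (cases "x \<in> A \<and> y \<in> A \<and> x' \<notin> A \<and> y' \<notin> A")
      case False
      then have "f1 (?ff w) * (b (snd (fst w)) * b (snd (snd w))) = 0" "f2 (?ss w) * (a (fst (fst w)) * a (fst (snd w))) = 0"
        by (auto simp: w f1_def f2_def a_def b_def indicator_def)
      then show ?thesis by (simp only: add_0_left zero_le)
    next
      case True
      \<comment> \<open>The mixed difference of the approximation error
        \<open>u - t\<close>.\<close>
      define E where "E = (u (x, y) - t (x, y)) - (u (x, y') - t (x, y')) - (u (x', y) - t (x', y)) + (u (x', y') - t (x', y'))"
      define R where "R = (u (x, y) - t (x, y))\<^sup>2 + (u (x, y') - t (x, y'))\<^sup>2 + (u (x', y) - t (x', y))\<^sup>2 + (u (x', y') - t (x', y'))\<^sup>2"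
      have E: "E\<^sup>2 \<le> 4 * R" unfolding E_def R_def by (rule sum4_squared_le)
      have U: "(u (x, y') + u (x', y))\<^sup>2 \<le> 2 * ((u (x, y'))\<^sup>2 + (u (x', y))\<^sup>2)"
        using zero_le_power2[of "u (x, y') - u (x', y)"] by (simp add: power2_eq_square algebra_simps)
      have "(u (x, y))\<^sup>2 + (u (x', y'))\<^sup>2 \<le> (u (x, y) + u (x', y'))\<^sup>2"
        using u0[of "(x, y)"] u0[of "(x', y')"] by (simp add: power2_sum)
      also have "u (x, y) + u (x', y') = ddiff t w + E + (u (x, y') + u (x', y))"
        by (simp add: w ddiff_def E_def)
      also have "(ddiff t w + E + (u (x, y') + u (x', y)))\<^sup>2 \<le> 3 * ((ddiff t w)\<^sup>2 + E\<^sup>2 + (u (x, y') + u (x', y))\<^sup>2)"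
        by (rule sum3_squared_le)
      \<comment> \<open>\<open>E\<close> costs a factor 4 and the off-diagonal term a factor 2; with
        the outer 3 the largest constant is 12.\<close>
      also have "\<dots> \<le> 12 * ((ddiff t w)\<^sup>2 + R + ((u (x, y'))\<^sup>2 + (u (x', y))\<^sup>2))"
        using E U by (simp add: algebra_simps) (smt (verit) zero_le_power2)
      finally have "ennreal ((u (x, y))\<^sup>2 + (u (x', y'))\<^sup>2) \<le> ennreal (12 * ((ddiff t w)\<^sup>2 + R + ((u (x, y'))\<^sup>2 + (u (x', y))\<^sup>2)))"
        by (rule ennreal_leI)
      also have "\<dots> = 12 * (ennreal ((ddiff t w)\<^sup>2) + (e (?ff w) + e (?fs w) + e (?sf w) + e (?ss w)) + (off (?fs w) + off (?sf w)))"
        using True by (simp add: w R_def e_def off_def a_def b_def ennreal_mult)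
      finally show ?thesis using True by (simp add: w f1_def f2_def a_def b_def)
    qed
  qed
  also have "\<dots> = 12 * (sqint ?W (ddiff t) + (sqint ?Q (\<lambda>z. u z - t z) + sqint ?Q (\<lambda>z. u z - t z) + sqint ?Q (\<lambda>z. u z - t z) + sqint ?Q (\<lambda>z. u z - t z))
      + ((\<integral>\<^sup>+z. off z \<partial>?Q) + (\<integral>\<^sup>+z. off z \<partial>?Q)))"
    by (simp add: nn_integral_cmult nn_integral_add nn_integral_project[OF N, of _ _ off] nn_integral_project[OF N, of _ _ e]
        sqint_def e_def[symmetric])
  finally show ?thesis unfolding diag offi
    by (simp add: mult_2[symmetric] mult.assoc[symmetric] add.assoc)
qed

section \<open>Almost invariant unit vectors of mean zero in both variables\<close>

definition rect_pullback :: "'a measure \<Rightarrow> ('a \<Rightarrow> 'a) \<Rightarrow> (real \<times> 'a set \<times> 'a set) list \<Rightarrow> (real \<times> 'a set \<times> 'a set) list" where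
  "rect_pullback N T = map (\<lambda>(r, A, B). (r, T -` A \<inter> space N, T -` B \<inter> space N))"

text \<open>A measure-preserving map does not change the means that \<open>centred\<close>
  subtracts, so pulling back commutes with centring.\<close>

lemma rect_pullback:
  assumes T[measurable]: "T \<in> N \<rightarrow>\<^sub>M N" and dT: "distr N N T = N" and l: "l \<in> rect_lists N N"
  shows "rect_pullback N T l \<in> rect_lists N N"
    and "z \<in> space (N \<Otimes>\<^sub>M N) \<Longrightarrow> rect (rect_pullback N T l) z = rect l (map_prod T T z)"
    and "z \<in> space (N \<Otimes>\<^sub>M N) \<Longrightarrow> centred N (rect_pullback N T l) z = centred N l (map_prod T T z)"
proof -
  have meas: "measure N (T -` A \<inter> space N) = measure N A" if "A \<in> sets N" for A
    using measure_distr[OF T that] by (simp add: dT)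
  show "rect_pullback N T l \<in> rect_lists N N"
    using l by (induction l) (auto simp: rect_pullback_def)
  show "rect (rect_pullback N T l) z = rect l (map_prod T T z)" if "z \<in> space (N \<Otimes>\<^sub>M N)"
    using that by (induction l) (auto simp: rect_pullback_def space_pair_measure indicator_def)
  show "centred N (rect_pullback N T l) z = centred N l (map_prod T T z)" if "z \<in> space (N \<Otimes>\<^sub>M N)"
    using l that by (induction l) (auto simp: rect_pullback_def space_pair_measure indicator_def meas)
qed

text \<open>The difference between the shifted and the original function is again given by a list,
  so the contraction property of centring applies to it.\<close>

lemma sqint_centred_shift_le:
  assumes N: "prob_space N" and T[measurable]: "T \<in> N \<rightarrow>\<^sub>M N" and dT: "distr N N T = N" and l: "l \<in> rect_lists N N"
  shows "sqint (N \<Otimes>\<^sub>M N) (\<lambda>z. centred N l (map_prod T T z) - centred N l z) \<le>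
    sqint (N \<Otimes>\<^sub>M N) (\<lambda>z. rect l (map_prod T T z) - rect l z)"
proof -
  define k where "k = rect_pullback N T l @ rect_scale (-1) l"
  have k: "k \<in> rect_lists N N" using rect_pullback(1)[OF T dT l] l by (simp add: k_def)
  have "sqint (N \<Otimes>\<^sub>M N) (\<lambda>z. centred N l (map_prod T T z) - centred N l z) = sqint (N \<Otimes>\<^sub>M N) (centred N k)"
    by (rule sqint_cong) (simp add: k_def rect_pullback(3)[OF T dT l])
  also have "\<dots> \<le> sqint (N \<Otimes>\<^sub>M N) (rect k)" by (rule sqint_centred_le[OF N k])
  also have "\<dots> = sqint (N \<Otimes>\<^sub>M N) (\<lambda>z. rect l (map_prod T T z) - rect l z)"
    by (rule sqint_cong) (simp add: k_def rect_pullback(2)[OF T dT l])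
  finally show ?thesis .
qed

text \<open>Centring preserves asymptotic invariance. The point is that the centred approximations
  of the square roots keep a norm bounded away from 0, so that normalising them is harmless.\<close>

lemma almost_invariant_lists:
  fixes h :: "nat \<Rightarrow> 'a \<times> 'a \<Rightarrow> real"
  assumes N: "prob_space N" and h0: "\<And>n z. h n z \<ge> 0" and hi: "\<And>n. integrable (N \<Otimes>\<^sub>M N) (h n)"
    and h1: "\<And>n. (\<integral>z. h n z \<partial>(N \<Otimes>\<^sub>M N)) = 1"
    and A[measurable]: "A \<in> sets N" and A01: "0 < measure N A" "measure N A < 1"
    and conc: "(\<lambda>n. \<integral>z. h n z * indicator {z. (fst z \<in> A) \<noteq> (snd z \<in> A)} z \<partial>(N \<Otimes>\<^sub>M N)) \<longlonglongrightarrow> 0"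
  obtains L :: "nat \<Rightarrow> (real \<times> 'a set \<times> 'a set) list" where
    "\<And>n. L n \<in> rect_lists N N" "\<And>n. sqint (N \<Otimes>\<^sub>M N) (centred N (L n)) = 1"
    "\<And>T. T \<in> N \<rightarrow>\<^sub>M N \<Longrightarrow> distr N N T = N \<Longrightarrow>
      (\<lambda>n. \<integral>z. \<bar>h n (map_prod T T z) - h n z\<bar> \<partial>(N \<Otimes>\<^sub>M N)) \<longlonglongrightarrow> 0 \<Longrightarrow>
      (\<lambda>n. sqint (N \<Otimes>\<^sub>M N) (\<lambda>z. centred N (L n) (map_prod T T z) - centred N (L n) z)) \<longlonglongrightarrow> 0"
proof -
  interpret N: prob_space N by fact
  interpret P: pair_prob_space N N ..
  let ?Q = "N \<Otimes>\<^sub>M N"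
  have hm[measurable]: "h n \<in> borel_measurable ?Q" for n using hi by (rule borel_measurable_integrable)
  define u where "u n z = sqrt (h n z)" for n z
  have u[measurable]: "u n \<in> borel_measurable ?Q" for n unfolding u_def by measurable
  have u2: "(u n z)\<^sup>2 = h n z" for n z by (simp add: u_def h0)
  have u0: "u n z \<ge> 0" for n z by (simp add: u_def h0)
  have su: "sqint ?Q (u n) = 1" for n
    unfolding sqint_def u2 using nn_integral_eq_integral[OF hi[of n]] h0 h1 by simp
  have "\<exists>l\<in>rect_lists N N. sqint ?Q (\<lambda>z. u n z - rect l z) \<le> ennreal (1 / real (Suc n))" for n
  proof -
    have "rect_limit N N (u n)" by (rule rect_limit_L2[OF N N u]) (simp add: su)
    then show ?thesis unfolding rect_limit_def by simp
  qed
  then obtain l where l: "\<And>n. l n \<in> rect_lists N N"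
    and lu: "\<And>n. sqint ?Q (\<lambda>z. u n z - rect (l n) z) \<le> ennreal (1 / real (Suc n))" by metis
  have [measurable]: "rect (l n) \<in> borel_measurable ?Q" "centred N (l n) \<in> borel_measurable ?Q" for n using l by auto
  have fin: "sqint ?Q (centred N (l n)) < \<infinity>" for n
  proof -
    obtain K where K: "\<And>z. \<bar>centred N (l n) z\<bar> \<le> K" using centred_bounded by blast
    have "(centred N (l n) z)\<^sup>2 \<le> K\<^sup>2" for z using K[of z] by (simp add: abs_le_square_iff[symmetric])
    then have "sqint ?Q (centred N (l n)) \<le> (\<integral>\<^sup>+z. ennreal (K\<^sup>2) \<partial>?Q)"
      unfolding sqint_def by (intro nn_integral_mono ennreal_leI)
    also have "\<dots> < \<infinity>" by (simp add: P.emeasure_space_1)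
    finally show ?thesis .
  qed
  define b where "b n = enn2real (sqint ?Q (centred N (l n)))" for n
  have b: "sqint ?Q (centred N (l n)) = ennreal (b n)" for n
    using fin[of n] by (simp add: b_def less_top)
  have b0: "b n \<ge> 0" for n by (simp add: b_def)
  define m where "m = min (measure N A) (1 - measure N A)"
  have m0: "m > 0" using A01 by (simp add: m_def)
  have mA: "0 \<le> m" "m \<le> measure N A" "m \<le> measure N (space N - A)"
    using m0 N.prob_compl[OF A] by (auto simp: m_def)
  define off where "off n = (\<integral>z. h n z * indicator {z. (fst z \<in> A) \<noteq> (snd z \<in> A)} z \<partial>?Q)" for n
  have [measurable]: "Measurable.pred ?Q (\<lambda>z. (fst z \<in> A) = (snd z \<in> A))" by (rule measurable_label_eq) measurable
  have indm: "(\<lambda>z. indicator {z. (fst z \<in> A) \<noteq> (snd z \<in> A)} z :: real) \<in> borel_measurable ?Q"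
  proof -
    have "(\<lambda>z. indicator {z. (fst z \<in> A) \<noteq> (snd z \<in> A)} z :: real) = (\<lambda>z. if (fst z \<in> A) = (snd z \<in> A) then 0 else 1)"
      by (auto simp: fun_eq_iff indicator_def)
    then show ?thesis by (simp add: measurable_If)
  qed
  have hoff: "integrable ?Q (\<lambda>z. h n z * indicator {z. (fst z \<in> A) \<noteq> (snd z \<in> A)} z)" for n
    by (rule Bochner_Integration.integrable_bound[OF hi[of n] borel_measurable_times[OF hm indm]])
       (auto simp: indicator_def h0)
  have lower: "m\<^sup>2 * (1 - off n) \<le> 12 * (16 * b n + 4 / real (Suc n) + 2 * off n)" for n
  proof -
    have o0: "off n \<ge> 0" unfolding off_def by (intro integral_nonneg_AE) (auto simp: h0)
    have o1: "off n \<le> 1"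
      unfolding off_def h1[of n, symmetric] by (rule integral_mono[OF hoff hi]) (auto simp: indicator_def h0)
    have d1: "(\<integral>\<^sup>+z. ennreal ((u n z)\<^sup>2) * indicator {z. (fst z \<in> A) \<noteq> (snd z \<in> A)} z \<partial>?Q) = ennreal (off n)"
    proof -
      have "(\<integral>\<^sup>+z. ennreal ((u n z)\<^sup>2) * indicator {z. (fst z \<in> A) \<noteq> (snd z \<in> A)} z \<partial>?Q) =
          (\<integral>\<^sup>+z. ennreal (h n z * indicator {z. (fst z \<in> A) \<noteq> (snd z \<in> A)} z) \<partial>?Q)"
        by (intro nn_integral_cong) (auto simp: u2 indicator_def)
      also have "\<dots> = ennreal (off n)" unfolding off_def
        by (rule nn_integral_eq_integral[OF hoff]) (auto simp: h0)
      finally show ?thesis .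
    qed
    have d2: "(\<integral>\<^sup>+z. ennreal ((u n z)\<^sup>2) * indicator {z. (fst z \<in> A) = (snd z \<in> A)} z \<partial>?Q) = ennreal (1 - off n)"
    proof -
      have "(\<integral>\<^sup>+z. ennreal ((u n z)\<^sup>2) * indicator {z. (fst z \<in> A) = (snd z \<in> A)} z \<partial>?Q) =
          (\<integral>\<^sup>+z. ennreal (h n z - h n z * indicator {z. (fst z \<in> A) \<noteq> (snd z \<in> A)} z) \<partial>?Q)"
        by (intro nn_integral_cong) (auto simp: u2 indicator_def)
      also have "\<dots> = ennreal (\<integral>z. h n z - h n z * indicator {z. (fst z \<in> A) \<noteq> (snd z \<in> A)} z \<partial>?Q)"
        by (rule nn_integral_eq_integral[OF Bochner_Integration.integrable_diff[OF hi hoff]]) (auto simp: h0 indicator_def)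
      also have "(\<integral>z. h n z - h n z * indicator {z. (fst z \<in> A) \<noteq> (snd z \<in> A)} z \<partial>?Q) = 1 - off n"
        unfolding off_def using Bochner_Integration.integral_diff[OF hi hoff] h1 by simp
      finally show ?thesis .
    qed
    have "ennreal (m\<^sup>2) * ennreal (1 - off n) \<le>
        12 * (sqint (?Q \<Otimes>\<^sub>M ?Q) (ddiff (rect (l n))) + 4 * sqint ?Q (\<lambda>z. u n z - rect (l n) z) + 2 * ennreal (off n))"
      using ddiff_lower_bound[OF N u _ u0 A mA, of "rect (l n)" n] unfolding d1 d2 by simp
    also have "sqint (?Q \<Otimes>\<^sub>M ?Q) (ddiff (rect (l n))) = sqint (?Q \<Otimes>\<^sub>M ?Q) (ddiff (centred N (l n)))"
      by (rule sqint_cong) (simp add: ddiff_centred)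
    also have "12 * (sqint (?Q \<Otimes>\<^sub>M ?Q) (ddiff (centred N (l n))) + 4 * sqint ?Q (\<lambda>z. u n z - rect (l n) z) + 2 * ennreal (off n))
        \<le> 12 * (16 * ennreal (b n) + 4 * ennreal (1 / real (Suc n)) + 2 * ennreal (off n))"
      using sqint_ddiff_le[OF N, of "centred N (l n)"] lu[of n] unfolding b
      by (intro mult_left_mono add_mono) auto
    also have "\<dots> = ennreal (12 * (16 * b n + 4 * (1 / real (Suc n)) + 2 * off n))"
    proof -
      have "12 * (16 * ennreal p + 4 * ennreal q + 2 * ennreal r) = ennreal (12 * (16 * p + 4 * q + 2 * r))"
        if "p \<ge> 0" "q \<ge> 0" "r \<ge> 0" for p q r using that by (simp add: ennreal_mult ennreal_plus)
      from this[OF b0[of n] _ o0] show ?thesis by simp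
    qed
    finally have "ennreal (m\<^sup>2 * (1 - off n)) \<le> ennreal (12 * (16 * b n + 4 * (1 / real (Suc n)) + 2 * off n))"
      using o1 by (simp add: ennreal_mult)
    then show ?thesis using b0[of n] o0 by (subst (asm) ennreal_le_iff) (auto intro!: add_nonneg_nonneg)
  qed
  have "(\<lambda>n. m\<^sup>2 * (1 - off n) - 12 * (4 / real (Suc n) + 2 * off n)) \<longlonglongrightarrow> m\<^sup>2 * (1 - 0) - 12 * (0 + 2 * 0)"
    unfolding off_def by (intro tendsto_intros conc) (rule LIMSEQ_Suc[OF lim_const_over_n])
  then have "\<forall>\<^sub>F n in sequentially. m\<^sup>2 * (1 - off n) - 12 * (4 / real (Suc n) + 2 * off n) > m\<^sup>2 / 2"
    using m0 by (intro order_tendstoD(1)) auto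
  then obtain n0 where n0: "\<And>n. n \<ge> n0 \<Longrightarrow> m\<^sup>2 * (1 - off n) - 12 * (4 / real (Suc n) + 2 * off n) > m\<^sup>2 / 2"
    by (auto simp: eventually_sequentially)
  \<comment> \<open>For \<open>n \<ge> n0\<close> the estimate \<open>lower\<close> gives
    \<open>192 * b n > m\<^sup>2 / 2\<close>, where \<open>192 = 12 * 16\<close>.\<close>
  define \<beta> where "\<beta> = m\<^sup>2 / 384"
  have \<beta>: "\<beta> > 0" using m0 by (simp add: \<beta>_def)
  have b\<beta>: "b n \<ge> \<beta>" if "n \<ge> n0" for n
    using n0[OF that] lower[of n] by (simp add: \<beta>_def algebra_simps)
  \<comment> \<open>The shift by \<open>n0\<close> discards the finitely many indices without the
    lower bound, where \<open>b\<close> might vanish.\<close>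
  define L where "L n = rect_scale (1 / sqrt (b (n + n0))) (l (n + n0))" for n
  show thesis
  proof (rule that[of L])
    show "L n \<in> rect_lists N N" for n unfolding L_def using l by simp
    show "sqint ?Q (centred N (L n)) = 1" for n
    proof -
      have pos: "b (n + n0) > 0" using b\<beta>[of "n + n0"] \<beta> by simp
      have "sqint ?Q (centred N (L n)) = ennreal ((1 / sqrt (b (n + n0)))\<^sup>2) * ennreal (b (n + n0))"
        unfolding L_def centred_rect_scale[abs_def] b[symmetric] by (rule sqint_cmult) measurable
      also have "\<dots> = 1" using pos by (simp add: ennreal_mult[symmetric] power_divide)
      finally show ?thesis .
    qed
    fix T assume T[measurable]: "T \<in> N \<rightarrow>\<^sub>M N" and dT: "distr N N T = N"
      and inv: "(\<lambda>n. \<integral>z. \<bar>h n (map_prod T T z) - h n z\<bar> \<partial>?Q) \<longlonglongrightarrow> 0"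
    have TT[measurable]: "map_prod T T \<in> ?Q \<rightarrow>\<^sub>M ?Q" by (intro measurable_map_prod T)
    have dTT: "distr ?Q ?Q (map_prod T T) = ?Q" by (rule distr_map_prod_preserving[OF N N T dT])
    define I where "I n = (\<integral>z. \<bar>h n (map_prod T T z) - h n z\<bar> \<partial>?Q)" for n
    have hT: "integrable ?Q (\<lambda>z. h n (map_prod T T z))" for n
      using hi[of n] by (subst (asm) dTT[symmetric], subst (asm) integrable_distr_eq) auto
    have uT: "sqint ?Q (\<lambda>z. u n (map_prod T T z) - u n z) \<le> ennreal (I n)" for n
    proof -
      have "sqint ?Q (\<lambda>z. u n (map_prod T T z) - u n z) \<le> (\<integral>\<^sup>+z. ennreal \<bar>h n (map_prod T T z) - h n z\<bar> \<partial>?Q)"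
        unfolding sqint_def
      proof (intro nn_integral_mono ennreal_leI)
        fix z
        \<comment> \<open>This is what turns L1 invariance of the densities into L2 invariance of
          their square roots.\<close>
        have "(p - q)\<^sup>2 \<le> \<bar>p\<^sup>2 - q\<^sup>2\<bar>" if "p \<ge> 0" "q \<ge> 0" for p q :: real
        proof -
          have "\<bar>p - q\<bar> * \<bar>p - q\<bar> \<le> \<bar>p - q\<bar> * (p + q)" using that by (intro mult_left_mono) auto
          also have "\<dots> = \<bar>(p - q) * (p + q)\<bar>" using that by (simp add: abs_mult)
          also have "(p - q) * (p + q) = p\<^sup>2 - q\<^sup>2" by (simp add: power2_eq_square algebra_simps)
          finally show ?thesis by (simp add: power2_eq_square abs_mult[symmetric])
        qed
        from this[OF u0 u0] show "(u n (map_prod T T z) - u n z)\<^sup>2 \<le> \<bar>h n (map_prod T T z) - h n z\<bar>" by (simp add: u2)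
      qed
      also have "\<dots> = ennreal (I n)" unfolding I_def
        by (rule nn_integral_eq_integral) (use hT hi in auto)
      finally show ?thesis .
    qed
    have shift: "sqint ?Q (\<lambda>z. centred N (l n) (map_prod T T z) - centred N (l n) z) \<le> ennreal (8 * (1 / real (Suc n)) + 4 * I n)" for n
    proof -
      let ?d = "\<lambda>z. u n z - rect (l n) z"
      have dd: "sqint ?Q (\<lambda>z. - ?d (map_prod T T z)) = sqint ?Q ?d"
      proof -
        have "sqint ?Q ?d = (\<integral>\<^sup>+z. ennreal ((?d z)\<^sup>2) \<partial>distr ?Q ?Q (map_prod T T))" by (simp add: dTT sqint_def)
        also have "\<dots> = sqint ?Q (\<lambda>z. - ?d (map_prod T T z))"
          unfolding sqint_def by (subst nn_integral_distr) (auto simp: power2_commute)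
        finally show ?thesis by simp
      qed
      have I0: "I n \<ge> 0" by (simp add: I_def)
      have "sqint ?Q (\<lambda>z. centred N (l n) (map_prod T T z) - centred N (l n) z) \<le> sqint ?Q (\<lambda>z. rect (l n) (map_prod T T z) - rect (l n) z)"
        by (rule sqint_centred_shift_le[OF N T dT l])
      also have "\<dots> = sqint ?Q (\<lambda>z. (- ?d (map_prod T T z) + ?d z) + (u n (map_prod T T z) - u n z))"
        by (rule sqint_cong) simp
      also have "\<dots> \<le> 2 * sqint ?Q (\<lambda>z. - ?d (map_prod T T z) + ?d z) + 2 * sqint ?Q (\<lambda>z. u n (map_prod T T z) - u n z)"
        by (rule sqint_add) measurable
      also have "\<dots> \<le> 2 * (2 * sqint ?Q (\<lambda>z. - ?d (map_prod T T z)) + 2 * sqint ?Q ?d) + 2 * sqint ?Q (\<lambda>z. u n (map_prod T T z) - u n z)"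
        by (intro add_mono mult_left_mono order_refl sqint_add) measurable
      also have "\<dots> \<le> 2 * (2 * ennreal (1 / real (Suc n)) + 2 * ennreal (1 / real (Suc n))) + 2 * ennreal (I n)"
        unfolding dd using lu[of n] uT[of n] by (intro add_mono mult_left_mono) auto
      also have "\<dots> = ennreal (2 * (2 * (1 / real (Suc n)) + 2 * (1 / real (Suc n))) + 2 * I n)"
      proof -
        have "2 * (2 * ennreal p + 2 * ennreal p) + 2 * ennreal q = ennreal (2 * (2 * p + 2 * p) + 2 * q)"
          if "p \<ge> 0" "q \<ge> 0" for p q using that
          by (simp add: ennreal_mult[symmetric] ennreal_plus[symmetric] ennreal_numeral[symmetric] del: ennreal_plus ennreal_numeral)
        from this[OF _ I0] show ?thesis by simp
      qed
      also have "\<dots> \<le> ennreal (8 * (1 / real (Suc n)) + 4 * I n)" using I0 by (intro ennreal_leI) simp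
      finally show ?thesis .
    qed
    have up: "sqint ?Q (\<lambda>z. centred N (L n) (map_prod T T z) - centred N (L n) z) \<le>
        ennreal ((8 * (1 / real (Suc (n + n0))) + 4 * I (n + n0)) / \<beta>)" for n
    proof -
      let ?k = "n + n0"
      have pos: "b ?k > 0" using b\<beta>[of ?k] \<beta> by simp
      have I0: "I ?k \<ge> 0" by (simp add: I_def)
      have "sqint ?Q (\<lambda>z. centred N (L n) (map_prod T T z) - centred N (L n) z) =
          sqint ?Q (\<lambda>z. (1 / sqrt (b ?k)) * (centred N (l ?k) (map_prod T T z) - centred N (l ?k) z))"
        by (rule sqint_cong) (simp add: L_def right_diff_distrib diff_divide_distrib)
      also have "\<dots> = ennreal ((1 / sqrt (b ?k))\<^sup>2) * sqint ?Q (\<lambda>z. centred N (l ?k) (map_prod T T z) - centred N (l ?k) z)"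
        by (rule sqint_cmult) measurable
      also have "\<dots> \<le> ennreal ((1 / sqrt (b ?k))\<^sup>2) * ennreal (8 * (1 / real (Suc ?k)) + 4 * I ?k)"
        by (intro mult_left_mono shift) auto
      also have "\<dots> = ennreal ((8 * (1 / real (Suc ?k)) + 4 * I ?k) / b ?k)"
      proof -
        have *: "ennreal ((1 / sqrt p)\<^sup>2) * ennreal q = ennreal (q / p)" if "p > 0" "q \<ge> 0" for p q
          using that by (simp add: ennreal_mult[symmetric] power_divide)
        show ?thesis by (rule *[OF pos]) (use I0 in simp)
      qed
      also have "\<dots> \<le> ennreal ((8 * (1 / real (Suc ?k)) + 4 * I ?k) / \<beta>)"
        using b\<beta>[of ?k] \<beta> I0 by (intro ennreal_leI divide_left_mono) auto
      finally show ?thesis .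
    qed
    have "(\<lambda>n. (8 * (1 / real (Suc n)) + 4 * I n) / \<beta>) \<longlonglongrightarrow> (8 * 0 + 4 * 0) / \<beta>"
      unfolding I_def using \<beta> by (intro tendsto_intros inv LIMSEQ_Suc[OF lim_const_over_n]) auto
    then have "(\<lambda>n. (8 * (1 / real (Suc (n + n0))) + 4 * I (n + n0)) / \<beta>) \<longlonglongrightarrow> (8 * 0 + 4 * 0) / \<beta>"
      by (rule LIMSEQ_ignore_initial_segment)
    then have "(\<lambda>n. ennreal ((8 * (1 / real (Suc (n + n0))) + 4 * I (n + n0)) / \<beta>)) \<longlonglongrightarrow> ennreal ((8 * 0 + 4 * 0) / \<beta>)"
      by (rule tendsto_ennrealI)
    then have "(\<lambda>n. ennreal ((8 * (1 / real (Suc (n + n0))) + 4 * I (n + n0)) / \<beta>)) \<longlonglongrightarrow> 0" by simp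
    then show "(\<lambda>n. sqint ?Q (\<lambda>z. centred N (L n) (map_prod T T z) - centred N (L n) z)) \<longlonglongrightarrow> 0"
      by (rule tendsto_sandwich[OF _ _ tendsto_const, rotated 2]) (use up in auto)
  qed
qed

section \<open>Completions of semi-inner product spaces\<close>

definition l2norm :: "'w measure \<Rightarrow> ('w \<Rightarrow> complex) \<Rightarrow> real" where
  "l2norm W f = sqrt (\<integral>z. (cmod (f z))\<^sup>2 \<partial>W)"

lemma l2norm_nonneg [simp]: "l2norm W f \<ge> 0"
  by (simp add: l2norm_def)

lemma l2norm_power2: "(l2norm W f)\<^sup>2 = (\<integral>z. (cmod (f z))\<^sup>2 \<partial>W)"
  by (simp add: l2norm_def)

lemma l2norm_cong_AE:
  assumes "f \<in> borel_measurable W" "g \<in> borel_measurable W" "AE z in W. f z = g z"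
  shows "l2norm W f = l2norm W g"
  unfolding l2norm_def by (rule arg_cong[where f = sqrt], rule integral_cong_AE) (use assms in auto)

lemma borel_measurable_cnj [measurable (raw)]:
  assumes "f \<in> borel_measurable W"
  shows "(\<lambda>z. cnj (f z)) \<in> borel_measurable W"
  using measurable_compose[OF assms, of cnj borel]
  by (simp add: borel_measurable_continuous_onI continuous_on_cnj)

lemma L2_funD: "f \<in> L2_fun W \<Longrightarrow> f \<in> borel_measurable W" "f \<in> L2_fun W \<Longrightarrow> integrable W (\<lambda>z. (cmod (f z))\<^sup>2)"
  by (auto simp: L2_fun_def)

lemma L2_fun_nn_integral:
  assumes [measurable]: "f \<in> borel_measurable W"
  shows "f \<in> L2_fun W \<longleftrightarrow> (\<integral>\<^sup>+z. ennreal ((cmod (f z))\<^sup>2) \<partial>W) < \<infinity>"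
  by (simp add: L2_fun_def integrable_iff_bounded)

lemma L2_fun_cong_AE:
  assumes "f \<in> L2_fun W" "g \<in> borel_measurable W" "AE z in W. f z = g z"
  shows "g \<in> L2_fun W"
proof -
  have [measurable]: "f \<in> borel_measurable W" "g \<in> borel_measurable W" using assms by (auto simp: L2_fun_def)
  have "integrable W (\<lambda>z. (cmod (g z))\<^sup>2)"
    by (rule integrable_cong_AE_imp[OF L2_funD(2)[OF assms(1)]]) (use assms(3) in auto)
  then show ?thesis using assms(2) by (simp add: L2_fun_def)
qed

lemma L2_fun_cmult: "f \<in> L2_fun W \<Longrightarrow> (\<lambda>z. c * f z) \<in> L2_fun W"
  by (auto simp: L2_fun_def norm_mult power_mult_distrib)

lemma L2_fun_add:
  assumes "f \<in> L2_fun W" "g \<in> L2_fun W"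
  shows "(\<lambda>z. f z + g z) \<in> L2_fun W"
proof -
  have [measurable]: "f \<in> borel_measurable W" "g \<in> borel_measurable W" using assms by (auto simp: L2_fun_def)
  have "integrable W (\<lambda>z. 2 * (cmod (f z))\<^sup>2 + 2 * (cmod (g z))\<^sup>2)" using assms by (auto simp: L2_fun_def)
  then have "integrable W (\<lambda>z. (cmod (f z + g z))\<^sup>2)"
  proof (rule Bochner_Integration.integrable_bound)
    have "(cmod (f z + g z))\<^sup>2 \<le> 2 * (cmod (f z))\<^sup>2 + 2 * (cmod (g z))\<^sup>2" for z
    proof -
      have "(cmod (f z + g z))\<^sup>2 \<le> (cmod (f z) + cmod (g z))\<^sup>2" by (intro power_mono norm_triangle_ineq) auto
      also have "\<dots> \<le> 2 * (cmod (f z))\<^sup>2 + 2 * (cmod (g z))\<^sup>2"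
        using zero_le_power2[of "cmod (f z) - cmod (g z)"] by (simp add: power2_eq_square algebra_simps)
      finally show ?thesis .
    qed
    then show "AE z in W. norm ((cmod (f z + g z))\<^sup>2) \<le> norm (2 * (cmod (f z))\<^sup>2 + 2 * (cmod (g z))\<^sup>2)"
      by (intro AE_I2) simp
  qed measurable
  then show ?thesis by (simp add: L2_fun_def)
qed

lemma L2_fun_diff:
  assumes "f \<in> L2_fun W" "g \<in> L2_fun W"
  shows "(\<lambda>z. f z - g z) \<in> L2_fun W"
  using L2_fun_add[OF assms(1) L2_fun_cmult[OF assms(2), of "-1"]] by simp

lemma integrable_L2_mult:
  assumes "f \<in> L2_fun W" "g \<in> L2_fun W"
  shows "integrable W (\<lambda>z. f z * cnj (g z))" "integrable W (\<lambda>z. cmod (f z) * cmod (g z))"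
proof -
  have [measurable]: "f \<in> borel_measurable W" "g \<in> borel_measurable W" using assms by (auto simp: L2_fun_def)
  have i: "integrable W (\<lambda>z. (cmod (f z))\<^sup>2 + (cmod (g z))\<^sup>2)" using assms by (auto simp: L2_fun_def)
  have b: "cmod (f z) * cmod (g z) \<le> (cmod (f z))\<^sup>2 + (cmod (g z))\<^sup>2" for z
  proof -
    have "2 * (cmod (f z) * cmod (g z)) \<le> (cmod (f z))\<^sup>2 + (cmod (g z))\<^sup>2"
      using zero_le_power2[of "cmod (f z) - cmod (g z)"] by (simp add: power2_eq_square algebra_simps)
    moreover have "0 \<le> cmod (f z) * cmod (g z)" by simp
    ultimately show ?thesis by linarith
  qed
  show "integrable W (\<lambda>z. f z * cnj (g z))"
    by (rule Bochner_Integration.integrable_bound[OF i]) (use b in \<open>auto simp: norm_mult\<close>)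
  show "integrable W (\<lambda>z. cmod (f z) * cmod (g z))"
    by (rule Bochner_Integration.integrable_bound[OF i]) (use b in auto)
qed

lemma l2norm_Cauchy_Schwarz:
  assumes "f \<in> L2_fun W" "g \<in> L2_fun W"
  shows "(\<integral>z. cmod (f z) * cmod (g z) \<partial>W) \<le> l2norm W f * l2norm W g"
proof -
  have [measurable]: "f \<in> borel_measurable W" "g \<in> borel_measurable W" using assms by (auto simp: L2_fun_def)
  let ?I = "\<integral>z. cmod (f z) * cmod (g z) \<partial>W"
  have I0: "?I \<ge> 0" by (intro integral_nonneg_AE) auto
  have "ennreal (?I\<^sup>2) = (\<integral>\<^sup>+z. ennreal (cmod (f z)) * ennreal (cmod (g z)) \<partial>W)\<^sup>2"
    using nn_integral_eq_integral[OF integrable_L2_mult(2)[OF assms]] I0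
    by (simp add: ennreal_mult ennreal_power)
  also have "\<dots> \<le> (\<integral>\<^sup>+z. (ennreal (cmod (f z)))\<^sup>2 \<partial>W) * (\<integral>\<^sup>+z. (ennreal (cmod (g z)))\<^sup>2 \<partial>W)"
    by (rule Cauchy_Schwarz_nn_integral) measurable
  also have "\<dots> = ennreal ((l2norm W f)\<^sup>2) * ennreal ((l2norm W g)\<^sup>2)"
    unfolding l2norm_power2
    using nn_integral_eq_integral[OF L2_funD(2)[OF assms(1)]] nn_integral_eq_integral[OF L2_funD(2)[OF assms(2)]]
    by (simp add: ennreal_power)
  also have "\<dots> = ennreal ((l2norm W f * l2norm W g)\<^sup>2)" by (simp add: ennreal_mult power_mult_distrib)
  finally have "?I\<^sup>2 \<le> (l2norm W f * l2norm W g)\<^sup>2" by (simp add: ennreal_le_iff)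
  then show ?thesis by (rule power2_le_imp_le) simp
qed

lemma l2norm_triangle:
  assumes f: "f \<in> L2_fun W" and g: "g \<in> L2_fun W"
  shows "l2norm W (\<lambda>z. f z + g z) \<le> l2norm W f + l2norm W g"
proof (rule power2_le_imp_le)
  have "(l2norm W (\<lambda>z. f z + g z))\<^sup>2 \<le> (\<integral>z. (cmod (f z))\<^sup>2 + (cmod (g z))\<^sup>2 + 2 * (cmod (f z) * cmod (g z)) \<partial>W)"
    unfolding l2norm_power2
  proof (rule integral_mono)
    show "integrable W (\<lambda>z. (cmod (f z + g z))\<^sup>2)" using L2_fun_add[OF f g] by (rule L2_funD)
    show "integrable W (\<lambda>z. (cmod (f z))\<^sup>2 + (cmod (g z))\<^sup>2 + 2 * (cmod (f z) * cmod (g z)))"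
      using L2_funD(2)[OF f] L2_funD(2)[OF g] integrable_L2_mult(2)[OF f g] by simp
    fix z
    have "(cmod (f z + g z))\<^sup>2 \<le> (cmod (f z) + cmod (g z))\<^sup>2" by (intro power_mono norm_triangle_ineq) auto
    then show "(cmod (f z + g z))\<^sup>2 \<le> (cmod (f z))\<^sup>2 + (cmod (g z))\<^sup>2 + 2 * (cmod (f z) * cmod (g z))"
      by (simp add: power2_sum)
  qed
  also have "\<dots> = (l2norm W f)\<^sup>2 + (l2norm W g)\<^sup>2 + 2 * (\<integral>z. cmod (f z) * cmod (g z) \<partial>W)"
    unfolding l2norm_power2
    using L2_funD(2)[OF f] L2_funD(2)[OF g] integrable_L2_mult(2)[OF f g] by simp
  also have "\<dots> \<le> (l2norm W f)\<^sup>2 + (l2norm W g)\<^sup>2 + 2 * (l2norm W f * l2norm W g)"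
    using l2norm_Cauchy_Schwarz[OF f g] by simp
  also have "\<dots> = (l2norm W f + l2norm W g)\<^sup>2" by (simp add: power2_sum)
  finally show "(l2norm W (\<lambda>z. f z + g z))\<^sup>2 \<le> (l2norm W f + l2norm W g)\<^sup>2" .
qed simp

lemma l2norm_cmult: "l2norm W (\<lambda>z. c * f z) = cmod c * l2norm W f"
  by (simp add: l2norm_def norm_mult power_mult_distrib real_sqrt_mult)

lemma l2norm_minus_commute: "l2norm W (\<lambda>z. f z - g z) = l2norm W (\<lambda>z. g z - f z)"
  by (simp add: l2norm_def norm_minus_commute)

lemma l2norm_diff_triangle:
  assumes "f \<in> L2_fun W" "g \<in> L2_fun W" "h \<in> L2_fun W"
  shows "l2norm W (\<lambda>z. f z - h z) \<le> l2norm W (\<lambda>z. f z - g z) + l2norm W (\<lambda>z. g z - h z)"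
  using l2norm_triangle[OF L2_fun_diff[OF assms(1,2)] L2_fun_diff[OF assms(2,3)]] by simp

lemma l2norm_diff_abs:
  assumes "f \<in> L2_fun W" "g \<in> L2_fun W"
  shows "\<bar>l2norm W f - l2norm W g\<bar> \<le> l2norm W (\<lambda>z. f z - g z)"
  using l2norm_triangle[OF L2_fun_diff[OF assms] assms(2)] l2norm_triangle[OF L2_fun_diff[OF assms(2,1)] assms(1)]
    l2norm_minus_commute[of W f g] by simp

text \<open>Realising an abstract semi-inner product space by square integrable functions turns its
  completion into computations with limits in \<open>L\<^sup>2\<close>.\<close>

locale hspace_model =
  fixes V :: "'v hspace" and W :: "'w measure" and \<Phi> :: "'v \<Rightarrow> 'w \<Rightarrow> complex"
  assumes model_L2: "\<And>u. u \<in> hcarrier V \<Longrightarrow> \<Phi> u \<in> L2_fun W"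
    and add_closed: "\<And>u v. u \<in> hcarrier V \<Longrightarrow> v \<in> hcarrier V \<Longrightarrow> hadd V u v \<in> hcarrier V"
    and scale_closed: "\<And>c u. u \<in> hcarrier V \<Longrightarrow> hscale V c u \<in> hcarrier V"
    and model_add: "\<And>u v. u \<in> hcarrier V \<Longrightarrow> v \<in> hcarrier V \<Longrightarrow> AE z in W. \<Phi> (hadd V u v) z = \<Phi> u z + \<Phi> v z"
    and model_scale: "\<And>c u. u \<in> hcarrier V \<Longrightarrow> AE z in W. \<Phi> (hscale V c u) z = c * \<Phi> u z"
    and model_inner: "\<And>u v. u \<in> hcarrier V \<Longrightarrow> v \<in> hcarrier V \<Longrightarrow> hinner V u v = (\<integral>z. \<Phi> u z * cnj (\<Phi> v z) \<partial>W)"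
begin

lemma model_self_inner:
  assumes "u \<in> hcarrier V"
  shows "hinner V u u = of_real ((l2norm W (\<Phi> u))\<^sup>2)"
  unfolding model_inner[OF assms assms] l2norm_power2
  by (subst complex_norm_square[symmetric]) (simp del: of_real_power)

lemma hnorm_model: "u \<in> hcarrier V \<Longrightarrow> hnorm V u = l2norm W (\<Phi> u)"
  unfolding hnorm_def by (simp add: model_self_inner del: of_real_power)

lemma hnorm_hdiff_model:
  assumes u: "u \<in> hcarrier V" and v: "v \<in> hcarrier V"
  shows "hnorm V (hdiff V u v) = l2norm W (\<lambda>z. \<Phi> u z - \<Phi> v z)"
proof -
  have s: "hscale V (-1) v \<in> hcarrier V" using v by (rule scale_closed)
  then have d: "hdiff V u v \<in> hcarrier V" unfolding hdiff_def using u by (intro add_closed)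
  have "AE z in W. \<Phi> (hdiff V u v) z = \<Phi> u z - \<Phi> v z"
    using model_add[OF u s] model_scale[OF v, of "-1"] unfolding hdiff_def by eventually_elim simp
  then have "l2norm W (\<Phi> (hdiff V u v)) = l2norm W (\<lambda>z. \<Phi> u z - \<Phi> v z)"
    by (intro l2norm_cong_AE L2_funD model_L2 d L2_fun_diff u v)
  then show ?thesis by (simp add: hnorm_model[OF d])
qed

definition converges :: "(nat \<Rightarrow> 'v) \<Rightarrow> ('w \<Rightarrow> complex) \<Rightarrow> bool" where
  "converges s f \<longleftrightarrow> f \<in> L2_fun W \<and> (\<forall>n. s n \<in> hcarrier V) \<and> (\<lambda>n. l2norm W (\<lambda>z. \<Phi> (s n) z - f z)) \<longlonglongrightarrow> 0"

text \<open>\<open>f\<close> is the image of the class \<open>A\<close> under the isometric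
  extension of \<open>\<Phi>\<close> to the completion. As a relation it involves no choice of a
  sequence in the class.\<close>

definition represents :: "(nat \<Rightarrow> 'v) set \<Rightarrow> ('w \<Rightarrow> complex) \<Rightarrow> bool" where
  "represents A f \<longleftrightarrow> (\<exists>s. converges s f \<and> A = hclass V s)"

lemma converges_hcauchy:
  assumes "converges s f"
  shows "hcauchy V s"
  unfolding hcauchy_def
proof (intro conjI allI impI)
  show s: "s n \<in> hcarrier V" for n using assms by (simp add: converges_def)
  fix e :: real assume "e > 0"
  then have "\<forall>\<^sub>F n in sequentially. l2norm W (\<lambda>z. \<Phi> (s n) z - f z) < e / 2"
    using assms unfolding converges_def by (intro order_tendstoD(2)[of _ 0]) auto
  then obtain N where N: "\<And>n. n \<ge> N \<Longrightarrow> l2norm W (\<lambda>z. \<Phi> (s n) z - f z) < e / 2"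
    by (auto simp: eventually_sequentially)
  have "hnorm V (hdiff V (s m) (s n)) < e" if "m \<ge> N" "n \<ge> N" for m n
  proof -
    have "hnorm V (hdiff V (s m) (s n)) \<le> l2norm W (\<lambda>z. \<Phi> (s m) z - f z) + l2norm W (\<lambda>z. f z - \<Phi> (s n) z)"
      unfolding hnorm_hdiff_model[OF s s]
      by (rule l2norm_diff_triangle) (use assms model_L2 in \<open>auto simp: converges_def\<close>)
    also have "\<dots> < e" using N[OF that(1)] N[OF that(2)] l2norm_minus_commute[of W f] by simp
    finally show ?thesis .
  qed
  then show "\<exists>N. \<forall>m\<ge>N. \<forall>n\<ge>N. hnorm V (hdiff V (s m) (s n)) < e" by blast
qed

text \<open>The operations of \<open>hcompletion\<close> compute with the sequence that
  \<open>rep\<close> selects. Its distance to the sequence defining the class tends to 0, hence it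
  has the same limit, which makes these operations well defined on limits.\<close>

lemma represents_rep:
  assumes "represents A f"
  shows "converges (rep A) f"
proof -
  obtain s where s: "converges s f" "A = hclass V s" using assms unfolding represents_def by blast
  have sc: "s n \<in> hcarrier V" for n using s(1) by (simp add: converges_def)
  have "l2norm W (\<lambda>z. \<Phi> (s n) z - \<Phi> (s n) z) = 0" for n by (simp add: l2norm_def)
  then have "s \<in> A" unfolding s(2) hclass_def using converges_hcauchy[OF s(1)] by (simp add: hnorm_hdiff_model[OF sc sc])
  then have r: "rep A \<in> A" unfolding rep_def by (rule someI[where P = "\<lambda>a. a \<in> _"])
  have rc: "rep A n \<in> hcarrier V" for n using r unfolding s(2) hclass_def hcauchy_def by blast
  have lim: "(\<lambda>n. l2norm W (\<lambda>z. \<Phi> (s n) z - \<Phi> (rep A n) z)) \<longlonglongrightarrow> 0"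
  proof -
    have "(\<lambda>n. hnorm V (hdiff V (s n) (rep A n))) \<longlonglongrightarrow> 0" using r s(2) unfolding hclass_def by simp
    then show ?thesis by (simp add: hnorm_hdiff_model[OF sc rc])
  qed
  have f: "f \<in> L2_fun W" using s(1) by (simp add: converges_def)
  have "(\<lambda>n. l2norm W (\<lambda>z. \<Phi> (s n) z - \<Phi> (rep A n) z) + l2norm W (\<lambda>z. \<Phi> (s n) z - f z)) \<longlonglongrightarrow> 0"
    using lim s(1) by (intro tendsto_add_zero) (auto simp: converges_def)
  then have "(\<lambda>n. l2norm W (\<lambda>z. \<Phi> (rep A n) z - f z)) \<longlonglongrightarrow> 0"
  proof (rule tendsto_sandwich[OF _ _ tendsto_const, rotated 2])
    show "\<forall>\<^sub>F n in sequentially. l2norm W (\<lambda>z. \<Phi> (rep A n) z - f z) \<le>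
        l2norm W (\<lambda>z. \<Phi> (s n) z - \<Phi> (rep A n) z) + l2norm W (\<lambda>z. \<Phi> (s n) z - f z)"
    proof (intro always_eventually allI)
      fix n
      show "l2norm W (\<lambda>z. \<Phi> (rep A n) z - f z) \<le>
        l2norm W (\<lambda>z. \<Phi> (s n) z - \<Phi> (rep A n) z) + l2norm W (\<lambda>z. \<Phi> (s n) z - f z)"
        using l2norm_diff_triangle[OF model_L2[OF rc] model_L2[OF sc] f]
        by (subst (2) l2norm_minus_commute)
    qed
  qed auto
  then show ?thesis using f rc by (simp add: converges_def)
qed

lemma converges_hclass: "converges s f \<Longrightarrow> represents (hclass V s) f"
  unfolding represents_def by blast

lemma represents_const:
  assumes "u \<in> hcarrier V" "f \<in> borel_measurable W" "AE z in W. \<Phi> u z = f z"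
  shows "represents (hclass V (\<lambda>_. u)) f"
proof -
  have f: "f \<in> L2_fun W" using L2_fun_cong_AE[OF model_L2[OF assms(1)] assms(2,3)] .
  have "l2norm W (\<lambda>z. \<Phi> u z - f z) = l2norm W (\<lambda>z. 0)"
    by (rule l2norm_cong_AE) (use assms L2_funD(1)[OF L2_fun_diff[OF model_L2[OF assms(1)] f]] in auto)
  then have "l2norm W (\<lambda>z. \<Phi> u z - f z) = 0" by (simp add: l2norm_def)
  then show ?thesis using assms(1) f by (intro converges_hclass) (simp add: converges_def)
qed

lemma represents_carrier: "represents A f \<Longrightarrow> A \<in> hcarrier (hcompletion V)"
  unfolding represents_def hcompletion_def using converges_hcauchy by auto

text \<open>The inner product of the completion is a \<open>lim\<close>, so convergence along the
  selected sequence has to be proved before its value can be read off.\<close>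

lemma represents_hnorm:
  assumes "represents A f"
  shows "hnorm (hcompletion V) A = l2norm W f"
proof -
  have r: "converges (rep A) f" by (rule represents_rep[OF assms])
  then have rc: "rep A n \<in> hcarrier V" and f: "f \<in> L2_fun W" for n by (auto simp: converges_def)
  have "(\<lambda>n. l2norm W (\<Phi> (rep A n))) \<longlonglongrightarrow> l2norm W f"
  proof (rule LIM_zero_cancel, rule tendsto_rabs_zero_cancel)
    show "(\<lambda>n. \<bar>l2norm W (\<Phi> (rep A n)) - l2norm W f\<bar>) \<longlonglongrightarrow> 0"
    proof (rule tendsto_sandwich[OF _ _ tendsto_const, rotated 2])
      show "(\<lambda>n. l2norm W (\<lambda>z. \<Phi> (rep A n) z - f z)) \<longlonglongrightarrow> 0" using r by (simp add: converges_def)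
      show "\<forall>\<^sub>F n in sequentially. \<bar>l2norm W (\<Phi> (rep A n)) - l2norm W f\<bar> \<le> l2norm W (\<lambda>z. \<Phi> (rep A n) z - f z)"
        by (intro always_eventually allI l2norm_diff_abs model_L2 rc f)
    qed auto
  qed
  then have "(\<lambda>n. complex_of_real ((l2norm W (\<Phi> (rep A n)))\<^sup>2)) \<longlonglongrightarrow> complex_of_real ((l2norm W f)\<^sup>2)"
    by (intro tendsto_of_real tendsto_power)
  then have "(\<lambda>n. hinner V (rep A n) (rep A n)) \<longlonglongrightarrow> complex_of_real ((l2norm W f)\<^sup>2)"
    by (simp only: model_self_inner[OF rc])
  then have "hinner (hcompletion V) A A = complex_of_real ((l2norm W f)\<^sup>2)"
    unfolding hcompletion_def by (simp add: limI del: of_real_power)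
  then show ?thesis unfolding hnorm_def by (simp del: of_real_power)
qed

lemma represents_hadd:
  assumes "represents A f" "represents B g"
  shows "represents (hadd (hcompletion V) A B) (\<lambda>z. f z + g z)"
proof -
  have A: "converges (rep A) f" and B: "converges (rep B) g" using assms by (auto intro: represents_rep)
  then have Ac: "rep A n \<in> hcarrier V" and Bc: "rep B n \<in> hcarrier V" and f: "f \<in> L2_fun W" and g: "g \<in> L2_fun W" for n
    by (auto simp: converges_def)
  have "(\<lambda>n. l2norm W (\<lambda>z. \<Phi> (rep A n) z - f z) + l2norm W (\<lambda>z. \<Phi> (rep B n) z - g z)) \<longlonglongrightarrow> 0"
    using A B by (intro tendsto_add_zero) (auto simp: converges_def)
  then have "(\<lambda>n. l2norm W (\<lambda>z. \<Phi> (hadd V (rep A n) (rep B n)) z - (f z + g z))) \<longlonglongrightarrow> 0"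
  proof (rule tendsto_sandwich[OF _ _ tendsto_const, rotated 2])
    have "l2norm W (\<lambda>z. \<Phi> (hadd V (rep A n) (rep B n)) z - (f z + g z)) \<le>
        l2norm W (\<lambda>z. \<Phi> (rep A n) z - f z) + l2norm W (\<lambda>z. \<Phi> (rep B n) z - g z)" for n
    proof -
      have "l2norm W (\<lambda>z. \<Phi> (hadd V (rep A n) (rep B n)) z - (f z + g z)) =
          l2norm W (\<lambda>z. (\<Phi> (rep A n) z - f z) + (\<Phi> (rep B n) z - g z))"
      proof (rule l2norm_cong_AE)
        show "AE z in W. \<Phi> (hadd V (rep A n) (rep B n)) z - (f z + g z) = (\<Phi> (rep A n) z - f z) + (\<Phi> (rep B n) z - g z)"
          using model_add[OF Ac[of n] Bc[of n]] by eventually_elim simp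
      qed (intro L2_funD(1) L2_fun_diff L2_fun_add model_L2 add_closed Ac Bc f g)+
      also have "\<dots> \<le> l2norm W (\<lambda>z. \<Phi> (rep A n) z - f z) + l2norm W (\<lambda>z. \<Phi> (rep B n) z - g z)"
        by (intro l2norm_triangle L2_fun_diff model_L2 Ac Bc f g)
      finally show ?thesis .
    qed
    then show "\<forall>\<^sub>F n in sequentially. l2norm W (\<lambda>z. \<Phi> (hadd V (rep A n) (rep B n)) z - (f z + g z)) \<le>
        l2norm W (\<lambda>z. \<Phi> (rep A n) z - f z) + l2norm W (\<lambda>z. \<Phi> (rep B n) z - g z)" by simp
  qed auto
  then show ?thesis unfolding hcompletion_def
    by (auto intro!: converges_hclass simp: converges_def L2_fun_add f g add_closed Ac Bc)
qed

lemma represents_hscale: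
  assumes "represents A f"
  shows "represents (hscale (hcompletion V) c A) (\<lambda>z. c * f z)"
proof -
  have A: "converges (rep A) f" using assms by (rule represents_rep)
  then have Ac: "rep A n \<in> hcarrier V" and f: "f \<in> L2_fun W" for n by (auto simp: converges_def)
  have "l2norm W (\<lambda>z. \<Phi> (hscale V c (rep A n)) z - c * f z) = cmod c * l2norm W (\<lambda>z. \<Phi> (rep A n) z - f z)" for n
  proof -
    have "l2norm W (\<lambda>z. \<Phi> (hscale V c (rep A n)) z - c * f z) = l2norm W (\<lambda>z. c * (\<Phi> (rep A n) z - f z))"
    proof (rule l2norm_cong_AE)
      show "AE z in W. \<Phi> (hscale V c (rep A n)) z - c * f z = c * (\<Phi> (rep A n) z - f z)"
        using model_scale[OF Ac[of n], of c] by eventually_elim (simp add: algebra_simps)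
    qed (intro L2_funD(1) L2_fun_diff L2_fun_cmult model_L2 scale_closed Ac f)+
    then show ?thesis by (simp only: l2norm_cmult)
  qed
  moreover have "(\<lambda>n. cmod c * l2norm W (\<lambda>z. \<Phi> (rep A n) z - f z)) \<longlonglongrightarrow> cmod c * 0"
    using A by (intro tendsto_mult tendsto_const) (simp add: converges_def)
  ultimately have "(\<lambda>n. l2norm W (\<lambda>z. \<Phi> (hscale V c (rep A n)) z - c * f z)) \<longlonglongrightarrow> 0" by simp
  then show ?thesis unfolding hcompletion_def
    by (auto intro!: converges_hclass simp: converges_def L2_fun_cmult f scale_closed Ac)
qed

lemma represents_hdiff:
  assumes "represents A f" "represents B g"
  shows "hnorm (hcompletion V) (hdiff (hcompletion V) A B) = l2norm W (\<lambda>z. f z - g z)"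
  using represents_hnorm[OF represents_hadd[OF assms(1) represents_hscale[OF assms(2), of "-1"]]]
  by (simp add: hdiff_def)

end

section \<open>Representatives of classes in L2 and in its mean-zero part\<close>

lemma rep_ae_class:
  assumes [measurable]: "f \<in> borel_measurable N"
  shows "rep (ae_class N f) \<in> borel_measurable N" "AE x in N. rep (ae_class N f) x = f x"
proof -
  have "f \<in> ae_class N f" by (simp add: ae_class_def)
  then have "rep (ae_class N f) \<in> ae_class N f" unfolding rep_def by (rule someI[where P = "\<lambda>a. a \<in> _"])
  then show "rep (ae_class N f) \<in> borel_measurable N" "AE x in N. rep (ae_class N f) x = f x"
    by (auto simp: ae_class_def elim: eventually_mono)
qed

lemma rep_L2_fun:
  assumes "f \<in> L2_fun N"
  shows "rep (ae_class N f) \<in> L2_fun N"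
proof -
  have f: "f \<in> borel_measurable N" using assms by (rule L2_funD)
  show ?thesis using rep_ae_class(2)[OF f]
    by (intro L2_fun_cong_AE[OF assms rep_ae_class(1)[OF f]]) (auto elim: eventually_mono)
qed

lemma L2_0_carrier_iff:
  assumes "prob_space N"
  shows "A \<in> hcarrier (L2_0 N) \<longleftrightarrow> A \<in> ae_class N ` L2_fun N \<and> (\<integral>x. rep A x \<partial>N) = 0"
proof -
  have "(\<integral>x. rep A x * cnj (rep (ae_class N (\<lambda>_. 1)) x) \<partial>N) = (\<integral>x. rep A x \<partial>N)" if "A \<in> ae_class N ` L2_fun N"
  proof -
    obtain f where f: "f \<in> L2_fun N" "A = ae_class N f" using \<open>A \<in> _\<close> by blast
    have m: "rep A \<in> borel_measurable N" "rep (ae_class N (\<lambda>_. 1)) \<in> borel_measurable N"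
      unfolding f(2) by (intro rep_ae_class L2_funD f borel_measurable_const)+
    show ?thesis
    proof (rule integral_cong_AE)
      have "AE x in N. rep (ae_class N (\<lambda>_. 1)) x = 1" by (rule rep_ae_class) simp
      then show "AE x in N. rep A x * cnj (rep (ae_class N (\<lambda>_. 1)) x) = rep A x" by eventually_elim simp
    qed (intro borel_measurable_times borel_measurable_cnj m)+
  qed
  then show ?thesis by (auto simp: L2_0_def L2_def)
qed

lemma L2_0_rep:
  assumes "prob_space N" "A \<in> hcarrier (L2_0 N)"
  shows "rep A \<in> L2_fun N" "(\<integral>x. rep A x \<partial>N) = 0"
  using assms(2) rep_L2_fun unfolding L2_0_carrier_iff[OF assms(1)] by auto

lemma ae_class_L2_0:
  assumes "prob_space N" "f \<in> L2_fun N" "(\<integral>x. f x \<partial>N) = 0"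
  shows "ae_class N f \<in> hcarrier (L2_0 N)"
proof -
  have f: "f \<in> borel_measurable N" using assms(2) by (rule L2_funD)
  have "(\<integral>x. rep (ae_class N f) x \<partial>N) = (\<integral>x. f x \<partial>N)"
    by (rule integral_cong_AE) (use rep_ae_class[OF f] f in auto)
  then show ?thesis using assms by (simp add: L2_0_carrier_iff)
qed

section \<open>The Koopman representation on tensor products\<close>

lemma (in prob_space) AE_pair_snd:
  assumes "AE x in M. Q x"
  shows "AE p in M \<Otimes>\<^sub>M M. Q (snd p)"
proof -
  have "AE x in distr (M \<Otimes>\<^sub>M M) M snd. Q x"
    unfolding distr_pair_snd by (rule assms)
  then show ?thesis by (rule AE_distrD[rotated]) measurable
qed

lemma L2_fun_tensor:
  assumes N: "prob_space N" and a: "a \<in> L2_fun N" and b: "b \<in> L2_fun N"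
  shows "(\<lambda>z. a (fst z) * cnj (b (snd z))) \<in> L2_fun (N \<Otimes>\<^sub>M N)"
proof -
  have [measurable]: "a \<in> borel_measurable N" "b \<in> borel_measurable N" using a b by (auto simp: L2_fun_def)
  have "(\<integral>\<^sup>+z. ennreal ((cmod (a (fst z) * cnj (b (snd z))))\<^sup>2) \<partial>(N \<Otimes>\<^sub>M N)) =
      (\<integral>\<^sup>+z. ennreal ((cmod (a (fst z)))\<^sup>2) * ennreal ((cmod (b (snd z)))\<^sup>2) \<partial>(N \<Otimes>\<^sub>M N))"
    by (intro nn_integral_cong) (simp add: norm_mult power_mult_distrib ennreal_mult)
  also have "\<dots> = (\<integral>\<^sup>+x. ennreal ((cmod (a x))\<^sup>2) \<partial>N) * (\<integral>\<^sup>+y. ennreal ((cmod (b y))\<^sup>2) \<partial>N)"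
    by (rule nn_integral_pair_mult[OF N N]) measurable
  also have "\<dots> < \<infinity>" using a b by (simp add: L2_fun_nn_integral ennreal_mult_less_top)
  finally show ?thesis by (subst L2_fun_nn_integral) simp_all
qed

lemma integral_tensor:
  fixes f g :: "'a \<Rightarrow> complex"
  assumes N: "prob_space N" and f: "integrable N f" and g: "integrable N g"
  shows "(\<integral>z. f (fst z) * g (snd z) \<partial>(N \<Otimes>\<^sub>M N)) = (\<integral>x. f x \<partial>N) * (\<integral>y. g y \<partial>N)"
proof -
  interpret N: prob_space N by fact
  interpret P: pair_sigma_finite N N ..
  have [measurable]: "f \<in> borel_measurable N" "g \<in> borel_measurable N" using f g by auto
  have "(\<integral>\<^sup>+z. ennreal (norm (f (fst z) * g (snd z))) \<partial>(N \<Otimes>\<^sub>M N)) =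
      (\<integral>\<^sup>+z. ennreal (norm (f (fst z))) * ennreal (norm (g (snd z))) \<partial>(N \<Otimes>\<^sub>M N))"
    by (intro nn_integral_cong) (simp add: norm_mult ennreal_mult)
  also have "\<dots> = (\<integral>\<^sup>+x. ennreal (norm (f x)) \<partial>N) * (\<integral>\<^sup>+y. ennreal (norm (g y)) \<partial>N)"
    by (rule nn_integral_pair_mult[OF N N]) measurable
  also have "\<dots> < \<infinity>" using f g by (simp add: integrable_iff_bounded ennreal_mult_less_top)
  finally have "integrable (N \<Otimes>\<^sub>M N) (\<lambda>z. f (fst z) * g (snd z))" by (simp add: integrable_iff_bounded)
  from P.integral_fst'[OF this] show ?thesis by simp
qed

text \<open>The second factor is conjugated because it belongs to the conjugate space: with this
  convention elementary tensors depend complex linearly on both factors, and so does the function of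
  two variables.\<close>

definition tensor_eval :: "(('a \<Rightarrow> complex) set \<times> ('a \<Rightarrow> complex) set) list \<Rightarrow> 'a \<times> 'a \<Rightarrow> complex" where
  "tensor_eval u z = (\<Sum>(A, B)\<leftarrow>u. rep A (fst z) * cnj (rep B (snd z)))"

lemma tensor_eval_simps [simp]:
  "tensor_eval [] z = 0"
  "tensor_eval ((A, B) # u) z = rep A (fst z) * cnj (rep B (snd z)) + tensor_eval u z"
  "tensor_eval (u @ v) z = tensor_eval u z + tensor_eval v z"
  by (simp_all add: tensor_eval_def)

abbreviation L2_0_tensors :: "'a measure \<Rightarrow> (('a \<Rightarrow> complex) set \<times> ('a \<Rightarrow> complex) set) list hspace" where
  "L2_0_tensors N \<equiv> formal_tensors (L2_0 N) (conj_hspace (L2_0 N))"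

lemma L2_0_tensors_carrier: "hcarrier (L2_0_tensors N) = lists (hcarrier (L2_0 N) \<times> hcarrier (L2_0 N))"
  by (simp add: formal_tensors_def conj_hspace_def)

lemma tensor_eval_L2:
  assumes N: "prob_space N" and "u \<in> hcarrier (L2_0_tensors N)"
  shows "tensor_eval u \<in> L2_fun (N \<Otimes>\<^sub>M N)"
  using assms(2) unfolding L2_0_tensors_carrier
proof (induction u)
  case Nil
  then show ?case unfolding tensor_eval_simps(1)[abs_def] by (simp add: L2_fun_def)
next
  case (Cons a u)
  then show ?case unfolding tensor_eval_simps(2)[abs_def]
    by (cases a) (auto simp: tensor_eval_simps(2)[abs_def] intro!: L2_fun_add L2_fun_tensor[OF N] L2_0_rep[OF N])
qed

lemma L2_0_scale:
  assumes N: "prob_space N" and A: "A \<in> hcarrier (L2_0 N)"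
  shows "hscale (L2_0 N) c A \<in> hcarrier (L2_0 N)" "AE x in N. rep (hscale (L2_0 N) c A) x = c * rep A x"
proof -
  note r = L2_0_rep[OF N A]
  have s: "hscale (L2_0 N) c A = ae_class N (\<lambda>x. c * rep A x)" by (simp add: L2_0_def L2_def)
  have m: "(\<lambda>x. c * rep A x) \<in> L2_fun N" using r(1) by (rule L2_fun_cmult)
  show "hscale (L2_0 N) c A \<in> hcarrier (L2_0 N)" unfolding s
    by (rule ae_class_L2_0[OF N m]) (simp add: r(2))
  show "AE x in N. rep (hscale (L2_0 N) c A) x = c * rep A x" unfolding s
    by (rule rep_ae_class) (rule L2_funD[OF m])
qed

lemma L2_0_inner: "hinner (L2_0 N) A B = (\<integral>x. rep A x * cnj (rep B x) \<partial>N)"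
  by (simp add: L2_0_def L2_def)

text \<open>By Fubini, inner products of elementary tensors are inner products of product functions
  on the square. Scaling a tensor is matched only almost everywhere, since classes are evaluated at
  selected representatives.\<close>

lemma tensor_model:
  assumes N: "prob_space N"
  shows "hspace_model (L2_0_tensors N) (N \<Otimes>\<^sub>M N) tensor_eval"
proof
  interpret N: prob_space N by fact
  let ?V = "L2_0_tensors N" and ?P = "N \<Otimes>\<^sub>M N"
  show "tensor_eval u \<in> L2_fun ?P" if "u \<in> hcarrier ?V" for u by (rule tensor_eval_L2[OF N that])
  show "hadd ?V u v \<in> hcarrier ?V" if "u \<in> hcarrier ?V" "v \<in> hcarrier ?V" for u v
    using that unfolding L2_0_tensors_carrier by (simp add: formal_tensors_def)
  show "hscale ?V c u \<in> hcarrier ?V" if "u \<in> hcarrier ?V" for c u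
    using that unfolding L2_0_tensors_carrier
    by (induction u) (auto simp: formal_tensors_def L2_0_scale[OF N])
  show "AE z in ?P. tensor_eval (hadd ?V u v) z = tensor_eval u z + tensor_eval v z" for u v
    by (simp add: formal_tensors_def)
  show "AE z in ?P. tensor_eval (hscale ?V c u) z = c * tensor_eval u z" if "u \<in> hcarrier ?V" for c u
    using that unfolding L2_0_tensors_carrier
  proof (induction u)
    case (Cons a u)
    obtain A B where a: "a = (A, B)" by (cases a)
    have A: "A \<in> hcarrier (L2_0 N)" using Cons.hyps a by simp
    have IH: "AE z in ?P. tensor_eval (hscale ?V c u) z = c * tensor_eval u z" using Cons by simp
    have s: "hscale ?V c (a # u) = (hscale (L2_0 N) c A, B) # hscale ?V c u"
      by (simp add: formal_tensors_def a)
    have "AE z in ?P. rep (hscale (L2_0 N) c A) (fst z) = c * rep A (fst z)"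
      by (rule N.AE_pair_fst[OF L2_0_scale(2)[OF N A]])
    then show ?case using IH unfolding s unfolding a by eventually_elim (simp add: algebra_simps)
  qed (simp add: formal_tensors_def)
  show "hinner ?V u v = (\<integral>z. tensor_eval u z * cnj (tensor_eval v z) \<partial>?P)"
    if u: "u \<in> hcarrier ?V" and v: "v \<in> hcarrier ?V" for u v
  proof -
    \<comment> \<open>The order of \<open>B'\<close> and \<open>B\<close> is reversed by
      \<open>conj_hspace\<close>, in accordance with the conjugation in
      \<open>tensor_eval\<close>.\<close>
    have pair: "hinner (L2_0 N) A A' * hinner (L2_0 N) B' B =
        (\<integral>z. (rep A (fst z) * cnj (rep B (snd z))) * cnj (rep A' (fst z) * cnj (rep B' (snd z))) \<partial>?P)"
      if "A \<in> hcarrier (L2_0 N)" "B \<in> hcarrier (L2_0 N)" "A' \<in> hcarrier (L2_0 N)" "B' \<in> hcarrier (L2_0 N)" for A B A' B'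
    proof -
      have "(\<integral>z. (rep A (fst z) * cnj (rep A' (fst z))) * (rep B' (snd z) * cnj (rep B (snd z))) \<partial>?P) =
          hinner (L2_0 N) A A' * hinner (L2_0 N) B' B"
        unfolding L2_0_inner by (rule integral_tensor[OF N]) (intro integrable_L2_mult L2_0_rep[OF N] that)+
      then show ?thesis by (simp add: mult_ac)
    qed
    have row: "(\<Sum>(A', B')\<leftarrow>v. hinner (L2_0 N) A A' * hinner (L2_0 N) B' B) =
        (\<integral>z. (rep A (fst z) * cnj (rep B (snd z))) * cnj (tensor_eval v z) \<partial>?P)"
      if A: "A \<in> hcarrier (L2_0 N)" and B: "B \<in> hcarrier (L2_0 N)" for A B
      using v unfolding L2_0_tensors_carrier
    proof (induction v)
      case (Cons a v)
      obtain A' B' where a: "a = (A', B')" by (cases a)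
      have A': "A' \<in> hcarrier (L2_0 N)" and B': "B' \<in> hcarrier (L2_0 N)" and v': "v \<in> hcarrier ?V"
        using Cons.hyps a by (auto simp: L2_0_tensors_carrier)
      note T = L2_fun_tensor[OF N L2_0_rep(1)[OF N A] L2_0_rep(1)[OF N B]]
      note T' = L2_fun_tensor[OF N L2_0_rep(1)[OF N A'] L2_0_rep(1)[OF N B']]
      have "(\<integral>z. (rep A (fst z) * cnj (rep B (snd z))) * cnj (tensor_eval (a # v) z) \<partial>?P) =
          (\<integral>z. (rep A (fst z) * cnj (rep B (snd z))) * cnj (rep A' (fst z) * cnj (rep B' (snd z))) +
            (rep A (fst z) * cnj (rep B (snd z))) * cnj (tensor_eval v z) \<partial>?P)"
        by (simp add: a distrib_left)
      also have "\<dots> = (\<integral>z. (rep A (fst z) * cnj (rep B (snd z))) * cnj (rep A' (fst z) * cnj (rep B' (snd z))) \<partial>?P) +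
          (\<integral>z. (rep A (fst z) * cnj (rep B (snd z))) * cnj (tensor_eval v z) \<partial>?P)"
        by (rule Bochner_Integration.integral_add[OF integrable_L2_mult(1)[OF T T'] integrable_L2_mult(1)[OF T tensor_eval_L2[OF N v']]])
      finally show ?case using Cons.IH pair[OF A B A' B'] by (simp add: a)
    qed simp
    have "(\<Sum>(A, B)\<leftarrow>u. \<Sum>(A', B')\<leftarrow>v. hinner (L2_0 N) A A' * hinner (L2_0 N) B' B) =
        (\<integral>z. tensor_eval u z * cnj (tensor_eval v z) \<partial>?P)"
      using u unfolding L2_0_tensors_carrier
    proof (induction u)
      case (Cons a u)
      obtain A B where a: "a = (A, B)" by (cases a)
      have A: "A \<in> hcarrier (L2_0 N)" and B: "B \<in> hcarrier (L2_0 N)" and u': "u \<in> hcarrier ?V"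
        using Cons.hyps a by (auto simp: L2_0_tensors_carrier)
      note T = L2_fun_tensor[OF N L2_0_rep(1)[OF N A] L2_0_rep(1)[OF N B]]
      have "(\<integral>z. tensor_eval (a # u) z * cnj (tensor_eval v z) \<partial>?P) =
          (\<integral>z. (rep A (fst z) * cnj (rep B (snd z))) * cnj (tensor_eval v z) + tensor_eval u z * cnj (tensor_eval v z) \<partial>?P)"
        by (simp add: a distrib_right)
      also have "\<dots> = (\<integral>z. (rep A (fst z) * cnj (rep B (snd z))) * cnj (tensor_eval v z) \<partial>?P) +
          (\<integral>z. tensor_eval u z * cnj (tensor_eval v z) \<partial>?P)"
        by (rule Bochner_Integration.integral_add[OF integrable_L2_mult(1)[OF T tensor_eval_L2[OF N v]]
            integrable_L2_mult(1)[OF tensor_eval_L2[OF N u'] tensor_eval_L2[OF N v]]])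
      finally show ?case using Cons.IH row[OF A B] by (simp add: a)
    qed simp
    then show ?thesis by (simp add: formal_tensors_def conj_hspace_def)
  qed
qed

lemma l2norm_of_real:
  assumes "f \<in> borel_measurable W"
  shows "l2norm W (\<lambda>z. of_real (f z)) = sqrt (enn2real (sqint W f))"
  unfolding l2norm_def sqint_def norm_of_real power2_abs
  by (subst integral_eq_nn_integral) (use assms in auto)

lemma koopman_L2_0:
  assumes N: "prob_space N" and T[measurable]: "T \<in> N \<rightarrow>\<^sub>M N" and dT: "distr N N T = N" and A: "A \<in> hcarrier (L2_0 N)"
  shows "ae_class N (\<lambda>y. rep A (T y)) \<in> hcarrier (L2_0 N)"
    and "AE y in N. rep (ae_class N (\<lambda>y. rep A (T y))) y = rep A (T y)"
proof -
  note r = L2_0_rep[OF N A]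
  have m[measurable]: "rep A \<in> borel_measurable N" using r(1) by (rule L2_funD)
  have rT: "(\<lambda>y. rep A (T y)) \<in> L2_fun N"
  proof -
    have "integrable (distr N N T) (\<lambda>y. (cmod (rep A y))\<^sup>2)" using L2_funD(2)[OF r(1)] by (simp add: dT)
    then have "integrable N (\<lambda>y. (cmod (rep A (T y)))\<^sup>2)" by (subst (asm) integrable_distr_eq) measurable
    then show ?thesis using measurable_compose[OF T m] by (simp add: L2_fun_def)
  qed
  have "(\<integral>y. rep A (T y) \<partial>N) = (\<integral>y. rep A y \<partial>distr N N T)"
    by (rule integral_distr[OF T m, symmetric])
  then have "(\<integral>y. rep A (T y) \<partial>N) = 0" by (simp add: dT r(2))
  then show "ae_class N (\<lambda>y. rep A (T y)) \<in> hcarrier (L2_0 N)" by (rule ae_class_L2_0[OF N rT])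
  show "AE y in N. rep (ae_class N (\<lambda>y. rep A (T y))) y = rep A (T y)"
    by (rule rep_ae_class(2)) (rule measurable_compose[OF T m])
qed

lemma tensor_eval_koopman:
  assumes N: "prob_space N" and T: "T \<in> N \<rightarrow>\<^sub>M N" and dT: "distr N N T = N"
    and \<pi>: "\<pi> = (\<lambda>A. ae_class N (\<lambda>y. rep A (T y)))" and u: "u \<in> hcarrier (L2_0_tensors N)"
  shows "map (map_prod \<pi> \<pi>) u \<in> hcarrier (L2_0_tensors N)"
    and "AE z in N \<Otimes>\<^sub>M N. tensor_eval (map (map_prod \<pi> \<pi>) u) z = tensor_eval u (map_prod T T z)"
proof -
  interpret N: prob_space N by fact
  show "map (map_prod \<pi> \<pi>) u \<in> hcarrier (L2_0_tensors N)"
    using u koopman_L2_0(1)[OF N T dT] unfolding L2_0_tensors_carrier \<pi> by (induction u) auto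
  show "AE z in N \<Otimes>\<^sub>M N. tensor_eval (map (map_prod \<pi> \<pi>) u) z = tensor_eval u (map_prod T T z)"
    using u unfolding L2_0_tensors_carrier
  proof (induction u)
    case (Cons a u)
    obtain A B where a: "a = (A, B)" by (cases a)
    have A: "A \<in> hcarrier (L2_0 N)" and B: "B \<in> hcarrier (L2_0 N)"
      using Cons.hyps a by auto
    have IH: "AE z in N \<Otimes>\<^sub>M N. tensor_eval (map (map_prod \<pi> \<pi>) u) z = tensor_eval u (map_prod T T z)"
      using Cons by simp
    show ?case
      using IH N.AE_pair_fst[OF koopman_L2_0(2)[OF N T dT A]] N.AE_pair_snd[OF koopman_L2_0(2)[OF N T dT B]]
      by eventually_elim (simp add: a \<pi>)
  qed simp
qed

definition centred_tensor :: "'a measure \<Rightarrow> (real \<times> 'a set \<times> 'a set) list \<Rightarrow> (('a \<Rightarrow> complex) set \<times> ('a \<Rightarrow> complex) set) list" where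
  "centred_tensor N = map (\<lambda>(r, A, B).
    (ae_class N (\<lambda>x. of_real (r * (indicator A x - measure N A))), ae_class N (\<lambda>y. of_real (indicator B y - measure N B))))"

lemma centred_indicator_L2_0:
  assumes N: "prob_space N" and A[measurable]: "A \<in> sets N"
  shows "ae_class N (\<lambda>x. of_real (r * (indicator A x - measure N A))) \<in> hcarrier (L2_0 N)"
    and "AE x in N. rep (ae_class N (\<lambda>x. of_real (r * (indicator A x - measure N A)))) x = of_real (r * (indicator A x - measure N A))"
proof -
  interpret N: prob_space N by fact
  let ?f = "\<lambda>x. r * (indicator A x - measure N A) :: real"
  have m: "(\<lambda>x. complex_of_real (?f x)) \<in> borel_measurable N" by measurable
  have bd: "\<bar>?f x\<bar> \<le> \<bar>r\<bar> * 2" for x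
  proof -
    have "\<bar>1 - p\<bar> \<le> 2 \<and> \<bar>0 - p\<bar> \<le> 2" if "0 \<le> p" "p \<le> 1" for p :: real using that by auto
    from this[OF measure_nonneg N.prob_le_1, of A] have "\<bar>indicator A x - measure N A\<bar> \<le> 2"
      by (cases "x \<in> A") simp_all
    then show ?thesis unfolding abs_mult by (intro mult_left_mono) simp_all
  qed
  have "integrable N (\<lambda>x. (cmod (complex_of_real (?f x)))\<^sup>2)"
  proof (rule N.integrable_const_bound[of _ "(\<bar>r\<bar> * 2)\<^sup>2"])
    have "(cmod (complex_of_real (?f x)))\<^sup>2 \<le> (\<bar>r\<bar> * 2)\<^sup>2" for x
      unfolding norm_of_real by (rule power_mono[OF bd]) simp
    then show "AE x in N. norm ((cmod (complex_of_real (?f x)))\<^sup>2) \<le> (\<bar>r\<bar> * 2)\<^sup>2" by (intro AE_I2) simp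
  qed measurable
  then have L2: "(\<lambda>x. complex_of_real (?f x)) \<in> L2_fun N" using m by (simp add: L2_fun_def)
  have "(\<integral>x. ?f x \<partial>N) = 0"
  proof -
    have "integrable N (indicator A :: 'a \<Rightarrow> real)" using A by (simp add: less_top[symmetric])
    then show ?thesis using A N.prob_space by (simp add: sets.Int_space_eq2)
  qed
  then have "(\<integral>x. complex_of_real (?f x) \<partial>N) = 0" by (simp only: integral_complex_of_real of_real_0)
  then show "ae_class N (\<lambda>x. of_real (?f x)) \<in> hcarrier (L2_0 N)" by (rule ae_class_L2_0[OF N L2])
  show "AE x in N. rep (ae_class N (\<lambda>x. of_real (?f x))) x = of_real (?f x)" by (rule rep_ae_class(2)[OF m])
qed

lemma centred_tensor:
  assumes N: "prob_space N" and l: "l \<in> rect_lists N N"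
  shows "centred_tensor N l \<in> hcarrier (L2_0_tensors N)"
    and "AE z in N \<Otimes>\<^sub>M N. tensor_eval (centred_tensor N l) z = of_real (centred N l z)"
proof -
  interpret N: prob_space N by fact
  note c = centred_indicator_L2_0[OF N]
  have c1: "ae_class N (\<lambda>x. of_real (indicator A x - measure N A)) \<in> hcarrier (L2_0 N)"
    "AE x in N. rep (ae_class N (\<lambda>x. of_real (indicator A x - measure N A))) x = of_real (indicator A x - measure N A)"
    if "A \<in> sets N" for A using c[OF that, of 1] by simp_all
  show "centred_tensor N l \<in> hcarrier (L2_0_tensors N)"
    using l
  proof (induction l)
    case (Cons a l)
    obtain r A B where a: "a = (r, A, B)" by (cases a)
    have A: "A \<in> sets N" and B: "B \<in> sets N" and l: "l \<in> rect_lists N N" using Cons.prems a by auto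
    have t: "centred_tensor N (a # l) = (ae_class N (\<lambda>x. of_real (r * (indicator A x - measure N A))),
        ae_class N (\<lambda>y. of_real (indicator B y - measure N B))) # centred_tensor N l"
      by (simp add: centred_tensor_def a)
    show ?case using Cons.IH[OF l] c(1)[OF A, of r] c1(1)[OF B] unfolding t L2_0_tensors_carrier
      by (simp del: of_real_mult of_real_diff)
  qed (simp add: centred_tensor_def L2_0_tensors_carrier)
  show "AE z in N \<Otimes>\<^sub>M N. tensor_eval (centred_tensor N l) z = of_real (centred N l z)"
    using l
  proof (induction l)
    case (Cons a l)
    obtain r A B where a: "a = (r, A, B)" by (cases a)
    have A: "A \<in> sets N" and B: "B \<in> sets N" and l: "l \<in> rect_lists N N" using Cons.prems a by auto
    have t: "centred_tensor N (a # l) = (ae_class N (\<lambda>x. of_real (r * (indicator A x - measure N A))),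
        ae_class N (\<lambda>y. of_real (indicator B y - measure N B))) # centred_tensor N l"
      by (simp add: centred_tensor_def a)
    show ?case
      using Cons.IH[OF l] N.AE_pair_fst[OF c(2)[OF A, of r]] N.AE_pair_snd[OF c1(2)[OF B]] unfolding t unfolding a
      by eventually_elim (simp only: tensor_eval_simps centred_simps complex_cnj_complex_of_real of_real_mult of_real_add)
  qed (simp add: centred_tensor_def)
qed

text \<open>The vectors \<open>\<xi> n\<close> are classes of constant sequences and represent the
  functions \<open>centred N (L n)\<close>. Under this identification the tensor representation
  becomes composition with a product map, so almost invariance can be read off in L2.\<close>

lemma amenable_koopmanI:
  fixes G :: "('g, 'm) monoid_scheme"
  assumes N: "prob_space N" and G: "group G"
    and \<psi>: "\<And>g. g \<in> carrier G \<Longrightarrow> \<psi> g \<in> N \<rightarrow>\<^sub>M N" "\<And>g. g \<in> carrier G \<Longrightarrow> distr N N (\<psi> g) = N"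
    and L: "\<And>n. L n \<in> rect_lists N N" "\<And>n. sqint (N \<Otimes>\<^sub>M N) (centred N (L n)) = 1"
    and inv: "\<And>g. g \<in> carrier G \<Longrightarrow>
      (\<lambda>n. sqint (N \<Otimes>\<^sub>M N) (\<lambda>z. centred N (L n) (map_prod (\<psi> g) (\<psi> g) z) - centred N (L n) z)) \<longlonglongrightarrow> 0"
  shows "amenable_rep G (L2_0 N) (koopman G N \<psi>)"
proof -
  interpret G: group G by fact
  let ?H = "tensor_hspace (L2_0 N) (conj_hspace (L2_0 N))"
  let ?\<rho> = "tensor_rep (L2_0 N) (koopman G N \<psi>) (conj_hspace (L2_0 N)) (koopman G N \<psi>)"
  let ?\<pi> = "koopman G N \<psi>"
  let ?V = "L2_0_tensors N" and ?P = "N \<Otimes>\<^sub>M N"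
  interpret hspace_model ?V ?P tensor_eval by (rule tensor_model[OF N])
  define \<xi> where "\<xi> n = hclass ?V (\<lambda>_. centred_tensor N (L n))" for n
  define F where "F n z = complex_of_real (centred N (L n) z)" for n z
  have [measurable]: "centred N (L n) \<in> borel_measurable ?P" for n using L(1) by auto
  have F[measurable]: "F n \<in> borel_measurable ?P" for n unfolding F_def by measurable
  have r: "represents (\<xi> n) (F n)" for n
    unfolding \<xi>_def by (rule represents_const) (use centred_tensor[OF N L(1)] F in \<open>auto simp: F_def\<close>)
  have unit: "hnorm ?H (\<xi> n) = 1" for n
    unfolding tensor_hspace_def represents_hnorm[OF r] unfolding F_def by (simp add: l2norm_of_real L)
  have lim: "(\<lambda>n. hnorm ?H (hdiff ?H
      (?\<rho> g (\<xi> n)) (\<xi> n))) \<longlonglongrightarrow> 0"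
    if g: "g \<in> carrier G" for g
  proof -
    \<comment> \<open>The Koopman representation composes with the inverse, so the hypothesis on
      \<open>L\<close> gets applied to the inverse of \<open>g\<close>.\<close>
    define T where "T = \<psi> (inv\<^bsub>G\<^esub> g)"
    have ig: "inv\<^bsub>G\<^esub> g \<in> carrier G" using g by simp
    have T[measurable]: "T \<in> N \<rightarrow>\<^sub>M N" and dT: "distr N N T = N" unfolding T_def using \<psi> ig by auto
    have TT[measurable]: "map_prod T T \<in> ?P \<rightarrow>\<^sub>M ?P" by (intro measurable_map_prod T)
    have dTT: "distr ?P ?P (map_prod T T) = ?P" by (rule distr_map_prod_preserving[OF N N T dT])
    have k: "koopman G N \<psi> g = (\<lambda>A. ae_class N (\<lambda>y. rep A (T y)))" by (simp add: koopman_def T_def fun_eq_iff)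
    have pres: "l2norm ?P (\<lambda>z. f (map_prod T T z)) = l2norm ?P f" if "f \<in> borel_measurable ?P" for f
    proof -
      have "(\<integral>z. (cmod (f z))\<^sup>2 \<partial>distr ?P ?P (map_prod T T)) = (\<integral>z. (cmod (f (map_prod T T z)))\<^sup>2 \<partial>?P)"
        by (rule integral_distr) (use that in measurable)
      then show ?thesis by (simp add: l2norm_def dTT)
    qed
    have L2T: "(\<lambda>z. f (map_prod T T z)) \<in> L2_fun ?P" if f: "f \<in> L2_fun ?P" for f
    proof -
      have "integrable (distr ?P ?P (map_prod T T)) (\<lambda>y. (cmod (f y))\<^sup>2)" using L2_funD(2)[OF f] by (simp add: dTT)
      then have "integrable ?P (\<lambda>y. (cmod (f (map_prod T T y)))\<^sup>2)"
        by (subst (asm) integrable_distr_eq) (use L2_funD(1)[OF f] in measurable)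
      then show ?thesis using measurable_compose[OF TT L2_funD(1)[OF f]] by (simp add: L2_fun_def)
    qed
    \<comment> \<open>\<open>rep (\<xi> n)\<close> is some sequence with limit \<open>F n\<close>,
      in general not the constant one. Its image converges because the product map preserves the L2
      norm.\<close>
    have rT: "represents (?\<rho> g (\<xi> n)) (\<lambda>z. F n (map_prod T T z))" for n
    proof -
      have R: "converges (rep (\<xi> n)) (F n)" by (rule represents_rep[OF r])
      then have Rc: "rep (\<xi> n) m \<in> hcarrier ?V" and FL: "F n \<in> L2_fun ?P" for m by (auto simp: converges_def)
      note tk = tensor_eval_koopman[OF N T dT k Rc]
      have "l2norm ?P (\<lambda>z. tensor_eval (map (map_prod (?\<pi> g) (?\<pi> g)) (rep (\<xi> n) m)) z - F n (map_prod T T z)) =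
          l2norm ?P (\<lambda>z. tensor_eval (rep (\<xi> n) m) z - F n z)" for m
      proof -
        have "l2norm ?P (\<lambda>z. tensor_eval (map (map_prod (?\<pi> g) (?\<pi> g)) (rep (\<xi> n) m)) z - F n (map_prod T T z)) =
            l2norm ?P (\<lambda>z. tensor_eval (rep (\<xi> n) m) (map_prod T T z) - F n (map_prod T T z))"
        proof (rule l2norm_cong_AE)
          show "AE z in ?P. tensor_eval (map (map_prod (?\<pi> g) (?\<pi> g)) (rep (\<xi> n) m)) z - F n (map_prod T T z) =
              tensor_eval (rep (\<xi> n) m) (map_prod T T z) - F n (map_prod T T z)"
            using tk(2)[of m] by eventually_elim simp
        qed (intro L2_funD(1) L2_fun_diff model_L2 tk(1) L2T FL Rc)+
        also have "\<dots> = l2norm ?P (\<lambda>z. tensor_eval (rep (\<xi> n) m) z - F n z)"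
          by (rule pres) (intro L2_funD(1) L2_fun_diff model_L2 FL Rc)
        finally show ?thesis .
      qed
      then have "converges (\<lambda>m. map (map_prod (?\<pi> g) (?\<pi> g)) (rep (\<xi> n) m)) (\<lambda>z. F n (map_prod T T z))"
        using R tk(1) L2T[OF FL] by (simp add: converges_def)
      then show ?thesis unfolding tensor_rep_def by (rule converges_hclass)
    qed
    have "hnorm ?H (hdiff ?H
      (?\<rho> g (\<xi> n)) (\<xi> n)) =
      sqrt (enn2real (sqint ?P (\<lambda>z. centred N (L n) (map_prod T T z) - centred N (L n) z)))" for n
    proof -
      have "l2norm ?P (\<lambda>z. F n (map_prod T T z) - F n z) = l2norm ?P (\<lambda>z. of_real (centred N (L n) (map_prod T T z) - centred N (L n) z))"
        by (simp add: F_def)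
      also have "\<dots> = sqrt (enn2real (sqint ?P (\<lambda>z. centred N (L n) (map_prod T T z) - centred N (L n) z)))"
        by (rule l2norm_of_real) measurable
      finally show ?thesis unfolding tensor_hspace_def represents_hdiff[OF rT r] .
    qed
    moreover have "(\<lambda>n. sqrt (enn2real (sqint ?P (\<lambda>z. centred N (L n) (map_prod T T z) - centred N (L n) z)))) \<longlonglongrightarrow> sqrt (enn2real 0)"
      using inv[OF ig] unfolding T_def by (intro tendsto_real_sqrt tendsto_enn2real) auto
    ultimately show ?thesis by simp
  qed
  have "\<xi> n \<in> hcarrier ?H" for n
    unfolding tensor_hspace_def by (rule represents_carrier[OF r])
  then show ?thesis unfolding amenable_rep_def spectral_gap_def using unit lim by blast
qed

section \<open>Modular actions\<close>

text \<open>The factor map is measurable for the completed measure, so the action has to be carried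
  over to the completion.\<close>

lemma completion_preserving:
  assumes T[measurable]: "T \<in> M \<rightarrow>\<^sub>M M" and dT: "distr M M T = M"
  shows "T \<in> completion M \<rightarrow>\<^sub>M completion M" "distr (completion M) (completion M) T = completion M"
proof -
  have T': "T \<in> completion M \<rightarrow>\<^sub>M M" by (rule measurable_completion[OF T])
  have d: "distr (completion M) M T = M" by (simp add: distr_completion[OF T] dT)
  show "T \<in> completion M \<rightarrow>\<^sub>M completion M" by (rule completion.measurable_completion2[OF T']) (simp add: d)
  show "distr (completion M) (completion M) T = completion M"
    using completion.completion_distr_eq[OF T'] by (simp add: d)
qed

lemma prob_space_completion_measure:
  assumes "prob_space M"
  shows "prob_space (completion M)"
proof
  interpret prob_space M by fact
  show "emeasure (completion M) (space (completion M)) = 1"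
    by (simp add: emeasure_space_1)
qed

text \<open>If the set were null or of full measure, \<open>r\<close> would have a constant sign
  almost everywhere, and mean zero would then make it vanish.\<close>

lemma (in prob_space) positive_part_nontrivial:
  fixes r :: "'a \<Rightarrow> real"
  assumes i: "integrable M r" and 0: "expectation r = 0" and n: "\<not> (AE x in M. r x = 0)"
  shows "0 < prob {x \<in> space M. r x > 0}" "prob {x \<in> space M. r x > 0} < 1"
proof -
  have [measurable]: "r \<in> borel_measurable M" using i by auto
  have pos: False if "AE x in M. r x \<ge> 0"
    using integral_nonneg_eq_0_iff_AE[OF i that] 0 n by simp
  have neg: False if "AE x in M. r x \<le> 0"
  proof -
    have "AE x in M. - r x \<ge> 0" using that by eventually_elim simp
    then have "AE x in M. - r x = 0"
      using integral_nonneg_eq_0_iff_AE[of M "\<lambda>x. - r x"] i 0 by simp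
    then show False using n by simp
  qed
  show "0 < prob {x \<in> space M. r x > 0}"
  proof (rule ccontr)
    assume "\<not> ?thesis"
    then have "prob {x \<in> space M. r x > 0} = 0" by (simp add: zero_less_measure_iff)
    then have "{x \<in> space M. r x > 0} \<in> null_sets M" by (simp add: null_sets_def emeasure_eq_measure)
    then have "AE x in M. x \<notin> {x \<in> space M. r x > 0}" by (rule AE_not_in)
    then have "AE x in M. r x \<le> 0" using AE_space by eventually_elim auto
    then show False by (rule neg)
  qed
  show "prob {x \<in> space M. r x > 0} < 1"
  proof (rule ccontr)
    assume "\<not> ?thesis"
    then have "prob {x \<in> space M. r x > 0} = 1" using prob_le_1 by (simp add: antisym)
    then have "AE x in M. r x > 0" by (subst (asm) prob_Collect_eq_1) auto
    then have "AE x in M. r x \<ge> 0" by eventually_elim simp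
    then show False by (rule pos)
  qed
qed

text \<open>For a one-point factor the mean-zero part is zero; it has no unit vectors, so its
  representation counts as not amenable. A nonzero vector excludes this case and, through the sign
  of its real or imaginary part, provides the set that splits the factor.\<close>

lemma L2_0_nontrivial_set:
  assumes N: "prob_space N" and "hcarrier (L2_0 N) \<noteq> {hzero (L2_0 N)}"
  obtains A where "A \<in> sets N" "0 < measure N A" "measure N A < 1"
proof -
  interpret prob_space N by fact
  have z: "hzero (L2_0 N) = ae_class N (\<lambda>_. 0)" by (simp add: L2_0_def L2_def)
  have "ae_class N (\<lambda>_. 0) \<in> hcarrier (L2_0 N)" by (rule ae_class_L2_0[OF N]) (auto simp: L2_fun_def)
  then obtain B where B: "B \<in> hcarrier (L2_0 N)" "B \<noteq> ae_class N (\<lambda>_. 0)" using assms(2) unfolding z by blast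
  note r = L2_0_rep[OF N B(1)]
  have m[measurable]: "rep B \<in> borel_measurable N" by (rule L2_funD[OF r(1)])
  have i: "integrable N (rep B)" 
  proof -
    have "integrable N (\<lambda>x. cmod (rep B x))"
      by (rule square_integrable_imp_integrable[OF _ L2_funD(2)[OF r(1)]]) measurable
    then show ?thesis using m by (simp add: integrable_norm_iff)
  qed
  have "\<not> (AE x in N. rep B x = 0)"
  proof
    assume 0: "AE x in N. rep B x = 0"
    obtain f where f: "f \<in> L2_fun N" "B = ae_class N f" using B(1) by (auto simp: L2_0_carrier_iff[OF N])
    have f0: "AE x in N. f x = 0" using 0 rep_ae_class(2)[OF L2_funD(1)[OF f(1)]] unfolding f(2) by eventually_elim simp
    have "(AE x in N. f x = g x) \<longleftrightarrow> (AE x in N. 0 = g x)" for g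
    proof
      show "AE x in N. 0 = g x" if "AE x in N. f x = g x" using that f0 by eventually_elim simp
      show "AE x in N. f x = g x" if "AE x in N. 0 = g x" using that f0 by eventually_elim simp
    qed
    then have "ae_class N f = ae_class N (\<lambda>_. 0)" unfolding ae_class_def by simp
    then show False using B(2) f(2) by simp
  qed
  then have "\<not> (AE x in N. Re (rep B x) = 0) \<or> \<not> (AE x in N. Im (rep B x) = 0)"
  proof (rule contrapos_np)
    assume "\<not> (\<not> (AE x in N. Re (rep B x) = 0) \<or> \<not> (AE x in N. Im (rep B x) = 0))"
    then have "AE x in N. Re (rep B x) = 0" "AE x in N. Im (rep B x) = 0" by auto
    then show "AE x in N. rep B x = 0" by eventually_elim (simp add: complex_eq_iff)
  qed
  then show thesis
  proof
    assume "\<not> (AE x in N. Re (rep B x) = 0)"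
    then show thesis using positive_part_nontrivial[OF integrable_Re[OF i]] r(2) that[of "{x \<in> space N. Re (rep B x) > 0}"]
      integral_Re[OF i] by simp
  next
    assume "\<not> (AE x in N. Im (rep B x) = 0)"
    then show thesis using positive_part_nontrivial[OF integrable_Im[OF i]] r(2) that[of "{x \<in> space N. Im (rep B x) > 0}"]
      integral_Im[OF i] by simp
  qed
qed

section \<open>Labels from a homomorphism to a modular action\<close>

lemma orbit_hom_witness:
  assumes act: "group_action G E \<phi>" and actD: "group_action D (space Z) \<zeta>"
    and X0: "X0 \<subseteq> E" and inv: "\<forall>g\<in>carrier G. \<phi> g ` X0 = X0" and sp: "space M0 = X0"
    and hom: "map_prod \<alpha> \<alpha> ` orbit_eqrel G M0 (\<lambda>g. restrict (\<phi> g) X0) \<subseteq> orbit_eqrel D Z \<zeta>"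
    and x: "x \<in> X0" and g: "g \<in> carrier G"
  shows "\<exists>d\<in>carrier D. \<alpha> (\<phi> g x) = \<zeta> d (\<alpha> x)"
proof -
  interpret A: group_action G E \<phi> by fact
  interpret group G using A.group_hom group_hom.axioms(1) by auto
  interpret D: group_action D "space Z" \<zeta> by fact
  have gx: "\<phi> g x \<in> X0" using inv x g by blast
  have "Group_Action.orbit G (\<lambda>g. restrict (\<phi> g) X0) x = Group_Action.orbit G (\<lambda>g. restrict (\<phi> g) X0) (\<phi> g x)"
  proof -
    have "\<exists>k\<in>carrier G. \<phi> h x = \<phi> k (\<phi> g x)" if h: "h \<in> carrier G" for h
    proof (intro bexI)
      have "\<phi> (h \<otimes>\<^bsub>G\<^esub> inv\<^bsub>G\<^esub> g) (\<phi> g x) = \<phi> (h \<otimes>\<^bsub>G\<^esub> inv\<^bsub>G\<^esub> g \<otimes>\<^bsub>G\<^esub> g) x"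
        using A.composition_rule[of x "h \<otimes>\<^bsub>G\<^esub> inv\<^bsub>G\<^esub> g" g] x X0 h g by auto
      also have "h \<otimes>\<^bsub>G\<^esub> inv\<^bsub>G\<^esub> g \<otimes>\<^bsub>G\<^esub> g = h" using h g by (simp add: m_assoc)
      finally show "\<phi> h x = \<phi> (h \<otimes>\<^bsub>G\<^esub> inv\<^bsub>G\<^esub> g) (\<phi> g x)" by simp
    qed (use h g in simp)
    moreover have "\<exists>k\<in>carrier G. \<phi> h (\<phi> g x) = \<phi> k x" if h: "h \<in> carrier G" for h
      using A.composition_rule[of x h g] x X0 h g by (intro bexI[of _ "h \<otimes>\<^bsub>G\<^esub> g"]) auto
    ultimately show ?thesis using x gx unfolding Group_Action.orbit_def by simp blast
  qed
  then have "(x, \<phi> g x) \<in> orbit_eqrel G M0 (\<lambda>g. restrict (\<phi> g) X0)"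
    using x gx sp by (simp add: orbit_eqrel_def)
  then have "(\<alpha> x, \<alpha> (\<phi> g x)) \<in> orbit_eqrel D Z \<zeta>" using hom by force
  then have "\<alpha> (\<phi> g x) \<in> space Z" "Group_Action.orbit D \<zeta> (\<alpha> x) = Group_Action.orbit D \<zeta> (\<alpha> (\<phi> g x))"
    by (auto simp: orbit_eqrel_def)
  then have "\<alpha> (\<phi> g x) \<in> Group_Action.orbit D \<zeta> (\<alpha> x)" using D.orbit_refl by simp
  then show ?thesis unfolding Group_Action.orbit_def by auto
qed

text \<open>\<open>X0\<close> is only measurable for the completed measure, so the labels are built
  on an invariant conull Borel subset \<open>X2\<close> of it, with a default value elsewhere. The
  conclusion is about the completion because the factor map is measurable there.\<close>

lemma modular_hom_labels:
  fixes G :: "('g, 'm) monoid_scheme" and \<mu> :: "'x measure" and D :: "('d, 'n) monoid_scheme" and Z :: "'z measure"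
  assumes pmp: "pmp_action G \<mu> \<phi>"
    and X0: "X0 \<in> sets (completion \<mu>)" "emeasure (completion \<mu>) X0 = 1" "\<forall>g\<in>carrier G. \<phi> g ` X0 = X0"
    and mod: "modular_action D Z \<zeta>"
    and hom: "countable_to_one_borel_hom (restrict_space \<mu> X0)
      (orbit_eqrel G (restrict_space \<mu> X0) (\<lambda>g. restrict (\<phi> g) X0)) Z (orbit_eqrel D Z \<zeta>) \<alpha>"
  obtains c :: "nat \<Rightarrow> 'x \<Rightarrow> nat list \<times> nat" where
    "refining_labels (completion \<mu>) c"
    "\<And>A. A \<in> sets (completion \<mu>) \<Longrightarrow> refining_labels.approximable (completion \<mu>) c A"
    "\<And>g. g \<in> carrier G \<Longrightarrow> refining_labels.label_compatible (completion \<mu>) c (\<phi> g)"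
proof -
  have sb: "standard_borel \<mu>" and pr: "prob_space \<mu>" and act: "group_action G (space \<mu>) \<phi>"
    and cG: "countable (carrier G)" and \<phi>m: "\<And>g. g \<in> carrier G \<Longrightarrow> \<phi> g \<in> \<mu> \<rightarrow>\<^sub>M \<mu>"
    and \<phi>d: "\<And>g. g \<in> carrier G \<Longrightarrow> distr \<mu> \<mu> (\<phi> g) = \<mu>"
    using pmp by (auto simp: pmp_action_def borel_action_def)
  interpret prob_space \<mu> by fact
  interpret A: group_action G "space \<mu>" \<phi> by fact
  interpret group G using A.group_hom group_hom.axioms(1) by auto
  have actD: "group_action D (space Z) \<zeta>" and cD: "countable (carrier D)"
    and \<zeta>m: "\<And>d. d \<in> carrier D \<Longrightarrow> \<zeta> d \<in> Z \<rightarrow>\<^sub>M Z"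
    using mod by (auto simp: modular_action_def borel_action_def)
  interpret D: group_action D "space Z" \<zeta> by fact
  interpret DG: group D using D.group_hom group_hom.axioms(1) by auto
  obtain P :: "nat \<Rightarrow> 'z set set" where P: "\<And>n. partition_on (space Z) (P n)" "\<And>n. countable (P n)" "\<And>n. P n \<subseteq> sets Z"
    and Pinv: "\<And>n d A. d \<in> carrier D \<Longrightarrow> A \<in> P n \<Longrightarrow> \<zeta> d ` A \<in> P n"
    and Psep: "\<And>z z'. z \<in> space Z \<Longrightarrow> z' \<in> space Z \<Longrightarrow> z \<noteq> z' \<Longrightarrow> \<exists>n. \<exists>A\<in>P n. z \<in> A \<and> z' \<notin> A"
    using mod unfolding modular_action_def by metis
  have X0s: "X0 \<subseteq> space \<mu>" using sets.sets_into_space[OF X0(1)] by simp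
  have sp0: "space (restrict_space \<mu> X0) = X0" using X0s by (auto simp: space_restrict_space)
  have \<alpha>m: "\<alpha> \<in> restrict_space \<mu> X0 \<rightarrow>\<^sub>M Z" and \<alpha>c: "\<And>z. z \<in> space Z \<Longrightarrow> countable (\<alpha> -` {z} \<inter> X0)"
    and \<alpha>h: "map_prod \<alpha> \<alpha> ` orbit_eqrel G (restrict_space \<mu> X0) (\<lambda>g. restrict (\<phi> g) X0) \<subseteq> orbit_eqrel D Z \<zeta>"
    using hom unfolding countable_to_one_borel_hom_def sp0 by auto
  have \<alpha>s: "\<alpha> x \<in> space Z" if "x \<in> X0" for x using measurable_space[OF \<alpha>m] that sp0 by auto
  define X1 where "X1 = main_part \<mu> X0"
  have X1[measurable]: "X1 \<in> sets \<mu>" unfolding X1_def using X0(1) by (rule main_part_sets)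
  have X10: "X1 \<subseteq> X0" unfolding X1_def using main_part_null_part_Un[OF X0(1)] by auto
  have "emeasure \<mu> X1 = 1" using X0(1,2) by (simp add: X1_def)
  then have X1ae: "AE x in \<mu>. x \<in> X1" by (intro AE_prob_1) (simp add: emeasure_eq_measure)
  \<comment> \<open>The largest invariant subset of the Borel set \<open>X1\<close>. It is Borel and
    conull because the group is countable.\<close>
  define X2 where "X2 = {x \<in> space \<mu>. \<forall>g\<in>carrier G. \<phi> g x \<in> X1}"
  have gm: "{x \<in> space \<mu>. \<phi> g x \<in> X1} \<in> sets \<mu>" if "g \<in> carrier G" for g
    using measurable_sets[OF \<phi>m[OF that] X1] by (simp add: vimage_def Int_def conj_commute)
  have X2[measurable]: "X2 \<in> sets \<mu>"
  proof -
    have "X2 = (\<Inter>g\<in>carrier G. {x \<in> space \<mu>. \<phi> g x \<in> X1})" unfolding X2_def by blast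
    moreover have "carrier G \<noteq> {}" by blast
    moreover have "(\<lambda>g. {x \<in> space \<mu>. \<phi> g x \<in> X1}) ` carrier G \<subseteq> sets \<mu>" using gm by blast
    ultimately show ?thesis using sets.countable_INT'[OF cG] by simp
  qed
  have X2ae: "AE x in \<mu>. x \<in> X2"
  proof -
    have "AE x in \<mu>. \<phi> g x \<in> X1" if g: "g \<in> carrier G" for g
    proof -
      have "AE x in distr \<mu> \<mu> (\<phi> g). x \<in> X1" unfolding \<phi>d[OF g] by (rule X1ae)
      then show ?thesis by (rule AE_distrD[OF \<phi>m[OF g]])
    qed
    then have "AE x in \<mu>. \<forall>g\<in>carrier G. \<phi> g x \<in> X1" using cG by (simp add: AE_ball_countable)
    then show ?thesis using AE_space by eventually_elim (simp add: X2_def)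
  qed
  have \<phi>s: "\<phi> g x \<in> space \<mu>" if "g \<in> carrier G" "x \<in> space \<mu>" for g x using A.element_image that by blast
  have X2g: "\<phi> g x \<in> X2 \<longleftrightarrow> x \<in> X2" if g: "g \<in> carrier G" and x: "x \<in> space \<mu>" for g x
  proof
    assume X: "x \<in> X2"
    show "\<phi> g x \<in> X2" unfolding X2_def
    proof (intro CollectI conjI ballI)
      fix h assume h: "h \<in> carrier G"
      have "\<phi> h (\<phi> g x) = \<phi> (h \<otimes>\<^bsub>G\<^esub> g) x" using A.composition_rule[OF x h g] by simp
      then show "\<phi> h (\<phi> g x) \<in> X1" using X h g by (simp add: X2_def)
    qed (rule \<phi>s[OF g x])
  next
    assume X: "\<phi> g x \<in> X2"
    show "x \<in> X2" unfolding X2_def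
    proof (intro CollectI conjI ballI)
      fix h assume h: "h \<in> carrier G"
      have "\<phi> (h \<otimes>\<^bsub>G\<^esub> inv\<^bsub>G\<^esub> g) (\<phi> g x) = \<phi> (h \<otimes>\<^bsub>G\<^esub> inv\<^bsub>G\<^esub> g \<otimes>\<^bsub>G\<^esub> g) x"
        using A.composition_rule[of x "h \<otimes>\<^bsub>G\<^esub> inv\<^bsub>G\<^esub> g" g] x h g by simp
      also have "h \<otimes>\<^bsub>G\<^esub> inv\<^bsub>G\<^esub> g \<otimes>\<^bsub>G\<^esub> g = h" using h g by (simp add: m_assoc)
      finally have "\<phi> (h \<otimes>\<^bsub>G\<^esub> inv\<^bsub>G\<^esub> g) (\<phi> g x) = \<phi> h x" .
      moreover have "h \<otimes>\<^bsub>G\<^esub> inv\<^bsub>G\<^esub> g \<in> carrier G" using h g by simp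
      ultimately show "\<phi> h x \<in> X1" using X unfolding X2_def by (metis (mono_tags, lifting) mem_Collect_eq)
    qed (rule x)
  qed
  have X20: "x \<in> X0" if "x \<in> X2" for x
  proof -
    have "\<phi> \<one>\<^bsub>G\<^esub> x = x" using that A.id_eq_one by (metis (no_types, lifting) X2_def mem_Collect_eq restrict_apply)
    then have "x \<in> X1" using that one_closed unfolding X2_def by force
    then show ?thesis using X10 by blast
  qed
  have X2s: "x \<in> space \<mu>" if "x \<in> X2" for x using that by (simp add: X2_def)
  have pre: "{x \<in> X2. \<alpha> x \<in> B} \<in> sets \<mu>" if B: "B \<in> sets Z" for B
  proof -
    have "\<alpha> -` B \<inter> X0 \<in> sets (restrict_space \<mu> X0)" using measurable_sets[OF \<alpha>m B] by (simp add: sp0)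
    then obtain S where S: "S \<in> sets \<mu>" "\<alpha> -` B \<inter> X0 = X0 \<inter> S" by (auto simp: sets_restrict_space)
    have "{x \<in> X2. \<alpha> x \<in> B} = X2 \<inter> S" using X20 S(2) by blast
    then show ?thesis using S(1) by simp
  qed
  define cls where "cls n z = (SOME A. A \<in> P n \<and> z \<in> A)" for n z
  have cls: "cls n z \<in> P n \<and> z \<in> cls n z" if "z \<in> space Z" for n z
  proof -
    have "\<exists>A. A \<in> P n \<and> z \<in> A" using P(1)[of n] that by (auto simp: partition_on_def)
    then show ?thesis unfolding cls_def by (rule someI_ex)
  qed
  have cls_eq: "cls n z = A" if "A \<in> P n" "z \<in> A" for n z A
  proof -
    have z: "z \<in> space Z" using that P(1)[of n] by (auto simp: partition_on_def)
    show ?thesis using cls[OF z, of n] that P(1)[of n] by (auto simp: partition_on_def disjoint_def)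
  qed
  \<comment> \<open>\<open>Suc\<close> reserves the label 0 for points outside
    \<open>X2\<close>.\<close>
  define a where "a x n = (if x \<in> X2 then Suc (to_nat_on (P n) (cls n (\<alpha> x))) else 0)" for x n
  have a_eq: "a x n = a y n \<longleftrightarrow> cls n (\<alpha> x) = cls n (\<alpha> y)" if "x \<in> X2" "y \<in> X2" for x y n
    using that cls[OF \<alpha>s[OF X20[OF that(1)]], of n] cls[OF \<alpha>s[OF X20[OF that(2)]], of n] P(2)[of n]
    by (auto simp: a_def)
  have am: "(\<lambda>x. a x n) \<in> \<mu> \<rightarrow>\<^sub>M count_space UNIV" for n
  proof -
    have "(\<lambda>x. a x n) -` {j} \<inter> space \<mu> \<in> sets \<mu>" for j
    proof (cases j)
      case 0
      have "(\<lambda>x. a x n) -` {j} \<inter> space \<mu> = space \<mu> - X2" by (auto simp: a_def 0 split: if_splits)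
      then show ?thesis by simp
    next
      case (Suc k)
      have "(\<lambda>x. a x n) -` {j} \<inter> space \<mu> = (\<Union>A\<in>{A \<in> P n. to_nat_on (P n) A = k}. {x \<in> X2. \<alpha> x \<in> A})"
      proof (intro equalityI subsetI)
        fix x assume "x \<in> (\<lambda>x. a x n) -` {j} \<inter> space \<mu>"
        then have x: "x \<in> X2" "to_nat_on (P n) (cls n (\<alpha> x)) = k" by (auto simp: a_def Suc split: if_splits)
        then show "x \<in> (\<Union>A\<in>{A \<in> P n. to_nat_on (P n) A = k}. {x \<in> X2. \<alpha> x \<in> A})"
          using cls[OF \<alpha>s[OF X20[OF x(1)]], of n] by blast
      next
        fix x assume "x \<in> (\<Union>A\<in>{A \<in> P n. to_nat_on (P n) A = k}. {x \<in> X2. \<alpha> x \<in> A})"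
        then obtain A where "A \<in> P n" "to_nat_on (P n) A = k" "x \<in> X2" "\<alpha> x \<in> A" by blast
        then show "x \<in> (\<lambda>x. a x n) -` {j} \<inter> space \<mu>" using cls_eq X2s by (auto simp: a_def Suc)
      qed
      also have "\<dots> \<in> sets \<mu>"
      proof (rule sets.countable_UN'')
        show "countable {A \<in> P n. to_nat_on (P n) A = k}" by (rule countable_subset[OF _ P(2)[of n]]) auto
      qed (use pre P(3) in auto)
      finally show ?thesis .
    qed
    then show ?thesis by (simp add: measurable_count_space_eq2_countable)
  qed
  \<comment> \<open>The partitions separate points, so equal label sequences on \<open>X2\<close>
    mean equal values of \<open>\<alpha>\<close>, whose fibres are countable.\<close>
  have fib: "countable {x \<in> X2. a x = z}" for z
  proof (cases "{x \<in> X2. a x = z} = {}")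
    case False
    then obtain x0 where x0: "x0 \<in> X2" "a x0 = z" by blast
    have "\<alpha> x = \<alpha> x0" if x: "x \<in> X2" "a x = z" for x
    proof (rule ccontr)
      assume "\<alpha> x \<noteq> \<alpha> x0"
      then obtain n A where A: "A \<in> P n" "\<alpha> x \<in> A" "\<alpha> x0 \<notin> A"
        using Psep \<alpha>s X20 x(1) x0(1) by meson
      have "a x n = a x0 n" using x(2) x0(2) by simp
      then have "cls n (\<alpha> x) = cls n (\<alpha> x0)" using a_eq x(1) x0(1) by blast
      then have "cls n (\<alpha> x0) = A" using cls_eq[OF A(1,2)] by simp
      then show False using cls[OF \<alpha>s[OF X20[OF x0(1)]], of n] A(3) by simp
    qed
    then have "{x \<in> X2. a x = z} \<subseteq> \<alpha> -` {\<alpha> x0} \<inter> X0" using X20 by auto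
    then show ?thesis by (rule countable_subset) (rule \<alpha>c[OF \<alpha>s[OF X20[OF x0(1)]]])
  next
    case True
    then show ?thesis by (simp only: countable_empty)
  qed
  obtain i :: "'x \<Rightarrow> nat" where im[measurable]: "i \<in> \<mu> \<rightarrow>\<^sub>M count_space UNIV"
    and rl0: "refining_labels \<mu> (\<lambda>n x. (map (a x) [0..<n], i x))"
    and ap0: "\<And>A. A \<in> sets \<mu> \<Longrightarrow> refining_labels.approximable \<mu> (\<lambda>n x. (map (a x) [0..<n], i x)) A"
    by (rule countable_fibres_partition[OF sb pr am X2 X2ae fib]) blast
  define c where "c = (\<lambda>n x. (map (a x) [0..<n], i x))"
  interpret R: refining_labels \<mu> c using rl0 by (simp add: c_def)
  let ?M = "completion \<mu>"
  have pM: "prob_space ?M" by (rule prob_space_completion_measure[OF pr])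
  have rl: "refining_labels ?M c"
  proof (intro refining_labels.intro refining_labels_axioms.intro pM)
    show "c n \<in> ?M \<rightarrow>\<^sub>M count_space UNIV" for n by (rule measurable_completion) simp
  qed (rule R.c_refine)
  interpret C: refining_labels ?M c by (rule rl)
  show thesis
  proof (rule that[OF rl])
    fix A assume A: "A \<in> sets ?M"
    define A1 where "A1 = main_part \<mu> A"
    have A1[measurable]: "A1 \<in> sets \<mu>" unfolding A1_def using A by (rule main_part_sets)
    have ae: "AE x in \<mu>. x \<in> A1 \<longleftrightarrow> x \<in> A" unfolding A1_def by (rule AE_in_main_part[OF A])
    have "R.approximable A1" using ap0[OF A1] by (simp add: c_def)
    have "C.err A1 n S = R.err A1 n S" for n S
    proof -
      have "{x \<in> space \<mu>. (x \<in> A1) \<noteq> (c n x \<in> S)} \<in> sets \<mu>" by measurable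
      then show ?thesis unfolding C.err_def R.err_def by simp
    qed
    then have "C.approximable A1" using \<open>R.approximable A1\<close> unfolding C.approximable_def R.approximable_def by simp
    then show "C.approximable A"
      by (rule C.approximable_cong_AE) (use A A1 ae in \<open>auto simp: AE_completion_iff\<close>)
  next
    fix g assume g: "g \<in> carrier G"
    have neD: "carrier D \<noteq> {}" by blast
    define \<delta> where "\<delta> = from_nat_into (carrier D)"
    have \<delta>: "\<delta> k \<in> carrier D" for k unfolding \<delta>_def by (rule from_nat_into[OF neD])
    \<comment> \<open>Equality of \<open>\<alpha> (\<phi> g x)\<close> and
      \<open>\<zeta> (\<delta> k) (\<alpha> x)\<close> is expressed through the countably many
      separating pieces, which makes it measurable in \<open>x\<close>. Off \<open>X2\<close> both
      memberships fail and \<open>Q k x\<close> holds for every \<open>k\<close>.\<close>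
    define Q where "Q k x \<longleftrightarrow> (\<forall>n. \<forall>A\<in>P n. (x \<in> {x \<in> X2. \<alpha> (\<phi> g x) \<in> A}) = (x \<in> {x \<in> X2. \<zeta> (\<delta> k) (\<alpha> x) \<in> A}))" for k x
    have U: "{x \<in> X2. \<alpha> (\<phi> g x) \<in> A} \<in> sets \<mu>" if "A \<in> P n" for A n
    proof -
      have "{x \<in> X2. \<alpha> (\<phi> g x) \<in> A} = \<phi> g -` {x \<in> X2. \<alpha> x \<in> A} \<inter> space \<mu>"
        using X2g[OF g] X2s by auto
      then show ?thesis using measurable_sets[OF \<phi>m[OF g] pre[of A]] that P(3) by auto
    qed
    have V: "{x \<in> X2. \<zeta> (\<delta> k) (\<alpha> x) \<in> A} \<in> sets \<mu>" if "A \<in> P n" for A n k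
    proof -
      have "\<zeta> (\<delta> k) -` A \<inter> space Z \<in> sets Z" using measurable_sets[OF \<zeta>m[OF \<delta>]] that P(3) by blast
      moreover have "{x \<in> X2. \<zeta> (\<delta> k) (\<alpha> x) \<in> A} = {x \<in> X2. \<alpha> x \<in> \<zeta> (\<delta> k) -` A \<inter> space Z}"
        using \<alpha>s X20 by auto
      ultimately show ?thesis using pre by (simp only:)
    qed
    have [measurable]: "Measurable.pred \<mu> (Q k)" for k
    proof -
      have "Measurable.pred \<mu> (\<lambda>x. (x \<in> {x \<in> X2. \<alpha> (\<phi> g x) \<in> A}) = (x \<in> {x \<in> X2. \<zeta> (\<delta> k) (\<alpha> x) \<in> A}))"
        if A: "A \<in> P n" for A n
      proof -
        note [measurable] = U[OF A] V[OF A]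
        show ?thesis by (rule measurable_label_eq) measurable
      qed
      then have "{x \<in> space \<mu>. (x \<in> {x \<in> X2. \<alpha> (\<phi> g x) \<in> A}) = (x \<in> {x \<in> X2. \<zeta> (\<delta> k) (\<alpha> x) \<in> A})} \<in> sets \<mu>"
        if "A \<in> P n" for A n using that unfolding pred_def by blast
      then have "space \<mu> - (\<Union>A\<in>P n. space \<mu> - {x \<in> space \<mu>. (x \<in> {x \<in> X2. \<alpha> (\<phi> g x) \<in> A}) = (x \<in> {x \<in> X2. \<zeta> (\<delta> k) (\<alpha> x) \<in> A})}) \<in> sets \<mu>" for n
        by (intro sets.Diff sets.top sets.countable_UN'' P(2))
      also have "space \<mu> - (\<Union>A\<in>P n. space \<mu> - {x \<in> space \<mu>. (x \<in> {x \<in> X2. \<alpha> (\<phi> g x) \<in> A}) = (x \<in> {x \<in> X2. \<zeta> (\<delta> k) (\<alpha> x) \<in> A})}) =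
          {x \<in> space \<mu>. \<forall>A\<in>P n. (x \<in> {x \<in> X2. \<alpha> (\<phi> g x) \<in> A}) = (x \<in> {x \<in> X2. \<zeta> (\<delta> k) (\<alpha> x) \<in> A})}" for n
        by blast
      finally have "Measurable.pred \<mu> (\<lambda>x. \<forall>A\<in>P n. (x \<in> {x \<in> X2. \<alpha> (\<phi> g x) \<in> A}) = (x \<in> {x \<in> X2. \<zeta> (\<delta> k) (\<alpha> x) \<in> A}))" for n
        unfolding pred_def .
      then show ?thesis unfolding Q_def by (rule pred_intros_countable(1))
    qed
    have Qeq: "Q k x \<longleftrightarrow> \<alpha> (\<phi> g x) = \<zeta> (\<delta> k) (\<alpha> x)" if x: "x \<in> X2" for k x
    proof -
      have s1: "\<alpha> (\<phi> g x) \<in> space Z" using \<alpha>s X20 X2g[OF g] x X2s by blast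
      have s2: "\<zeta> (\<delta> k) (\<alpha> x) \<in> space Z" using measurable_space[OF \<zeta>m[OF \<delta>]] \<alpha>s X20 x by blast
      show ?thesis unfolding Q_def using Psep[OF s1 s2] x by auto
    qed
    have Qex: "\<exists>k. Q k x" if x: "x \<in> X2" for x
    proof -
      obtain d where d: "d \<in> carrier D" "\<alpha> (\<phi> g x) = \<zeta> d (\<alpha> x)"
        using orbit_hom_witness[OF act actD X0s X0(3) sp0 \<alpha>h X20[OF x] g] by blast
      obtain k where "\<delta> k = d" unfolding \<delta>_def using from_nat_into_surj[OF cD d(1)] by blast
      then show ?thesis using Qeq[OF x] d(2) by blast
    qed
    \<comment> \<open>The cutting for \<open>g\<close>: on \<open>X2\<close> it fixes an element of
      \<open>D\<close> that moves \<open>\<alpha> x\<close> to \<open>\<alpha> (\<phi> g x)\<close>,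
      and everywhere the value of \<open>i\<close> at the image. With these fixed, a single element
      of \<open>D\<close> permutes the pieces of all levels.\<close>
    define e where "e x = to_nat (x \<in> X2, LEAST k. Q k x, i (\<phi> g x))" for x
    have em: "e \<in> \<mu> \<rightarrow>\<^sub>M count_space UNIV"
    proof -
      have [measurable]: "(\<lambda>x. i (\<phi> g x)) \<in> \<mu> \<rightarrow>\<^sub>M count_space UNIV" using measurable_compose[OF \<phi>m[OF g] im] .
      show ?thesis unfolding e_def by measurable
    qed
    have key: "c n (\<phi> g x) = c n (\<phi> g y)"
      if x: "x \<in> space \<mu>" and y: "y \<in> space \<mu>" and cc: "c n x = c n y" and ee: "e x = e y" for n x y
    proof -
      have e3: "x \<in> X2 \<longleftrightarrow> y \<in> X2" "(LEAST k. Q k x) = (LEAST k. Q k y)" "i (\<phi> g x) = i (\<phi> g y)"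
        using ee unfolding e_def by auto
      have "a (\<phi> g x) k = a (\<phi> g y) k" if k: "k < n" for k
      proof (cases "x \<in> X2")
        case False
        then show ?thesis using e3(1) X2g[OF g x] X2g[OF g y] by (simp add: a_def)
      next
        case True
        then have y2: "y \<in> X2" using e3(1) by simp
        define m where "m = (LEAST k. Q k x)"
        have mx: "\<alpha> (\<phi> g x) = \<zeta> (\<delta> m) (\<alpha> x)"
          using Qeq[OF True] LeastI_ex[OF Qex[OF True]] unfolding m_def by blast
        have my: "\<alpha> (\<phi> g y) = \<zeta> (\<delta> m) (\<alpha> y)"
          using Qeq[OF y2] LeastI_ex[OF Qex[OF y2]] unfolding m_def e3(2) by blast
        have "map (a x) [0..<n] = map (a y) [0..<n]" using cc by (simp add: c_def)
        then have "a x k = a y k" using k by simp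
        then have same: "cls k (\<alpha> x) = cls k (\<alpha> y)" using a_eq[OF True y2] by blast
        have cx: "cls k (\<alpha> x) \<in> P k" "\<alpha> x \<in> cls k (\<alpha> x)" using cls[OF \<alpha>s[OF X20[OF True]]] by auto
        have cy: "\<alpha> y \<in> cls k (\<alpha> x)" unfolding same using cls[OF \<alpha>s[OF X20[OF y2]]] by auto
        have im: "\<zeta> (\<delta> m) ` cls k (\<alpha> x) \<in> P k" by (rule Pinv[OF \<delta> cx(1)])
        have "cls k (\<alpha> (\<phi> g x)) = \<zeta> (\<delta> m) ` cls k (\<alpha> x)" "cls k (\<alpha> (\<phi> g y)) = \<zeta> (\<delta> m) ` cls k (\<alpha> x)"
          unfolding mx my using im cx(2) cy by (auto intro!: cls_eq)
        then show ?thesis using a_eq X2g[OF g x] X2g[OF g y] True y2 by simp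
      qed
      then show ?thesis using e3(3) by (simp add: c_def)
    qed
    show "C.label_compatible (\<phi> g)"
      unfolding C.label_compatible_def
      using completion_preserving[OF \<phi>m[OF g] \<phi>d[OF g]] measurable_completion[OF em] key[unfolded space_completion[symmetric, of \<mu>]]
      by blast
  qed
qed

theorem corollary3:
  fixes G :: "('g, 'm) monoid_scheme"
    and \<mu> :: "'x measure" and \<phi> :: "'g \<Rightarrow> 'x \<Rightarrow> 'x"
    and \<nu> :: "'y measure" and \<psi> :: "'g \<Rightarrow> 'y \<Rightarrow> 'y"
    and p :: "'x \<Rightarrow> 'y" and X0 :: "'x set"
  assumes "pmp_action G \<mu> \<phi>"
    and "pmp_action G \<nu> \<psi>"
    and "factor_map G \<mu> \<phi> \<nu> \<psi> p"
    and "hcarrier (L2_0 \<nu>) \<noteq> {hzero (L2_0 \<nu>)}"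
    and "\<not> amenable_rep G (L2_0 \<nu>) (koopman G \<nu> \<psi>)"
    and "X0 \<in> sets (completion \<mu>)"
    and "emeasure (completion \<mu>) X0 = 1"
    and "\<forall>g\<in>carrier G. \<phi> g ` X0 = X0"
  shows "antimodular TYPE('d) TYPE('z) G (restrict_space \<mu> X0) (\<lambda>g. restrict (\<phi> g) X0)"
  unfolding antimodular_def
proof
  assume "\<exists>(D :: 'd monoid) (N :: 'z measure) \<zeta> \<alpha>. modular_action D N \<zeta> \<and>
    countable_to_one_borel_hom (restrict_space \<mu> X0)
      (orbit_eqrel G (restrict_space \<mu> X0) (\<lambda>g. restrict (\<phi> g) X0)) N (orbit_eqrel D N \<zeta>) \<alpha>"
  then obtain D :: "'d monoid" and Z :: "'z measure" and \<zeta> \<alpha> where mod: "modular_action D Z \<zeta>"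
    and hom: "countable_to_one_borel_hom (restrict_space \<mu> X0)
      (orbit_eqrel G (restrict_space \<mu> X0) (\<lambda>g. restrict (\<phi> g) X0)) Z (orbit_eqrel D Z \<zeta>) \<alpha>" by blast
  let ?M = "completion \<mu>"
  have act: "group_action G (space \<mu>) \<phi>" and actY: "group_action G (space \<nu>) \<psi>" and N: "prob_space \<nu>"
    and \<psi>: "\<And>g. g \<in> carrier G \<Longrightarrow> \<psi> g \<in> \<nu> \<rightarrow>\<^sub>M \<nu>" "\<And>g. g \<in> carrier G \<Longrightarrow> distr \<nu> \<nu> (\<psi> g) = \<nu>"
    using assms(1,2) by (auto simp: pmp_action_def borel_action_def)
  interpret A: group_action G "space \<mu>" \<phi> by fact
  interpret B: group_action G "space \<nu>" \<psi> by fact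
  interpret group G using A.group_hom group_hom.axioms(1) by auto
  have p: "p \<in> ?M \<rightarrow>\<^sub>M \<nu>" "distr ?M \<nu> p = \<nu>" and eq: "\<And>g. g \<in> carrier G \<Longrightarrow> AE x in ?M. p (\<phi> g x) = \<psi> g (p x)"
    using assms(3) by (auto simp: factor_map_def AE_completion_iff)
  obtain c :: "nat \<Rightarrow> 'x \<Rightarrow> nat list \<times> nat" where rl: "refining_labels ?M c"
    and ap: "\<And>A. A \<in> sets ?M \<Longrightarrow> refining_labels.approximable ?M c A"
    and comp: "\<And>g. g \<in> carrier G \<Longrightarrow> refining_labels.label_compatible ?M c (\<phi> g)"
    by (rule modular_hom_labels[OF assms(1,6,7,8) mod hom]) blast
  interpret refining_labels ?M c by (rule rl)
  obtain A where A: "A \<in> sets \<nu>" "0 < measure \<nu> A" "measure \<nu> A < 1"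
    by (rule L2_0_nontrivial_set[OF N assms(4)])
  show False
  proof (rule factor_densities[OF ap N p])
    fix h :: "nat \<Rightarrow> 'y \<times> 'y \<Rightarrow> real"
    assume h: "\<And>n z. h n z \<ge> 0" "\<And>n. integrable (\<nu> \<Otimes>\<^sub>M \<nu>) (h n)" "\<And>n. (\<integral>z. h n z \<partial>(\<nu> \<Otimes>\<^sub>M \<nu>)) = 1"
    and hA: "\<And>A. A \<in> sets \<nu> \<Longrightarrow> (\<lambda>n. \<integral>z. h n z * indicator {z. (fst z \<in> A) \<noteq> (snd z \<in> A)} z \<partial>(\<nu> \<Otimes>\<^sub>M \<nu>)) \<longlonglongrightarrow> 0"
    and hT: "\<And>S S' T T'. label_compatible S \<Longrightarrow> label_compatible S' \<Longrightarrow> (\<And>x. x \<in> space ?M \<Longrightarrow> S' (S x) = x) \<Longrightarrow>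
      T \<in> \<nu> \<rightarrow>\<^sub>M \<nu> \<Longrightarrow> distr \<nu> \<nu> T = \<nu> \<Longrightarrow> T' \<in> \<nu> \<rightarrow>\<^sub>M \<nu> \<Longrightarrow> (\<And>y. y \<in> space \<nu> \<Longrightarrow> T' (T y) = y) \<Longrightarrow>
      (AE x in ?M. p (S x) = T (p x)) \<Longrightarrow> (\<lambda>n. \<integral>z. \<bar>h n (map_prod T T z) - h n z\<bar> \<partial>(\<nu> \<Otimes>\<^sub>M \<nu>)) \<longlonglongrightarrow> 0"
    show False
    proof (rule almost_invariant_lists[OF N h A hA[OF A(1)]])
      fix L :: "nat \<Rightarrow> (real \<times> 'y set \<times> 'y set) list"
      assume L: "\<And>n. L n \<in> rect_lists \<nu> \<nu>" "\<And>n. sqint (\<nu> \<Otimes>\<^sub>M \<nu>) (centred \<nu> (L n)) = 1"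
    and LT: "\<And>T. T \<in> \<nu> \<rightarrow>\<^sub>M \<nu> \<Longrightarrow> distr \<nu> \<nu> T = \<nu> \<Longrightarrow>
      (\<lambda>n. \<integral>z. \<bar>h n (map_prod T T z) - h n z\<bar> \<partial>(\<nu> \<Otimes>\<^sub>M \<nu>)) \<longlonglongrightarrow> 0 \<Longrightarrow>
      (\<lambda>n. sqint (\<nu> \<Otimes>\<^sub>M \<nu>) (\<lambda>z. centred \<nu> (L n) (map_prod T T z) - centred \<nu> (L n) z)) \<longlonglongrightarrow> 0"
      have "amenable_rep G (L2_0 \<nu>) (koopman G \<nu> \<psi>)"
      proof (rule amenable_koopmanI[OF N group_axioms \<psi> L])
        fix g assume g: "g \<in> carrier G"
        then have ig: "inv\<^bsub>G\<^esub> g \<in> carrier G" by simp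
        show "(\<lambda>n. sqint (\<nu> \<Otimes>\<^sub>M \<nu>) (\<lambda>z. centred \<nu> (L n) (map_prod (\<psi> g) (\<psi> g) z) - centred \<nu> (L n) z)) \<longlonglongrightarrow> 0"
        \<comment> \<open>Both \<open>\<phi> g\<close> and its inverse are compatible with the
          labels, which supplies the two cuttings behind the asymptotic invariance.\<close>
        proof (rule LT[OF \<psi>[OF g]], rule hT[OF comp[OF g] comp[OF ig] _ \<psi>[OF g] \<psi>(1)[OF ig] _ eq[OF g]])
          show "\<phi> (inv\<^bsub>G\<^esub> g) (\<phi> g x) = x" if "x \<in> space ?M" for x
            using A.orbit_sym_aux[OF g _ refl] that by simp
          show "\<psi> (inv\<^bsub>G\<^esub> g) (\<psi> g y) = y" if "y \<in> space \<nu>" for y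
            using B.orbit_sym_aux[OF g _ refl] that by simp
        qed
      qed
      then show False using assms(5) by contradiction
    qed
  qed
qed

end
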